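(* Let $T>0$, $\sigma\neq0$, and let $(k_n)_{n\ge1}$ be positive real numbers, with $k_0=0$. For every $x=(x_n)_{n\ge1}\in l^2$ there exists a weak solution on $[0,T]$ of the stochastic dyadic model with initial condition $x$ which is of class $L^\infty$, i.e. there is a constant $C>0$ with $\sum_{n=1}^\infty X_n^2(t)\le C$ for a.e. $(\omega,t)\in\Omega\times[0,T]$.
   Context: A filtered probability space $(\Omega,F_t,P)$ on $[0,T]$ means a probability space $(\Omega,F_T,P)$ with a right-continuous filtration $(F_t)_{t\in[0,T]}$. Given $x\in l^2$, a weak solution is a filtered probability space $(\Omega,F_t,P)$, a sequence $(W_n)_{n\ge1}$ of independent Brownian motions on it, and an $l^2$-valued process $X=(X_n)_{n\ge1}$ with continuous adapted components such that for each $n\ge1$ and $t\in[0,T]$, $$X_n(t)=x_n+\int_0^t\big(k_{n-1}X_{n-1}^2(s)-k_nX_n(s)X_{n+1}(s)\big)ds+\int_0^t\sigma k_{n-1}X_{n-1}(s)\,dW_{n-1}(s)-\int_0^t\sigma k_nX_{n+1}(s)\,dW_n(s)-\int_0^t\frac{\sigma^2}{2}(k_n^2+k_{n-1}^2)X_n(s)\,ds,$$ with $k_0=0$ and $X_0\equiv0$. *)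

theory Defs
  imports "HOL-Probability.Probability"
begin

definition filtered_prob_space :: "'a measure \<Rightarrow> (real \<Rightarrow> 'a measure) \<Rightarrow> real \<Rightarrow> bool" where
  "filtered_prob_space M F T \<longleftrightarrow>
     prob_space M \<and>
     (\<forall>t\<in>{0..T}. space (F t) = space M \<and> sets (F t) \<subseteq> sets M) \<and>
     (\<forall>s t. 0 \<le> s \<and> s \<le> t \<and> t \<le> T \<longrightarrow> sets (F s) \<subseteq> sets (F t)) \<and>
     sets (F T) = sets M \<and>
     (\<forall>t. 0 \<le> t \<and> t < T \<longrightarrow> sets (F t) = (\<Inter>s\<in>{t<..T}. sets (F s)))"

definition brownian_motion :: "'a measure \<Rightarrow> (real \<Rightarrow> 'a measure) \<Rightarrow> real \<Rightarrow> (real \<Rightarrow> 'a \<Rightarrow> real) \<Rightarrow> bool" where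
  "brownian_motion M F T W \<longleftrightarrow>
     (\<forall>\<omega>\<in>space M. W 0 \<omega> = 0 \<and> continuous_on {0..T} (\<lambda>t. W t \<omega>)) \<and>
     (\<forall>t\<in>{0..T}. W t \<in> borel_measurable (F t)) \<and>
     (\<forall>s t. 0 \<le> s \<and> s < t \<and> t \<le> T \<longrightarrow>
        distributed M lborel (\<lambda>\<omega>. W t \<omega> - W s \<omega>) (normal_density 0 (sqrt (t - s))) \<and>
        (\<forall>A\<in>sets (F s). \<forall>B\<in>sets borel.
           measure M (A \<inter> {\<omega>\<in>space M. W t \<omega> - W s \<omega> \<in> B}) =
           measure M A * measure M {\<omega>\<in>space M. W t \<omega> - W s \<omega> \<in> B}))"

text \<open>I is (a version of) the Ito integral of the continuous adapted integrand H against W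
  over [0,t]: the limit in probability of left-point Riemann sums as the mesh tends to 0.\<close>
definition ito_integral :: "'a measure \<Rightarrow> (real \<Rightarrow> 'a \<Rightarrow> real) \<Rightarrow> (real \<Rightarrow> 'a \<Rightarrow> real) \<Rightarrow> real \<Rightarrow> ('a \<Rightarrow> real) \<Rightarrow> bool" where
  "ito_integral M H W t I \<longleftrightarrow>
     I \<in> borel_measurable M \<and>
     (\<forall>\<epsilon>>0. \<exists>\<delta>>0. \<forall>(p :: nat \<Rightarrow> real) (N :: nat).
        p 0 = 0 \<and> p N = t \<and> (\<forall>i<N. p i < p (Suc i) \<and> p (Suc i) - p i < \<delta>) \<longrightarrow>
        measure M {\<omega>\<in>space M.
           \<epsilon> < \<bar>(\<Sum>i<N. H (p i) \<omega> * (W (p (Suc i)) \<omega> - W (p i) \<omega>)) - I \<omega>\<bar>} < \<epsilon>)"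

text \<open>Weak solution of the stochastic dyadic model on [0,T] with initial condition x.
  Indices n \<ge> 1 are the physical ones; X 0 \<equiv> 0 and k 0 = 0 are conventions.\<close>
definition weak_solution :: "real \<Rightarrow> real \<Rightarrow> (nat \<Rightarrow> real) \<Rightarrow> (nat \<Rightarrow> real) \<Rightarrow> 'a measure \<Rightarrow>
    (real \<Rightarrow> 'a measure) \<Rightarrow> (nat \<Rightarrow> real \<Rightarrow> 'a \<Rightarrow> real) \<Rightarrow> (nat \<Rightarrow> real \<Rightarrow> 'a \<Rightarrow> real) \<Rightarrow> bool" where
  "weak_solution T \<sigma> k x M F W X \<longleftrightarrow>
     filtered_prob_space M F T \<and>
     (\<forall>n\<ge>1. brownian_motion M F T (W n)) \<and>
     prob_space.indep_vars M (\<lambda>_. PiM {0..T} (\<lambda>_. borel))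
        (\<lambda>n \<omega>. restrict (\<lambda>t. W n t \<omega>) {0..T}) {1..} \<and>
     (\<forall>t \<omega>. X 0 t \<omega> = 0) \<and>
     (\<forall>n\<ge>1. \<forall>\<omega>\<in>space M. continuous_on {0..T} (\<lambda>t. X n t \<omega>)) \<and>
     (\<forall>n\<ge>1. \<forall>t\<in>{0..T}. X n t \<in> borel_measurable (F t)) \<and>
     (\<forall>t\<in>{0..T}. \<forall>\<omega>\<in>space M. summable (\<lambda>n. (X n t \<omega>)\<^sup>2)) \<and>
     (\<forall>n\<ge>1. \<forall>t\<in>{0..T}. \<exists>I1 I2.
        ito_integral M (\<lambda>s \<omega>. \<sigma> * k (n - 1) * X (n - 1) s \<omega>) (W (n - 1)) t I1 \<and>
        ito_integral M (\<lambda>s \<omega>. \<sigma> * k n * X (Suc n) s \<omega>) (W n) t I2 \<and>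
        (AE \<omega> in M. X n t \<omega> = x n
            + integral {0..t} (\<lambda>s. k (n - 1) * (X (n - 1) s \<omega>)\<^sup>2 - k n * X n s \<omega> * X (Suc n) s \<omega>)
            + I1 \<omega> - I2 \<omega>
            - integral {0..t} (\<lambda>s. \<sigma>\<^sup>2 / 2 * ((k n)\<^sup>2 + (k (n - 1))\<^sup>2) * X n s \<omega>)))"

end

theory Submission
  imports Defs
begin

text \<open>
  In Stratonovich form the system is \<open>dX = \<Sum>\<^sub>n k\<^sub>n (X\<^sub>n dt + \<sigma> \<circ> dW\<^sub>n) J\<^sub>n X\<close>, where \<open>J\<^sub>n\<close> generates the rotations
  in the plane of the modes \<open>n\<close> and \<open>n + 1\<close>.  Hence an Euler scheme which composes, in each time step, the
  rotations by the angles \<open>k\<^sub>n (h X\<^sub>n + \<sigma> \<Delta>W\<^sub>n)\<close> never increases the energy.  Discrete martingale estimates show that,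
  for each mode, the increments of \<open>X\<close>, of \<open>W\<close> and of the two stochastic integrals have fourth moments
  of order \<open>|t - s|\<^sup>2\<close>, and that the equation and the left-point Riemann sums hold in mean square up to the mesh.

  All these statements concern finitely many dyadic times, so it suffices to pass to the limit in law for the
  countable family of values at dyadic times.  This family is coded continuously into one real number, so that
  Helly's selection theorem and Skorohod's theorem on the real line provide copies converging almost surely.
  Kolmogorov's continuity criterion turns the limit into continuous processes, and Fatou's lemma transfers the
  mean square estimates, which identify the stochastic integrals and the equation.
\<close>

section \<open>Limits of laws and of independence\<close>

text \<open>The coefficients \<open>k\<close> may grow at any rate, so no bound is uniform in the
  mode. Each estimate concerns one mode and three neighbouring planes, with a constant of its own;
  the energy bound alone is uniform, and it keeps all integrands bounded. A plain Euler step would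
  lose it, since Gaussian increments are unbounded; a rotation keeps it for every angle. Taylor
  expansion of a rotation yields the drift, the Ito correction (from the cosines) and centred terms
  of size h per step, whose sums are small only by orthogonality. For this the planes act in
  increasing order: the value entering plane n has met only lower planes in the current step and is
  independent of the fresh noise of plane n. In the coding it is the decoding that has to be
  continuous. Binary digits written to base 4 form a Cantor set, where convergence makes every digit
  eventually constant. A limit at an end of the squashed line would mean escape to infinity; second
  moments exclude it. Riemann sums are controlled at rate \<open>\<delta>\<close> for every
  partition of mesh \<open>\<delta>\<close>, the form that Chebyshev's inequality turns into
  convergence in probability.\<close>

definition closed_bump :: "nat \<Rightarrow> 'a::metric_space set \<Rightarrow> 'a \<Rightarrow> real" where
  "closed_bump k A x = (if A = {} then 0 else max 0 (1 - real k * infdist x A))"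

lemma closed_bump_bounds: "0 \<le> closed_bump k A x" "closed_bump k A x \<le> 1"
  by (auto simp: closed_bump_def infdist_nonneg)

lemma continuous_on_closed_bump: "continuous_on UNIV (closed_bump k A)"
  unfolding closed_bump_def by (cases "A = {}") (auto intro!: continuous_intros)

lemma borel_measurable_closed_bump [measurable]: "closed_bump k A \<in> borel_measurable borel"
  by (rule borel_measurable_continuous_onI[OF continuous_on_closed_bump])

text \<open>A point outside a closed set has positive distance d from it, so the bump vanishes as
  soon as k > 1/d. For the empty set \<open>infdist\<close> is 0 and the formula would give 1; this
  is why \<open>closed_bump\<close> treats that case apart.\<close>

lemma closed_bump_tendsto:
  assumes "closed A"
  shows "(\<lambda>k. closed_bump k A x) \<longlonglongrightarrow> indicator A x"
proof (cases "x \<in> A")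
  case True
  then have "closed_bump k A x = 1" for k by (auto simp: closed_bump_def)
  then show ?thesis using True by simp
next
  case False
  show ?thesis
  proof (cases "A = {}")
    case True
    then show ?thesis by (auto simp: closed_bump_def)
  next
    case ne: False
    then have pos: "infdist x A > 0"
      using infdist_pos_not_in_closed[OF assms] False by auto
    obtain K :: nat where K: "1 / infdist x A < real K" using reals_Archimedean2 by blast
    have "closed_bump k A x = 0" if "k \<ge> K" for k
    proof -
      have "1 / infdist x A < real k" using K that by linarith
      then have "1 < real k * infdist x A" using pos by (simp add: divide_simps)
      then show ?thesis by (auto simp: closed_bump_def)
    qed
    then have "eventually (\<lambda>k. closed_bump k A x = indicator A x) sequentially"
      using False by (auto simp: eventually_sequentially)
    then show ?thesis by (rule tendsto_eventually)
  qed
qed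

lemma closed_bump_tendsto_arg: "(u \<longlonglongrightarrow> x) \<Longrightarrow> (\<lambda>N. closed_bump k A (u N)) \<longlonglongrightarrow> closed_bump k A x"
  using continuous_on_closed_bump[of k A]
  by (auto simp: continuous_on_eq_continuous_within intro: isCont_tendsto_compose)

lemma sets_borel_closed: "sets (borel :: 'a::topological_space measure) = sigma_sets UNIV {A. closed A}"
  by (subst borel_eq_closed) simp

text \<open>Bounded continuous test functions pass to the almost sure limit by dominated
  convergence, and the bumps then decrease to closed sets, an intersection-stable generator. The
  laws are eventually equal to \<open>\<nu>\<close> instead of merely converging to it, because
  increments are normalised to unit variance before use.\<close>

lemma (in prob_space) distr_limit:
  fixes V :: "'a \<Rightarrow> 'b::metric_space"
  assumes U [measurable]: "\<And>N. U N \<in> borel_measurable M" and V [measurable]: "V \<in> borel_measurable M"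
    and lim: "AE \<omega> in M. (\<lambda>N. U N \<omega>) \<longlonglongrightarrow> V \<omega>"
    and law: "\<forall>\<^sub>F N in sequentially. distr M borel (U N) = \<nu>"
  shows "distr M borel V = \<nu>"
proof -
  obtain N0 where N0: "distr M borel (U N0) = \<nu>"
    using law by (auto simp: eventually_sequentially)
  have sets_nu [measurable_cong]: "sets \<nu> = sets borel" by (simp flip: N0)
  have nu: "prob_space \<nu>" unfolding N0[symmetric] by (rule prob_space_distr) simp
  interpret nu: prob_space \<nu> by fact
  interpret dV: prob_space "distr M borel V" by (rule prob_space_distr) simp
  have eq: "measure (distr M borel V) A = measure \<nu> A" if A: "closed A" for A
  proof -
    have [measurable]: "A \<in> sets borel" using A by (rule borel_closed)
    have int: "(\<integral>\<omega>. closed_bump k A (V \<omega>) \<partial>M) = (\<integral>x. closed_bump k A x \<partial>\<nu>)" for k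
    proof (rule LIMSEQ_unique)
      show "(\<lambda>N. \<integral>\<omega>. closed_bump k A (U N \<omega>) \<partial>M) \<longlonglongrightarrow> (\<integral>\<omega>. closed_bump k A (V \<omega>) \<partial>M)"
      proof (rule integral_dominated_convergence[where w="\<lambda>_. 1"])
        show "AE \<omega> in M. (\<lambda>N. closed_bump k A (U N \<omega>)) \<longlonglongrightarrow> closed_bump k A (V \<omega>)"
          using lim by eventually_elim (rule closed_bump_tendsto_arg)
      qed (auto simp: closed_bump_bounds)
      have "\<forall>\<^sub>F N in sequentially. (\<integral>\<omega>. closed_bump k A (U N \<omega>) \<partial>M) = (\<integral>x. closed_bump k A x \<partial>\<nu>)"
        using law
      proof eventually_elim
        case (elim N)
        show ?case by (subst elim[symmetric]) (simp add: integral_distr)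
      qed
      then show "(\<lambda>N. \<integral>\<omega>. closed_bump k A (U N \<omega>) \<partial>M) \<longlonglongrightarrow> (\<integral>x. closed_bump k A x \<partial>\<nu>)"
        by (rule tendsto_eventually)
    qed
    have gen: "(\<lambda>k. \<integral>x. closed_bump k A x \<partial>\<mu>) \<longlonglongrightarrow> measure \<mu> A"
      if mu: "prob_space \<mu>" and [measurable_cong]: "sets \<mu> = sets borel" for \<mu> :: "'b measure"
    proof -
      interpret mu: prob_space \<mu> by fact
      have "(\<lambda>k. \<integral>x. closed_bump k A x \<partial>\<mu>) \<longlonglongrightarrow> (\<integral>x. indicator A x \<partial>\<mu>)"
        by (rule integral_dominated_convergence[where w="\<lambda>_. 1"])
          (auto simp: closed_bump_bounds closed_bump_tendsto A)
      then show ?thesis by (simp add: Int_absorb2 sets.sets_into_space)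
    qed
    have "(\<lambda>k. \<integral>x. closed_bump k A x \<partial>(distr M borel V)) \<longlonglongrightarrow> measure (distr M borel V) A"
      by (rule gen) (auto intro: dV.prob_space_axioms)
    moreover have "(\<lambda>k. \<integral>x. closed_bump k A x \<partial>\<nu>) \<longlonglongrightarrow> measure \<nu> A"
      by (rule gen[OF nu sets_nu])
    ultimately show ?thesis
      using int LIMSEQ_unique by (force simp: integral_distr)
  qed
  show ?thesis
  proof (rule measure_eqI_generator_eq[where E="{A. closed A}" and \<Omega>=UNIV and A="\<lambda>_. UNIV"])
    show "Int_stable {A :: 'b set. closed A}" by (auto simp: Int_stable_def)
    show "emeasure (distr M borel V) X = emeasure \<nu> X" if "X \<in> {A. closed A}" for X
      using eq[of X] that by (simp add: dV.emeasure_eq_measure nu.emeasure_eq_measure)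
    show "sets (distr M borel V) = sigma_sets UNIV {A. closed A}" by (simp add: sets_borel_closed)
    show "sets \<nu> = sigma_sets UNIV {A. closed A}" by (simp add: sets_nu sets_borel_closed)
  qed (auto simp: dV.emeasure_eq_measure)
qed

lemma (in prob_space) indep_vars_finite_subsets:
  "indep_vars M' X I \<longleftrightarrow>
    (\<forall>i\<in>I. random_variable (M' i) (X i)) \<and> (\<forall>J\<subseteq>I. J \<noteq> {} \<longrightarrow> finite J \<longrightarrow> indep_vars M' X J)"
  unfolding indep_vars_def2 by (subst indep_sets_finite_index_sets) auto

text \<open>For finitely many variables, expectations of products of bumps factorise. This is an
  identity between integrals of bounded continuous functions and survives almost sure limits;
  letting the bumps shrink to closed sets gives the product rule on a generator. The values lie in
  any metric space, so that \<open>V i\<close> may be a whole sequence of samples.\<close>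

lemma (in prob_space) indep_vars_limit:
  fixes V :: "'i \<Rightarrow> 'a \<Rightarrow> 'b::metric_space"
  assumes U [measurable]: "\<And>N i. i \<in> I \<Longrightarrow> U N i \<in> borel_measurable M"
    and V [measurable]: "\<And>i. i \<in> I \<Longrightarrow> V i \<in> borel_measurable M"
    and lim: "\<And>i. i \<in> I \<Longrightarrow> AE \<omega> in M. (\<lambda>N. U N i \<omega>) \<longlonglongrightarrow> V i \<omega>"
    and indep: "\<forall>\<^sub>F N in sequentially. indep_vars (\<lambda>_. borel) (U N) I"
  shows "indep_vars (\<lambda>_. borel) V I"
proof (subst indep_vars_finite_subsets, intro conjI ballI allI impI V)
  fix J assume J: "J \<subseteq> I" "J \<noteq> {}" "finite J"
  have mJ [measurable]: "U N j \<in> borel_measurable M" "V j \<in> borel_measurable M" if "j \<in> J" for N j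
    using J that by auto
  show "indep_vars (\<lambda>_. borel) V J"
  proof (subst indep_vars_finite[where E="\<lambda>_. {A. closed A}"])
    show "\<forall>A\<in>(\<Pi> i\<in>J. {A. closed A}). prob (\<Inter>j\<in>J. V j -` A j \<inter> space M) = (\<Prod>j\<in>J. prob (V j -` A j \<inter> space M))"
    proof
      fix A :: "'i \<Rightarrow> 'b set" assume "A \<in> (\<Pi> i\<in>J. {A. closed A})"
      then have A: "closed (A j)" if "j \<in> J" for j using that by auto
      then have [measurable]: "A j \<in> sets borel" if "j \<in> J" for j using that by (auto intro: borel_closed)
      have bnd: "norm (\<Prod>j\<in>J. closed_bump k (A j) (f j)) \<le> 1" for k f
      proof -
        have "norm (\<Prod>j\<in>J. closed_bump k (A j) (f j)) = (\<Prod>j\<in>J. closed_bump k (A j) (f j))"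
          by (simp add: prod_nonneg closed_bump_bounds)
        also have "\<dots> \<le> 1" by (intro prod_le_1) (auto simp: closed_bump_bounds)
        finally show ?thesis .
      qed
      have int: "(\<integral>\<omega>. (\<Prod>j\<in>J. closed_bump k (A j) (V j \<omega>)) \<partial>M) = (\<Prod>j\<in>J. \<integral>\<omega>. closed_bump k (A j) (V j \<omega>) \<partial>M)" for k
      proof (rule LIMSEQ_unique)
        show "(\<lambda>N. \<integral>\<omega>. (\<Prod>j\<in>J. closed_bump k (A j) (U N j \<omega>)) \<partial>M) \<longlonglongrightarrow> (\<integral>\<omega>. (\<Prod>j\<in>J. closed_bump k (A j) (V j \<omega>)) \<partial>M)"
        proof (rule integral_dominated_convergence[where w="\<lambda>_. 1"])
          have "AE \<omega> in M. \<forall>j\<in>J. (\<lambda>N. U N j \<omega>) \<longlonglongrightarrow> V j \<omega>"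
            using J lim by (intro AE_finite_allI) auto
          then show "AE \<omega> in M. (\<lambda>N. \<Prod>j\<in>J. closed_bump k (A j) (U N j \<omega>)) \<longlonglongrightarrow> (\<Prod>j\<in>J. closed_bump k (A j) (V j \<omega>))"
            by eventually_elim (intro tendsto_prod closed_bump_tendsto_arg, auto)
        qed (use bnd in \<open>auto intro!: borel_measurable_prod\<close>)
        have "(\<lambda>N. \<Prod>j\<in>J. \<integral>\<omega>. closed_bump k (A j) (U N j \<omega>) \<partial>M) \<longlonglongrightarrow> (\<Prod>j\<in>J. \<integral>\<omega>. closed_bump k (A j) (V j \<omega>) \<partial>M)"
        proof (intro tendsto_prod integral_dominated_convergence[where w="\<lambda>_. 1"])
          fix j assume "j \<in> J"
          then have "AE \<omega> in M. (\<lambda>N. U N j \<omega>) \<longlonglongrightarrow> V j \<omega>" using J lim by auto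
          then show "AE \<omega> in M. (\<lambda>N. closed_bump k (A j) (U N j \<omega>)) \<longlonglongrightarrow> closed_bump k (A j) (V j \<omega>)"
            by eventually_elim (rule closed_bump_tendsto_arg)
        qed (auto simp: closed_bump_bounds)
        moreover have "\<forall>\<^sub>F N in sequentially. (\<Prod>j\<in>J. \<integral>\<omega>. closed_bump k (A j) (U N j \<omega>) \<partial>M)
            = (\<integral>\<omega>. (\<Prod>j\<in>J. closed_bump k (A j) (U N j \<omega>)) \<partial>M)"
          using indep
        proof eventually_elim
          case (elim N)
          have "indep_vars (\<lambda>_. borel) (U N) J" by (rule indep_vars_subset[OF elim J(1)])
          then have "indep_vars (\<lambda>_. borel) (\<lambda>j \<omega>. closed_bump k (A j) (U N j \<omega>)) J"
            by (rule indep_vars_compose2) auto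
          then show ?case
            by (subst indep_vars_lebesgue_integral)
              (use J in \<open>auto intro!: integrable_const_bound[where B=1] simp: closed_bump_bounds\<close>)
        qed
        ultimately show "(\<lambda>N. \<integral>\<omega>. (\<Prod>j\<in>J. closed_bump k (A j) (U N j \<omega>)) \<partial>M) \<longlonglongrightarrow> (\<Prod>j\<in>J. \<integral>\<omega>. closed_bump k (A j) (V j \<omega>) \<partial>M)"
          by (rule Lim_transform_eventually)
      qed
      have "prob (\<Inter>j\<in>J. V j -` A j \<inter> space M) = (\<integral>\<omega>. (\<Prod>j\<in>J. indicator (A j) (V j \<omega>)) \<partial>M)"
      proof -
        have meas: "(\<Inter>j\<in>J. V j -` A j \<inter> space M) \<in> sets M"
          using J by (intro sets.finite_INT) auto
        have "prob (\<Inter>j\<in>J. V j -` A j \<inter> space M) = (\<integral>\<omega>. indicator (\<Inter>j\<in>J. V j -` A j \<inter> space M) \<omega> \<partial>M)"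
          using meas by (simp add: Int_absorb2 sets.sets_into_space)
        also have "\<dots> = (\<integral>\<omega>. (\<Prod>j\<in>J. indicator (A j) (V j \<omega>)) \<partial>M)"
        proof (rule Bochner_Integration.integral_cong[OF refl])
          fix \<omega> assume w: "\<omega> \<in> space M"
          show "indicator (\<Inter>j\<in>J. V j -` A j \<inter> space M) \<omega> = (\<Prod>j\<in>J. indicator (A j) (V j \<omega>) :: real)"
          proof (cases "\<forall>j\<in>J. V j \<omega> \<in> A j")
            case True
            then show ?thesis using w by (auto intro!: prod.neutral[symmetric])
          next
            case False
            then show ?thesis using w J(3) by (auto simp: prod_zero_iff indicator_def)
          qed
        qed
        finally show ?thesis .
      qed
      moreover have "(\<lambda>k. \<integral>\<omega>. (\<Prod>j\<in>J. closed_bump k (A j) (V j \<omega>)) \<partial>M) \<longlonglongrightarrow> (\<integral>\<omega>. (\<Prod>j\<in>J. indicator (A j) (V j \<omega>)) \<partial>M)"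
        by (rule integral_dominated_convergence[where w="\<lambda>_. 1"])
          (use bnd in \<open>auto intro!: borel_measurable_prod tendsto_prod closed_bump_tendsto A\<close>)
      moreover have "(\<lambda>k. \<Prod>j\<in>J. \<integral>\<omega>. closed_bump k (A j) (V j \<omega>) \<partial>M) \<longlonglongrightarrow> (\<Prod>j\<in>J. prob (V j -` A j \<inter> space M))"
      proof (intro tendsto_prod)
        fix j assume j: "j \<in> J"
        have "(\<lambda>k. \<integral>\<omega>. closed_bump k (A j) (V j \<omega>) \<partial>M) \<longlonglongrightarrow> (\<integral>\<omega>. indicator (A j) (V j \<omega>) \<partial>M)"
          by (rule integral_dominated_convergence[where w="\<lambda>_. 1"])
            (use j in \<open>auto simp: closed_bump_bounds intro!: closed_bump_tendsto A\<close>)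
        also have "(\<integral>\<omega>. indicator (A j) (V j \<omega>) \<partial>M) = (\<integral>\<omega>. (indicator (V j -` A j \<inter> space M) \<omega> :: real) \<partial>M)"
          by (intro Bochner_Integration.integral_cong) (auto simp: indicator_def)
        also have "\<dots> = prob (V j -` A j \<inter> space M)"
          using j by (simp add: Int_absorb2 sets.sets_into_space)
        finally show "(\<lambda>k. \<integral>\<omega>. closed_bump k (A j) (V j \<omega>) \<partial>M) \<longlonglongrightarrow> prob (V j -` A j \<inter> space M)" .
      qed
      ultimately show "prob (\<Inter>j\<in>J. V j -` A j \<inter> space M) = (\<Prod>j\<in>J. prob (V j -` A j \<inter> space M))"
        using int LIMSEQ_unique by simp
    qed
  qed (use J in \<open>auto simp: sets_borel_closed Int_stable_def\<close>)
qed

text \<open>A pair is treated as a family over \<open>bool\<close>; hence both variables take values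
  in the same type.\<close>

lemma (in prob_space) indep_var_limit:
  fixes V V' :: "'a \<Rightarrow> 'b::metric_space"
  assumes U: "\<And>N. U N \<in> borel_measurable M" "\<And>N. U' N \<in> borel_measurable M"
    and V: "V \<in> borel_measurable M" "V' \<in> borel_measurable M"
    and lim: "AE \<omega> in M. (\<lambda>N. U N \<omega>) \<longlonglongrightarrow> V \<omega>" "AE \<omega> in M. (\<lambda>N. U' N \<omega>) \<longlonglongrightarrow> V' \<omega>"
    and indep: "\<forall>\<^sub>F N in sequentially. indep_var borel (U N) borel (U' N)"
  shows "indep_var borel V borel V'"
proof -
  have *: "case_bool borel borel = (\<lambda>_. borel)" by (auto simp: fun_eq_iff split: bool.split)
  show ?thesis
    using indep unfolding indep_var_def *
    by (intro indep_vars_limit[where U="\<lambda>N. case_bool (U N) (U' N)"])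
      (use U V lim in \<open>auto split: bool.split\<close>)
qed

text \<open>Fatou's lemma; the varying bound \<open>c N\<close> absorbs error terms, such as the
  time step, that disappear in the limit.\<close>

lemma (in prob_space) nn_integral_limit_le:
  fixes V :: "'a \<Rightarrow> real"
  assumes U [measurable]: "\<And>N. U N \<in> borel_measurable M"
    and lim: "AE \<omega> in M. (\<lambda>N. U N \<omega>) \<longlonglongrightarrow> V \<omega>"
    and le: "\<forall>\<^sub>F N in sequentially. (\<integral>\<^sup>+\<omega>. ennreal (U N \<omega>) \<partial>M) \<le> ennreal (c N)"
    and c: "c \<longlonglongrightarrow> C"
  shows "(\<integral>\<^sup>+\<omega>. ennreal (V \<omega>) \<partial>M) \<le> ennreal C"
proof -
  have "(\<integral>\<^sup>+\<omega>. ennreal (V \<omega>) \<partial>M) = (\<integral>\<^sup>+\<omega>. liminf (\<lambda>N. ennreal (U N \<omega>)) \<partial>M)"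
  proof (rule nn_integral_cong_AE)
    show "AE \<omega> in M. ennreal (V \<omega>) = liminf (\<lambda>N. ennreal (U N \<omega>))"
      using lim
    proof eventually_elim
      case (elim \<omega>)
      have "(\<lambda>N. ennreal (U N \<omega>)) \<longlonglongrightarrow> ennreal (V \<omega>)" using elim by (rule tendsto_ennrealI)
      then show ?case by (simp add: lim_imp_Liminf)
    qed
  qed
  also have "\<dots> \<le> liminf (\<lambda>N. \<integral>\<^sup>+\<omega>. ennreal (U N \<omega>) \<partial>M)" by (rule nn_integral_liminf) auto
  also have "\<dots> \<le> liminf (\<lambda>N. ennreal (c N))" by (rule Liminf_mono[OF le])
  also have "\<dots> = ennreal C" using c by (intro lim_imp_Liminf tendsto_ennrealI) auto
  finally show ?thesis .
qed

section \<open>Almost sure copies of a tight sequence\<close>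

definition base4_code :: "(nat \<Rightarrow> int) \<Rightarrow> real" where
  "base4_code b = (\<Sum>m. real_of_int (b m) / 4 ^ Suc m)"

definition base4_digit :: "nat \<Rightarrow> real \<Rightarrow> int" where
  "base4_digit m y = \<lfloor>4 ^ Suc m * y\<rfloor> mod 4"

lemma summable_digits:
  assumes "\<And>m. \<bar>real_of_int (b m)\<bar> \<le> 3" "q > 1"
  shows "summable (\<lambda>m. real_of_int (b m) / (q::real) ^ Suc m)"
proof (rule summable_comparison_test')
  show "summable (\<lambda>m. 3 / q * (1 / q) ^ m)" using assms(2) by (intro summable_mult summable_geometric) auto
  show "norm (real_of_int (b m) / q ^ Suc m) \<le> 3 / q * (1 / q) ^ m" if "m \<ge> 0" for m
    using assms by (auto simp: power_divide divide_simps)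
qed

text \<open>With digits 0 and 1 only, every tail of the base 4 expansion is at most 1/4 + 1/16 + ...
  = 1/3, so the fractional parts of \<open>4 ^ n * y\<close> stay away from 1. This gap makes the
  floor, hence each digit, stable under small perturbations.\<close>

lemma base4_code_floor:
  assumes b: "\<And>m. b m \<in> {0, 1}"
  shows "0 \<le> 4 ^ n * base4_code b - \<lfloor>4 ^ n * base4_code b\<rfloor>" "4 ^ n * base4_code b - \<lfloor>4 ^ n * base4_code b\<rfloor> \<le> 1 / 3"
    "base4_digit m (base4_code b) = b m"
proof -
  \<comment> \<open>\<open>t n\<close> is the rescaled tail behind the first n digits and
    \<open>K n\<close> the integer formed by these digits; the code times \<open>4 ^ n\<close> is
    their sum.\<close>
  define t where "t n = (\<Sum>l. real_of_int (b (l + n)) / 4 ^ Suc l)" for n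
  define K where "K = rec_nat 0 (\<lambda>n k. 4 * k + b n)"
  have K: "K 0 = 0" "K (Suc n) = 4 * K n + b n" for n by (auto simp: K_def)
  have b01: "0 \<le> b m" "b m \<le> 1" "\<bar>real_of_int (b m)\<bar> \<le> 3" for m using b[of m] by auto
  have sm: "summable (\<lambda>l. real_of_int (b (l + n)) / 4 ^ Suc l)" for n
    by (rule summable_digits) (use b01 in auto)
  have t0: "t 0 = base4_code b" by (simp add: t_def base4_code_def)
  have tS: "4 * t n = b n + t (Suc n)" for n
  proof -
    have "t n = b n / 4 + (\<Sum>l. real_of_int (b (Suc l + n)) / 4 ^ Suc (Suc l))"
      unfolding t_def using suminf_split_head[OF sm[of n]] by simp
    also have "(\<Sum>l. real_of_int (b (Suc l + n)) / 4 ^ Suc (Suc l)) = (\<Sum>l. (1/4) * (real_of_int (b (l + Suc n)) / 4 ^ Suc l))"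
      by (intro suminf_cong) simp
    also have "\<dots> = (1/4) * t (Suc n)" unfolding t_def by (rule suminf_mult[OF sm])
    finally show ?thesis by simp
  qed
  have tb: "0 \<le> t n" "t n \<le> 1 / 3" for n
  proof -
    show "0 \<le> t n" unfolding t_def by (rule suminf_nonneg[OF sm]) (use b01 in auto)
    have g: "(\<lambda>l. 1/4 * (1 / 4 :: real) ^ l) sums (1/4 * (1 / (1 - 1/4)))"
      by (intro sums_mult geometric_sums) auto
    have "t n \<le> (\<Sum>l. 1/4 * (1 / 4 :: real) ^ l)"
      unfolding t_def by (intro suminf_le sm sums_summable[OF g]) (use b01 in \<open>auto simp: power_divide divide_simps\<close>)
    also have "\<dots> = 1 / 3" using sums_unique[OF g] by simp
    finally show "t n \<le> 1 / 3" .
  qed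
  have eq: "4 ^ n * base4_code b = K n + t n" for n
  proof (induction n)
    case 0 then show ?case by (simp add: K t0)
  next
    case (Suc n)
    have "4 ^ Suc n * base4_code b = 4 * (4 ^ n * base4_code b)" by simp
    also have "\<dots> = 4 * K n + 4 * t n" unfolding Suc by simp
    finally show ?case by (simp add: K tS)
  qed
  have fl: "\<lfloor>4 ^ n * base4_code b\<rfloor> = K n" for n
    unfolding eq using tb[of n] by (intro floor_unique) auto
  show "0 \<le> 4 ^ n * base4_code b - \<lfloor>4 ^ n * base4_code b\<rfloor>" "4 ^ n * base4_code b - \<lfloor>4 ^ n * base4_code b\<rfloor> \<le> 1 / 3"
    using fl[of n] eq[of n] tb[of n] by auto
  have "base4_digit m (base4_code b) = (4 * K m + b m) mod 4" unfolding base4_digit_def fl K(2) ..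
  also have "\<dots> = b m" using b[of m] by auto
  finally show "base4_digit m (base4_code b) = b m" .
qed

text \<open>Two codes with fractional parts in [0, 1/3] whose multiples by \<open>4 ^ Suc m\<close>
  are closer than 1/3 have integer parts less than 1 apart, hence equal. Nothing is claimed about
  the digits of the limit \<open>y0\<close> itself.\<close>

lemma base4_digit_eventually_const:
  fixes y :: "nat \<Rightarrow> real"
  assumes y: "y \<longlonglongrightarrow> (y0::real)"
    and fr: "\<And>N n. 4 ^ n * y N - \<lfloor>4 ^ n * y N\<rfloor> \<le> 1 / 3"
  shows "\<exists>d. \<forall>\<^sub>F N in sequentially. base4_digit m (y N) = d"
proof -
  let ?c = "4 ^ Suc m :: real"
  have "(\<lambda>N. ?c * y N) \<longlonglongrightarrow> ?c * y0" by (intro tendsto_intros y)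
  then have "Cauchy (\<lambda>N. ?c * y N)" by (rule LIMSEQ_imp_Cauchy)
  then obtain N0 where N0: "\<And>N. N \<ge> N0 \<Longrightarrow> \<bar>?c * y N - ?c * y N0\<bar> < 1 / 3"
    by (force simp: Cauchy_def dist_real_def dest!: spec[of _ "1/3"])
  have "\<lfloor>?c * y N\<rfloor> = \<lfloor>?c * y N0\<rfloor>" if "N \<ge> N0" for N
  proof -
    have "?c * y N - \<lfloor>?c * y N\<rfloor> \<le> 1/3" "?c * y N0 - \<lfloor>?c * y N0\<rfloor> \<le> 1/3" by (rule fr)+
    moreover have "?c * y N - \<lfloor>?c * y N\<rfloor> \<ge> 0" "?c * y N0 - \<lfloor>?c * y N0\<rfloor> \<ge> 0" by auto
    moreover note N0[OF that]
    ultimately have "\<bar>real_of_int \<lfloor>?c * y N\<rfloor> - real_of_int \<lfloor>?c * y N0\<rfloor>\<bar> < 1" by linarith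
    then have "\<bar>\<lfloor>?c * y N\<rfloor> - \<lfloor>?c * y N0\<rfloor>\<bar> < 1" by linarith
    then show ?thesis by simp
  qed
  then show ?thesis unfolding base4_digit_def eventually_sequentially by metis
qed

definition binary_digit :: "nat \<Rightarrow> real \<Rightarrow> int" where
  "binary_digit j v = \<lfloor>2 ^ Suc j * v\<rfloor> - 2 * \<lfloor>2 ^ j * v\<rfloor>"

lemma binary_digit_01: "binary_digit j v \<in> {0, 1}"
proof -
  have "2 * \<lfloor>2 ^ j * v\<rfloor> \<le> \<lfloor>2 ^ Suc j * v\<rfloor>" unfolding le_floor_iff by (simp add: of_int_floor_le)
  moreover have "\<lfloor>2 ^ Suc j * v\<rfloor> < 2 * \<lfloor>2 ^ j * v\<rfloor> + 2"
    proof -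
    define w where "w = 2 ^ j * v"
    have eq: "2 ^ Suc j * v = 2 * w" by (simp add: w_def)
    have "w < \<lfloor>w\<rfloor> + 1" by linarith
    then show ?thesis unfolding eq w_def[symmetric] by linarith
  qed
  ultimately show ?thesis by (auto simp: binary_digit_def)
qed

text \<open>The partial sums telescope to the dyadic floors of v.\<close>

lemma binary_digit_sums:
  assumes "0 \<le> v" "v < 1"
  shows "(\<lambda>j. binary_digit j v / 2 ^ Suc j) sums v"
proof -
  have part: "(\<Sum>j<n. binary_digit j v / 2 ^ Suc j) = \<lfloor>2 ^ n * v\<rfloor> / 2 ^ n" for n
  proof (induction n)
    case 0 have "\<lfloor>v\<rfloor> = 0" using assms by linarith
    then show ?case by simp
  next
    case (Suc n) then show ?case by (simp add: binary_digit_def field_simps)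
  qed
  have "(\<lambda>n. \<lfloor>2 ^ n * v\<rfloor> / 2 ^ n) \<longlonglongrightarrow> v"
  proof (rule tendsto_sandwich)
    show "\<forall>\<^sub>F n in sequentially. v - (1/2) ^ n \<le> \<lfloor>2 ^ n * v\<rfloor> / 2 ^ n"
    proof (rule always_eventually, rule allI)
      fix n :: nat
      have "2 ^ n * v - 1 \<le> \<lfloor>2 ^ n * v\<rfloor>" by linarith
      then have "(2 ^ n * v - 1) / 2 ^ n \<le> \<lfloor>2 ^ n * v\<rfloor> / 2 ^ n" by (rule divide_right_mono) simp
      then show "v - (1/2) ^ n \<le> \<lfloor>2 ^ n * v\<rfloor> / 2 ^ n" by (simp add: diff_divide_distrib power_divide)
    qed
    show "\<forall>\<^sub>F n in sequentially. \<lfloor>2 ^ n * v\<rfloor> / 2 ^ n \<le> v"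
      by (rule always_eventually) (simp add: divide_simps mult.commute)
    have "(\<lambda>n. v - (1/2) ^ n) \<longlonglongrightarrow> v - 0" by (intro tendsto_intros LIMSEQ_realpow_zero) auto
    then show "(\<lambda>n. v - (1/2) ^ n) \<longlonglongrightarrow> v" by simp
  qed auto
  then show ?thesis unfolding sums_def part .
qed

definition squash :: "real \<Rightarrow> real" where "squash z = (1 + z / (1 + \<bar>z\<bar>)) / 2"
definition unsquash :: "real \<Rightarrow> real" where "unsquash v = (2 * v - 1) / (1 - \<bar>2 * v - 1\<bar>)"

lemma squash_bounds: "0 < squash z" "squash z < 1"
  by (auto simp: squash_def field_simps abs_if)

lemma unsquash_squash: "unsquash (squash z) = z"
proof -
  have *: "2 * squash z - 1 = z / (1 + \<bar>z\<bar>)"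
  proof -
    have "2 * ((1 + q) / 2) - 1 = q" for q :: real by (simp add: add_divide_distrib)
    then show ?thesis unfolding squash_def .
  qed
  have "1 - \<bar>z / (1 + \<bar>z\<bar>)\<bar> = 1 / (1 + \<bar>z\<bar>)" by (simp add: abs_divide field_simps)
  then show ?thesis unfolding unsquash_def * by (simp add: field_simps)
qed

lemma measurable_squash [measurable]: "squash \<in> borel_measurable borel" "unsquash \<in> borel_measurable borel"
  unfolding squash_def[abs_def] unsquash_def[abs_def] by measurable

text \<open>Squashed values may converge to 0 or 1, where the original reals run off to infinity. A
  finite lower limit of the squares excludes exactly this, and elsewhere \<open>unsquash\<close> is
  continuous at the limit.\<close>

lemma unsquash_convergent:
  assumes v: "v \<longlonglongrightarrow> v0" and b: "\<And>N. 0 < v N" "\<And>N. v N < 1"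
    and fin: "liminf (\<lambda>N. ennreal ((unsquash (v N))\<^sup>2)) < \<infinity>"
  shows "convergent (\<lambda>N. unsquash (v N))"
proof (cases "\<bar>2 * v0 - 1\<bar> = 1")
  case False
  then have "(\<lambda>N. unsquash (v N)) \<longlonglongrightarrow> unsquash v0"
    unfolding unsquash_def by (intro tendsto_intros v) auto
  then show ?thesis by (rule convergentI)
next
  case True
  have lt: "\<bar>2 * v N - 1\<bar> < 1" for N using b[of N] by auto
  have abs: "\<bar>unsquash (v N)\<bar> = 1 / (1 - \<bar>2 * v N - 1\<bar>) - 1" for N
    using lt[of N] by (auto simp: unsquash_def abs_divide field_simps)
  have "((\<lambda>N. 1 - \<bar>2 * v N - 1\<bar>) \<longlonglongrightarrow> 1 - \<bar>2 * v0 - 1\<bar>)" by (intro tendsto_intros v)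
  then have "filterlim (\<lambda>N. 1 - \<bar>2 * v N - 1\<bar>) (at_right 0) sequentially"
    using lt True by (auto simp: filterlim_at less_imp_neq)
  then have "filterlim (\<lambda>N. 1 / (1 - \<bar>2 * v N - 1\<bar>)) at_top sequentially"
    using filterlim_compose[OF filterlim_inverse_at_top_right] by (simp add: inverse_eq_divide)
  then have "filterlim (\<lambda>N. (-1) + 1 / (1 - \<bar>2 * v N - 1\<bar>)) at_top sequentially"
    by (rule filterlim_tendsto_add_at_top[OF tendsto_const])
  then have "filterlim (\<lambda>N. \<bar>unsquash (v N)\<bar>) at_top sequentially" by (simp add: abs)
  then have "filterlim (\<lambda>N. (\<bar>unsquash (v N)\<bar>)^2) at_top sequentially"
    by (intro filterlim_pow_at_top) auto
  then have "(\<lambda>N. ennreal ((unsquash (v N))\<^sup>2)) \<longlonglongrightarrow> \<infinity>"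
    by (simp add: ennreal_tendsto_top_eq_at_top)
  then have "liminf (\<lambda>N. ennreal ((unsquash (v N))\<^sup>2)) = \<infinity>" by (intro lim_imp_Liminf) auto
  then show ?thesis using fin by simp
qed

text \<open>The binary digits of all squashed entries are interleaved by \<open>prod_decode\<close>
  into one sequence, which becomes a base 4 number. Binary digits jump, so \<open>encode\<close> is
  only shown to be Borel; continuity is asked of the decoding.\<close>

definition encode :: "(nat \<Rightarrow> real) \<Rightarrow> real" where
  "encode z = base4_code (\<lambda>m. case prod_decode m of (i, j) \<Rightarrow> binary_digit j (squash (z i)))"
definition decode :: "nat \<Rightarrow> real \<Rightarrow> real" where
  "decode i y = (\<Sum>j. base4_digit (prod_encode (i, j)) y / 2 ^ Suc j)"

lemma decode_encode: "decode i (encode z) = squash (z i)"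
proof -
  have "base4_digit (prod_encode (i, j)) (encode z) = binary_digit j (squash (z i))" for j
    unfolding encode_def by (subst base4_code_floor(3)) (use binary_digit_01 in \<open>auto split: prod.split\<close>)
  then show ?thesis
    unfolding decode_def using sums_unique[OF binary_digit_sums[of "squash (z i)"]] squash_bounds[of "z i"] by simp
qed

lemma encode_frac: "4 ^ n * encode z - \<lfloor>4 ^ n * encode z\<rfloor> \<le> 1 / 3"
  unfolding encode_def by (rule base4_code_floor) (use binary_digit_01 in \<open>auto split: prod.split\<close>)

lemma encode_bounds: "0 \<le> encode z" "encode z < 2"
proof -
  let ?b = "\<lambda>m. case prod_decode m of (i, j) \<Rightarrow> binary_digit j (squash (z i))"
  have b: "?b m \<in> {0,1}" for m using binary_digit_01 by (auto split: prod.split)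
  then have b': "0 \<le> ?b m" "?b m \<le> 1" "\<bar>real_of_int (?b m)\<bar> \<le> 3" for m
  proof -
    have "0 \<le> c \<and> c \<le> 1 \<and> \<bar>real_of_int c\<bar> \<le> 3" if "c \<in> {0, 1}" for c :: int using that by auto
    from this[OF b[of m]] show "0 \<le> ?b m" "?b m \<le> 1" "\<bar>real_of_int (?b m)\<bar> \<le> 3" by blast+
  qed
  have sm: "summable (\<lambda>m. real_of_int (?b m) / 4 ^ Suc m)" by (rule summable_digits) (use b' in auto)
  show "0 \<le> encode z" unfolding encode_def base4_code_def
    by (rule suminf_nonneg[OF sm]) (use b'(1) in \<open>auto intro!: divide_nonneg_nonneg\<close>)
  have g: "(\<lambda>l. 1/4 * (1 / 4 :: real) ^ l) sums (1/4 * (1 / (1 - 1/4)))"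
    by (intro sums_mult geometric_sums) auto
  have "encode z \<le> (\<Sum>l. 1/4 * (1 / 4 :: real) ^ l)"
    unfolding encode_def base4_code_def
  proof (intro suminf_le sm sums_summable[OF g])
    show "real_of_int (?b n) / 4 ^ Suc n \<le> 1/4 * (1 / 4) ^ n" for n
      using b'(2)[of n] by (auto simp: power_divide divide_simps)
  qed
  also have "\<dots> < 2" using sums_unique[OF g] by simp
  finally show "encode z < 2" .
qed

lemma measurable_binary_digit [measurable]: "binary_digit j \<in> borel \<rightarrow>\<^sub>M count_space UNIV"
  unfolding binary_digit_def[abs_def] by measurable

lemma measurable_base4_digit [measurable]: "base4_digit j \<in> borel \<rightarrow>\<^sub>M count_space UNIV"
  unfolding base4_digit_def[abs_def] by measurable

lemma measurable_encode [measurable]: "encode \<in> borel_measurable borel"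
proof -
  have "(\<lambda>z. real_of_int (binary_digit j (squash (z i)))) \<in> borel_measurable borel" for i j :: nat
    by measurable
  then show ?thesis
    unfolding encode_def[abs_def] base4_code_def by (intro borel_measurable_suminf) (auto split: prod.split)
qed

lemma measurable_decode [measurable]: "decode i \<in> borel_measurable borel"
  unfolding decode_def[abs_def] by measurable

text \<open>Each digit of the converging codes is eventually constant. Digits are at most 3, so the
  binary series has a geometric majorant and Tannery's theorem gives the limit as the series of the
  limiting digits.\<close>

lemma decode_convergent:
  fixes y :: "nat \<Rightarrow> real"
  assumes y: "y \<longlonglongrightarrow> y0" and fr: "\<And>N n. 4 ^ n * y N - \<lfloor>4 ^ n * y N\<rfloor> \<le> 1 / 3"
  shows "convergent (\<lambda>N. decode i (y N))"
proof -
  have "\<exists>d. \<forall>j. \<forall>\<^sub>F N in sequentially. base4_digit (prod_encode (i, j)) (y N) = d j"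
    using base4_digit_eventually_const[OF y fr] by (intro choice allI) auto
  then obtain d where d: "\<And>j. \<forall>\<^sub>F N in sequentially. base4_digit (prod_encode (i, j)) (y N) = d j" by auto
  have "(\<lambda>N. decode i (y N)) \<longlonglongrightarrow> (\<Sum>j. d j / 2 ^ Suc j)"
    unfolding decode_def
  proof (rule tannerys_theorem[where M="\<lambda>j. 3 * (1/2::real) ^ j", THEN conjunct2, THEN conjunct2])
    show "(\<lambda>N. real_of_int (base4_digit (prod_encode (i, k)) (y N)) / 2 ^ Suc k) \<longlonglongrightarrow> d k / 2 ^ Suc k" for k
      by (rule tendsto_eventually, rule eventually_mono[OF d[of k]]) simp
    have "\<bar>base4_digit m v\<bar> \<le> 3" for m v
      using pos_mod_bound[of 4 "\<lfloor>4 ^ Suc m * v\<rfloor>"] pos_mod_sign[of 4 "\<lfloor>4 ^ Suc m * v\<rfloor>"] by (simp add: base4_digit_def)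
    then have "\<bar>real_of_int (base4_digit m v)\<bar> \<le> 3" for m v
      by (metis of_int_abs of_int_le_iff of_int_numeral)
    then show "\<forall>\<^sub>F (k, N) in sequentially \<times>\<^sub>F sequentially.
        norm (real_of_int (base4_digit (prod_encode (i, k)) (y N)) / 2 ^ Suc k) \<le> 3 * (1/2) ^ k"
    proof -
      have "norm (real_of_int (base4_digit m v) / 2 ^ Suc k) \<le> 3 * (1/2) ^ k" for m v k
      proof -
        have "norm (real_of_int (base4_digit m v) / 2 ^ Suc k) = \<bar>real_of_int (base4_digit m v)\<bar> / 2 ^ Suc k" by simp
        also have "\<dots> \<le> 3 / 2 ^ Suc k" by (rule divide_right_mono[OF \<open>\<bar>real_of_int (base4_digit m v)\<bar> \<le> 3\<close>]) simp
        also have "\<dots> \<le> 3 * (1/2) ^ k" by (simp add: power_divide divide_simps)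
        finally show ?thesis .
      qed
      then show ?thesis by (intro always_eventually) auto
    qed
    show "summable (\<lambda>j. 3 * (1/2::real) ^ j)" by (intro summable_mult summable_geometric) auto
  qed auto
  then show ?thesis by (rule convergentI)
qed

section \<open>Almost sure convergence along a subsequence\<close>

text \<open>The codes lie in [0, 2), so their laws are tight and have a weakly convergent
  subsequence, which is realised by pointwise convergence on one space. The moment bound enters
  afterwards: with Fatou's lemma it keeps the decoded squashed entries from tending to 0 or
  1.\<close>

theorem skorohod_sequence:
  fixes z :: "nat \<Rightarrow> 'a \<Rightarrow> nat \<Rightarrow> real"
  assumes M0: "prob_space M0" and z [measurable]: "\<And>N. z N \<in> borel_measurable M0"
    and tight: "\<And>i. \<exists>C. \<forall>N. (\<integral>\<^sup>+\<omega>. ennreal ((z N \<omega> i)\<^sup>2) \<partial>M0) \<le> ennreal C"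
  shows "\<exists>(M :: real measure) r Z V. prob_space M \<and> strict_mono (r :: nat \<Rightarrow> nat) \<and>
    (\<forall>N. Z N \<in> borel_measurable M) \<and> V \<in> borel_measurable M \<and>
    (\<forall>N. distr M borel (Z N) = distr M0 borel (z (r N))) \<and>
    (AE \<omega> in M. \<forall>i. (\<lambda>N. Z N \<omega> i) \<longlonglongrightarrow> V \<omega> i)"
proof -
  interpret M0: prob_space M0 by fact
  define \<mu> where "\<mu> N = distr M0 borel (\<lambda>\<omega>. encode (z N \<omega>))" for N
  have rd: "real_distribution (\<mu> N)" for N
    unfolding \<mu>_def by (rule M0.real_distribution_distr) simp
  \<comment> \<open>The interval is enlarged to the half-open form in which \<open>tight\<close> is
    stated.\<close>
  have \<mu>_mass: "measure (\<mu> N) {-1<..2} = 1" for N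
  proof -
    have "measure (\<mu> N) {-1<..2} = measure M0 ((\<lambda>\<omega>. encode (z N \<omega>)) -` {-1<..2} \<inter> space M0)"
      unfolding \<mu>_def by (rule measure_distr) auto
    also have "(\<lambda>\<omega>. encode (z N \<omega>)) -` {-1<..2} \<inter> space M0 = space M0"
    proof -
      have "-1 < encode w \<and> encode w \<le> 2" for w using encode_bounds[of w] by simp
      then show ?thesis by auto
    qed
    finally show ?thesis by (simp add: M0.prob_space)
  qed
  have "tight \<mu>" unfolding tight_def
    by (intro conjI allI impI rd exI[of _ "-1 :: real"] exI[of _ "2 :: real"]) (auto simp: \<mu>_mass)
  from tight_imp_convergent_subsubsequence[OF this strict_mono_id]
  obtain r \<nu> where r: "strict_mono (r :: nat \<Rightarrow> nat)" "real_distribution \<nu>" "weak_conv_m (\<mu> \<circ> r) \<nu>" by auto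
  have "\<exists> (\<Omega> :: real measure) Y_seq Y. prob_space \<Omega> \<and> (\<forall>n. Y_seq n \<in> measurable \<Omega> borel) \<and>
    (\<forall>n. distr \<Omega> borel (Y_seq n) = (\<mu> \<circ> r) n) \<and> Y \<in> measurable \<Omega> lborel \<and> distr \<Omega> borel Y = \<nu> \<and>
    (\<forall>x \<in> space \<Omega>. (\<lambda>n. Y_seq n x) \<longlonglongrightarrow> Y x)"
    by (rule Skorohod[OF _ r(2,3)]) (simp add: rd)
  then obtain M :: "real measure" and Y Y0 where ps: "prob_space M"
    and Y [measurable]: "\<And>N. Y N \<in> borel_measurable M"
    and dY: "\<And>N. distr M borel (Y N) = \<mu> (r N)"
    and Ylim: "\<And>\<omega>. \<omega> \<in> space M \<Longrightarrow> (\<lambda>N. Y N \<omega>) \<longlonglongrightarrow> Y0 \<omega>"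
    unfolding comp_def by blast
  interpret prob_space M by fact
  define dec where "dec y = (\<lambda>i. unsquash (decode i y))" for y
  have dec_m [measurable]: "dec \<in> borel_measurable borel"
    unfolding dec_def by (rule measurable_coordinatewise_then_product) simp
  have dec_encode: "dec (encode w) = w" for w
    by (simp add: dec_def decode_encode unsquash_squash)
  define Z where "Z N \<omega> = dec (Y N \<omega>)" for N \<omega>
  have Z [measurable]: "Z N \<in> borel_measurable M" for N unfolding Z_def by simp
  have dZ: "distr M borel (Z N) = distr M0 borel (z (r N))" for N
  proof -
    have "distr M borel (Z N) = distr (distr M borel (Y N)) borel dec"
      by (subst distr_distr) (auto simp: Z_def[abs_def] comp_def)
    also have "\<dots> = distr M0 borel (z (r N))"
      unfolding dY \<mu>_def by (subst distr_distr) (auto simp: comp_def dec_encode)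
    finally show ?thesis .
  qed
  \<comment> \<open>The copies \<open>Y N\<close> need not be codes at every point. The properties
    of codes used below are Borel conditions, so they hold almost surely because the law of
    \<open>Y N\<close> is the law of a code.\<close>
  have good: "AE \<omega> in M. \<forall>N. (\<forall>n. 4 ^ n * Y N \<omega> - \<lfloor>4 ^ n * Y N \<omega>\<rfloor> \<le> 1 / 3) \<and>
      (\<forall>i. 0 < decode i (Y N \<omega>) \<and> decode i (Y N \<omega>) < 1)"
  proof (subst AE_all_countable, rule allI)
    fix N
    have "AE y in distr M0 borel (\<lambda>\<omega>. encode (z (r N) \<omega>)).
      (\<forall>n. 4 ^ n * y - \<lfloor>4 ^ n * y\<rfloor> \<le> 1 / 3) \<and> (\<forall>i. 0 < decode i y \<and> decode i y < 1)"
      by (subst AE_distr_iff)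
       (measurable, intro AE_I2 conjI allI encode_frac, simp_all add: decode_encode squash_bounds)
    then have "AE y in distr M borel (Y N).
      (\<forall>n. 4 ^ n * y - \<lfloor>4 ^ n * y\<rfloor> \<le> 1 / 3) \<and> (\<forall>i. 0 < decode i y \<and> decode i y < 1)"
      unfolding dY \<mu>_def .
    then show "AE \<omega> in M. (\<forall>n. 4 ^ n * Y N \<omega> - \<lfloor>4 ^ n * Y N \<omega>\<rfloor> \<le> 1 / 3) \<and>
      (\<forall>i. 0 < decode i (Y N \<omega>) \<and> decode i (Y N \<omega>) < 1)"
      by (subst (asm) AE_distr_iff) auto
  qed
  have fin: "AE \<omega> in M. \<forall>i. liminf (\<lambda>N. ennreal ((Z N \<omega> i)\<^sup>2)) < \<infinity>"
  proof (subst AE_all_countable, rule allI)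
    fix i
    obtain C where C: "\<And>N. (\<integral>\<^sup>+\<omega>. ennreal ((z N \<omega> i)\<^sup>2) \<partial>M0) \<le> ennreal C" using tight[of i] by auto
    have "(\<integral>\<^sup>+\<omega>. ennreal ((Z N \<omega> i)\<^sup>2) \<partial>M) = (\<integral>\<^sup>+\<omega>. ennreal ((z (r N) \<omega> i)\<^sup>2) \<partial>M0)" for N
    proof -
      have "(\<integral>\<^sup>+\<omega>. ennreal ((Z N \<omega> i)\<^sup>2) \<partial>M) = (\<integral>\<^sup>+w. ennreal ((w i)\<^sup>2) \<partial>distr M borel (Z N))"
        by (subst nn_integral_distr) auto
      also have "\<dots> = (\<integral>\<^sup>+\<omega>. ennreal ((z (r N) \<omega> i)\<^sup>2) \<partial>M0)"
        unfolding dZ by (subst nn_integral_distr) auto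
      finally show ?thesis .
    qed
    then have le: "(\<integral>\<^sup>+\<omega>. ennreal ((Z N \<omega> i)\<^sup>2) \<partial>M) \<le> ennreal C" for N using C by simp
    have [measurable]: "(\<lambda>\<omega>. Z N \<omega> i) \<in> borel_measurable M" for N
      by (rule measurable_product_then_coordinatewise[OF Z])
    have "(\<integral>\<^sup>+\<omega>. liminf (\<lambda>N. ennreal ((Z N \<omega> i)\<^sup>2)) \<partial>M) \<le> liminf (\<lambda>N. \<integral>\<^sup>+\<omega>. ennreal ((Z N \<omega> i)\<^sup>2) \<partial>M)"
      by (rule nn_integral_liminf) auto
    also have "\<dots> \<le> liminf (\<lambda>N :: nat. ennreal C)" by (rule Liminf_mono) (auto simp: le)
    also have "\<dots> = ennreal C" by (simp add: Liminf_const)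
    also have "\<dots> < \<infinity>" by simp
    finally have "(\<integral>\<^sup>+\<omega>. liminf (\<lambda>N. ennreal ((Z N \<omega> i)\<^sup>2)) \<partial>M) \<noteq> \<infinity>" by simp
    then show "AE \<omega> in M. liminf (\<lambda>N. ennreal ((Z N \<omega> i)\<^sup>2)) < \<infinity>"
      by (intro eventually_mono[OF nn_integral_noteq_infinite]) (auto simp: less_top)
  qed
  define V where "V \<omega> i = lim (\<lambda>N. Z N \<omega> i)" for \<omega> i
  have V: "V \<in> borel_measurable M"
  proof (rule measurable_coordinatewise_then_product)
    have [measurable]: "(\<lambda>\<omega>. Z N \<omega> i) \<in> borel_measurable M" for N i
      by (rule measurable_product_then_coordinatewise[OF Z])
    show "(\<lambda>\<omega>. V \<omega> i) \<in> borel_measurable M" for i unfolding V_def by measurable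
  qed
  have "AE \<omega> in M. \<forall>i. (\<lambda>N. Z N \<omega> i) \<longlonglongrightarrow> V \<omega> i"
    using good fin AE_space
  proof eventually_elim
    case (elim \<omega>)
    show ?case
    proof
      fix i
      have "convergent (\<lambda>N. decode i (Y N \<omega>))"
        using Ylim[OF elim(3)] elim(1) by (intro decode_convergent) auto
      then obtain v0 where "(\<lambda>N. decode i (Y N \<omega>)) \<longlonglongrightarrow> v0" by (auto simp: convergent_def)
      then have "convergent (\<lambda>N. unsquash (decode i (Y N \<omega>)))"
        using elim(1,2) by (intro unsquash_convergent) (auto simp: Z_def dec_def)
      then show "(\<lambda>N. Z N \<omega> i) \<longlonglongrightarrow> V \<omega> i"
        unfolding V_def Z_def dec_def by (simp add: convergent_LIMSEQ_iff)
    qed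
  qed
  then show ?thesis using ps r(1) Z V dZ by blast
qed

section \<open>Gaussian product spaces and predictable sums\<close>

definition gauss_space :: "('i::countable \<Rightarrow> real) measure" where
  "gauss_space = PiM UNIV (\<lambda>_. std_normal_distribution)"

definition depends_on :: "'i set \<Rightarrow> (('i \<Rightarrow> real) \<Rightarrow> 'b) \<Rightarrow> bool" where
  "depends_on S f \<longleftrightarrow> (\<forall>\<omega> \<omega>'. (\<forall>i\<in>S. \<omega> i = \<omega>' i) \<longrightarrow> f \<omega> = f \<omega>')"

lemma depends_onD: "depends_on S f \<Longrightarrow> (\<And>i. i \<in> S \<Longrightarrow> \<omega> i = \<omega>' i) \<Longrightarrow> f \<omega> = f \<omega>'"
  by (auto simp: depends_on_def)

lemma depends_on_mono: "depends_on S f \<Longrightarrow> S \<subseteq> S' \<Longrightarrow> depends_on S' f"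
  by (auto simp: depends_on_def)

interpretation gauss: prob_space gauss_space
  unfolding gauss_space_def using real_dist_normal_dist
  by (intro prob_space_PiM) (simp add: real_distribution_def)

lemma sets_gauss_space [measurable_cong, simp]: "sets gauss_space = sets (borel :: ('i::countable \<Rightarrow> real) measure)"
  unfolding gauss_space_def by (subst sets_PiM_equal_borel[symmetric]) (auto intro!: sets_PiM_cong)

lemma space_gauss_space [simp]: "space gauss_space = UNIV"
  using sets_eq_imp_space_eq[OF sets_gauss_space] by simp

lemma gauss_prob_UNIV [simp]: "measure gauss_space UNIV = 1"
  using gauss.prob_space by simp

lemma gauss_coordinate: "distr gauss_space borel (\<lambda>\<omega>. \<omega> i) = std_normal_distribution"
proof -
  have "distr (PiM UNIV (\<lambda>_. std_normal_distribution)) std_normal_distribution (\<lambda>\<omega>. \<omega> i) = std_normal_distribution"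
    by (rule distr_PiM_component) (use real_dist_normal_dist in \<open>auto simp: real_distribution_def\<close>)
  then show ?thesis unfolding gauss_space_def by (subst distr_cong[OF refl, of _ std_normal_distribution]) auto
qed

lemma gauss_indep_vars: "gauss.indep_vars (\<lambda>_. borel) (\<lambda>i \<omega>. \<omega> i) (UNIV :: 'i::countable set)"
proof (subst gauss.indep_vars_iff_distr_eq_PiM)
  have "distr gauss_space (PiM UNIV (\<lambda>_. borel)) (\<lambda>x. \<lambda>i\<in>UNIV. x (i::'i)) = distr gauss_space gauss_space (\<lambda>x. x)"
    by (rule distr_cong) (auto simp: sets_PiM_equal_borel)
  also have "\<dots> = gauss_space" by simp
  also have "\<dots> = PiM UNIV (\<lambda>i. distr gauss_space borel (\<lambda>\<omega>. \<omega> (i::'i)))"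
    unfolding gauss_coordinate by (simp add: gauss_space_def)
  finally show "distr gauss_space (PiM UNIV (\<lambda>_. borel)) (\<lambda>x. \<lambda>i\<in>UNIV. x (i::'i)) = PiM UNIV (\<lambda>i. distr gauss_space borel (\<lambda>\<omega>. \<omega> i))" .
qed auto

text \<open>Setting the coordinates outside S to 0 does not change f and exhibits it as a measurable
  function of the restriction to S. This turns \<open>depends_on\<close> into independence for
  functions of disjoint sets of coordinates.\<close>

lemma depends_on_factor:
  fixes f :: "('i::countable \<Rightarrow> real) \<Rightarrow> 'b"
  assumes f: "f \<in> borel \<rightarrow>\<^sub>M N" and dep: "depends_on S f"
  shows "\<exists>F. F \<in> PiM S (\<lambda>_. borel) \<rightarrow>\<^sub>M N \<and> f = (\<lambda>\<omega>. F (restrict \<omega> S))"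
proof (intro exI conjI)
  let ?F = "\<lambda>w. f (\<lambda>i. if i \<in> S then w i else 0)"
  show "f = (\<lambda>\<omega>. ?F (restrict \<omega> S))"
  proof
    fix \<omega>
    show "f \<omega> = ?F (restrict \<omega> S)" by (rule depends_onD[OF dep]) simp
  qed
  have "(\<lambda>w i. if i \<in> S then w i else 0) \<in> PiM S (\<lambda>_. borel) \<rightarrow>\<^sub>M (borel :: ('i \<Rightarrow> real) measure)"
  proof (rule measurable_coordinatewise_then_product)
    show "(\<lambda>w. if i \<in> S then w i else 0 :: real) \<in> borel_measurable (PiM S (\<lambda>_. borel))" for i
      by (cases "i \<in> S") auto
  qed
  then show "?F \<in> PiM S (\<lambda>_. borel) \<rightarrow>\<^sub>M N" by (rule measurable_compose[OF _ f])
qed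

lemma gauss_indep_var:
  fixes f g :: "('i::countable \<Rightarrow> real) \<Rightarrow> 'b"
  assumes f: "f \<in> borel \<rightarrow>\<^sub>M N" "depends_on S f" and g: "g \<in> borel \<rightarrow>\<^sub>M N'" "depends_on S' g" and d: "S \<inter> S' = {}"
  shows "gauss.indep_var N f N' g"
proof -
  obtain F where F: "F \<in> PiM S (\<lambda>_. borel) \<rightarrow>\<^sub>M N" "f = (\<lambda>\<omega>. F (restrict \<omega> S))"
    using depends_on_factor[OF f] by (elim exE conjE)
  obtain G where G: "G \<in> PiM S' (\<lambda>_. borel) \<rightarrow>\<^sub>M N'" "g = (\<lambda>\<omega>. G (restrict \<omega> S'))"
    using depends_on_factor[OF g] by (elim exE conjE)
  have "gauss.indep_var (PiM S (\<lambda>_. borel)) (\<lambda>\<omega>. restrict (\<lambda>i. \<omega> i) S) (PiM S' (\<lambda>_. borel)) (\<lambda>\<omega>. restrict (\<lambda>i. \<omega> i) S')"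
    using gauss.indep_var_restrict[OF gauss_indep_vars d subset_UNIV subset_UNIV] .
  from gauss.indep_var_compose[OF this F(1) G(1)]
  have "gauss.indep_var N (F \<circ> (\<lambda>\<omega>. restrict \<omega> S)) N' (G \<circ> (\<lambda>\<omega>. restrict \<omega> S'))" .
  then show ?thesis unfolding F(2) G(2) comp_def .
qed

lemma gauss_indep_vars_family:
  fixes f :: "'j \<Rightarrow> ('i::countable \<Rightarrow> real) \<Rightarrow> 'b"
  assumes f: "\<And>j. j \<in> L \<Longrightarrow> f j \<in> borel \<rightarrow>\<^sub>M N j" "\<And>j. j \<in> L \<Longrightarrow> depends_on (S j) (f j)" and d: "disjoint_family_on S L"
  shows "gauss.indep_vars N f L"
proof -
  have "\<forall>j\<in>L. \<exists>F. F \<in> PiM (S j) (\<lambda>_. borel) \<rightarrow>\<^sub>M N j \<and> f j = (\<lambda>\<omega>. F (restrict \<omega> (S j)))"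
    using depends_on_factor[OF f(1,2)] by blast
  from bchoice[OF this] obtain F where F0:
    "\<forall>j\<in>L. F j \<in> PiM (S j) (\<lambda>_. borel) \<rightarrow>\<^sub>M N j \<and> f j = (\<lambda>\<omega>. F j (restrict \<omega> (S j)))" ..
  have F: "F j \<in> PiM (S j) (\<lambda>_. borel) \<rightarrow>\<^sub>M N j" "f j = (\<lambda>\<omega>. F j (restrict \<omega> (S j)))" if "j \<in> L" for j
    by (rule conjunct1[OF bspec[OF F0 that]], rule conjunct2[OF bspec[OF F0 that]])
  have "gauss.indep_vars (\<lambda>j. PiM (S j) (\<lambda>_. borel)) (\<lambda>j \<omega>. restrict (\<lambda>i. \<omega> i) (S j)) L"
    using gauss.indep_vars_restrict[OF gauss_indep_vars subset_UNIV d] .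
  from gauss.indep_vars_compose2[OF this F(1)]
  have "gauss.indep_vars N (\<lambda>j \<omega>. F j (restrict \<omega> (S j))) L" .
  then show ?thesis by (subst gauss.indep_vars_cong[OF refl F(2) refl])
qed

lemma gauss_integral_coordinate:
  fixes \<phi> :: "real \<Rightarrow> real"
  assumes [measurable]: "\<phi> \<in> borel_measurable borel"
  shows "(\<integral>\<omega>. \<phi> (\<omega> i) \<partial>gauss_space) = (\<integral>x. \<phi> x \<partial>std_normal_distribution)"
    "integrable gauss_space (\<lambda>\<omega>. \<phi> (\<omega> i)) \<longleftrightarrow> integrable std_normal_distribution \<phi>"
  by (subst gauss_coordinate[of i, symmetric], simp add: integral_distr integrable_distr_eq)+

lemma gauss_integrable_power [simp, intro]: "integrable gauss_space (\<lambda>\<omega>. \<omega> i ^ n)"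
  using gauss_integral_coordinate(2)[of "\<lambda>x. x ^ n" i] integrable_std_normal_distribution_moment[of n] by simp

lemma gauss_moments:
  "(\<integral>\<omega>. \<omega> i \<partial>gauss_space) = 0" "(\<integral>\<omega>. \<omega> i ^ 2 \<partial>gauss_space) = 1"
  "(\<integral>\<omega>. \<omega> i ^ 3 \<partial>gauss_space) = 0" "(\<integral>\<omega>. \<omega> i ^ 4 \<partial>gauss_space) = 3"
proof -
  show "(\<integral>\<omega>. \<omega> i ^ 2 \<partial>gauss_space) = 1" "(\<integral>\<omega>. \<omega> i ^ 4 \<partial>gauss_space) = 3"
    using gauss_integral_coordinate(1)[of "\<lambda>x. x ^ 2" i] gauss_integral_coordinate(1)[of "\<lambda>x. x ^ 4" i]
      std_normal_distribution_even_moments(1)[of 1] std_normal_distribution_even_moments(1)[of 2]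
    by (simp_all add: fact_numeral)
  have odd: "(\<integral>x. x ^ (2 * k + 1) \<partial>std_normal_distribution) = 0" for k
    by (subst integral_density) (use integral_std_normal_moment_odd[of k] in \<open>auto\<close>)
  show "(\<integral>\<omega>. \<omega> i \<partial>gauss_space) = 0" "(\<integral>\<omega>. \<omega> i ^ 3 \<partial>gauss_space) = 0"
    using gauss_integral_coordinate(1)[of "\<lambda>x. x" i] gauss_integral_coordinate(1)[of "\<lambda>x. x ^ 3" i] odd[of 0] odd[of 1]
    by (simp_all add: numeral_3_eq_3)
qed

lemma std_moments:
  "(\<integral>x. x \<partial>std_normal_distribution) = 0" "(\<integral>x. x ^ 2 \<partial>std_normal_distribution) = 1"
  "(\<integral>x. x ^ 4 \<partial>std_normal_distribution) = 3"
  "integrable std_normal_distribution (\<lambda>x. x)" "integrable std_normal_distribution (\<lambda>x. x ^ n)"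
proof -
  show "(\<integral>x. x \<partial>std_normal_distribution) = 0" "(\<integral>x. x ^ 2 \<partial>std_normal_distribution) = 1"
    "(\<integral>x. x ^ 4 \<partial>std_normal_distribution) = 3"
    using gauss_integral_coordinate(1)[of "\<lambda>x. x" "0::nat"] gauss_integral_coordinate(1)[of "\<lambda>x. x ^ 2" "0::nat"]
      gauss_integral_coordinate(1)[of "\<lambda>x. x ^ 4" "0::nat"] gauss_moments[of "0::nat"] by auto
  show "integrable std_normal_distribution (\<lambda>x. x)" "integrable std_normal_distribution (\<lambda>x. x ^ n)"
    using integrable_std_normal_distribution_moment[of 1] integrable_std_normal_distribution_moment[of n] by auto
qed

lemma gauss_integral_mult:
  fixes f :: "('i::countable \<Rightarrow> real) \<Rightarrow> real"
  assumes f: "f \<in> borel_measurable borel" "depends_on S f" "integrable gauss_space f" and i: "i \<notin> S"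
    and \<phi>: "\<phi> \<in> borel_measurable borel" "integrable std_normal_distribution \<phi>"
  shows "integrable gauss_space (\<lambda>\<omega>. f \<omega> * \<phi> (\<omega> i))"
    "(\<integral>\<omega>. f \<omega> * \<phi> (\<omega> i) \<partial>gauss_space) = (\<integral>\<omega>. f \<omega> \<partial>gauss_space) * (\<integral>x. \<phi> x \<partial>std_normal_distribution)"
proof -
  note [measurable] = f(1) \<phi>(1)
  have "gauss.indep_var borel f borel (\<lambda>\<omega>. \<phi> (\<omega> i))"
    by (rule gauss_indep_var[where S=S and S'="{i}"]) (use f i in \<open>auto simp: depends_on_def\<close>)
  note * = gauss.indep_var_integrable[OF this f(3)] gauss.indep_var_lebesgue_integral[OF this f(3)]
  show "integrable gauss_space (\<lambda>\<omega>. f \<omega> * \<phi> (\<omega> i))"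
    "(\<integral>\<omega>. f \<omega> * \<phi> (\<omega> i) \<partial>gauss_space) = (\<integral>\<omega>. f \<omega> \<partial>gauss_space) * (\<integral>x. \<phi> x \<partial>std_normal_distribution)"
    using * by (auto simp: gauss_integral_coordinate \<phi>)
qed

section \<open>Moments of sums with predictable coefficients\<close>

text \<open>A martingale transform described by coordinates instead of a filtration:
  \<open>S i\<close> is the set of coordinates known when the i-th coefficient is chosen, and
  \<open>e i\<close> is the noise of step i, unknown at that moment and known at all later
  steps.\<close>

locale predictable =
  fixes a :: "nat \<Rightarrow> ('i::countable \<Rightarrow> real) \<Rightarrow> real" and e :: "nat \<Rightarrow> 'i" and S :: "nat \<Rightarrow> 'i set" and K :: real
  assumes a_meas [measurable]: "\<And>i. a i \<in> borel_measurable borel"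
    and a_dep: "\<And>i. depends_on (S i) (a i)"
    and fresh: "\<And>i. e i \<notin> S i" and old: "\<And>i j. j < i \<Longrightarrow> e j \<in> S i" and S_mono: "\<And>i j. j < i \<Longrightarrow> S j \<subseteq> S i"
    and a_bound: "\<And>i \<omega>. \<bar>a i \<omega>\<bar> \<le> K"
begin

lemma a_pow_bound: "\<bar>a i \<omega> ^ n\<bar> \<le> K ^ n"
  using power_mono[OF a_bound[of i \<omega>], of n] by (simp add: power_abs)

lemma a_integrable: "integrable gauss_space (\<lambda>\<omega>. a i \<omega> ^ n)"
  by (rule gauss.integrable_const_bound[of _ "K ^ n"]) (auto simp: a_pow_bound)

lemma depends_sum:
  fixes \<phi> :: "real \<Rightarrow> real"
  shows "depends_on (S n) (\<lambda>\<omega>. \<Sum>i<n. a i \<omega> * \<phi> (\<omega> (e i)))"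
  unfolding depends_on_def
proof (intro allI impI sum.cong refl arg_cong2[where f="(*)"])
  fix \<omega> \<omega>' :: "'i \<Rightarrow> real" and i assume eq: "\<forall>i\<in>S n. \<omega> i = \<omega>' i" and i: "i \<in> {..<n}"
  show "a i \<omega> = a i \<omega>'"
    using S_mono[of i n] i eq by (intro depends_onD[OF a_dep]) auto
  show "\<phi> (\<omega> (e i)) = \<phi> (\<omega>' (e i))" using eq old i by auto
qed

text \<open>Martingale orthogonality: the cross term contains the factor
  \<open>\<phi> (\<omega> (e n))\<close>, which is centred and independent of everything in
  \<open>S n\<close>. The uses are \<open>\<phi>\<close> the identity and \<open>\<phi>\<close> the
  Hermite polynomial x^2 - 1.\<close>

lemma second_moment:
  fixes \<phi> :: "real \<Rightarrow> real"
  assumes [measurable]: "\<phi> \<in> borel_measurable borel"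
    and int: "integrable std_normal_distribution \<phi>" "integrable std_normal_distribution (\<lambda>x. \<phi> x ^ 2)"
    and mean: "(\<integral>x. \<phi> x \<partial>std_normal_distribution) = 0"
  shows "integrable gauss_space (\<lambda>\<omega>. (\<Sum>i<n. a i \<omega> * \<phi> (\<omega> (e i)))\<^sup>2)"
    "(\<integral>\<omega>. (\<Sum>i<n. a i \<omega> * \<phi> (\<omega> (e i)))\<^sup>2 \<partial>gauss_space) =
      (\<integral>x. \<phi> x ^ 2 \<partial>std_normal_distribution) * (\<Sum>i<n. \<integral>\<omega>. (a i \<omega>)\<^sup>2 \<partial>gauss_space)"
proof (induction n)
  case 0
  { case 1 then show ?case by simp next case 2 then show ?case by simp }
next
  case (Suc n)
  define Y where "Y \<omega> = (\<Sum>i<n. a i \<omega> * \<phi> (\<omega> (e i)))" for \<omega>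
  have [measurable]: "Y \<in> borel_measurable borel" unfolding Y_def[abs_def] by measurable
  have Yd: "depends_on (S n) Y" unfolding Y_def[abs_def] by (rule depends_sum)
  have Y2: "integrable gauss_space (\<lambda>\<omega>. (Y \<omega>)\<^sup>2)" using Suc(1) by (simp add: Y_def)
  have Ya: "integrable gauss_space (\<lambda>\<omega>. Y \<omega> * a n \<omega>)"
  proof (rule Bochner_Integration.integrable_bound)
    show "integrable gauss_space (\<lambda>\<omega>. (Y \<omega>)\<^sup>2 + a n \<omega> ^ 2)" by (intro Bochner_Integration.integrable_add Y2 a_integrable)
    show "AE \<omega> in gauss_space. norm (Y \<omega> * a n \<omega>) \<le> norm ((Y \<omega>)\<^sup>2 + a n \<omega> ^ 2)"
    proof (rule AE_I2)
      fix \<omega>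
      have "0 \<le> (\<bar>Y \<omega>\<bar> - \<bar>a n \<omega>\<bar>)\<^sup>2" by simp
      then have "2 * (\<bar>Y \<omega>\<bar> * \<bar>a n \<omega>\<bar>) \<le> (Y \<omega>)\<^sup>2 + (a n \<omega>)\<^sup>2" by (simp add: power2_diff)
      moreover have "0 \<le> \<bar>Y \<omega> * a n \<omega>\<bar>" by simp
      ultimately have "\<bar>Y \<omega> * a n \<omega>\<bar> \<le> (Y \<omega>)\<^sup>2 + (a n \<omega>)\<^sup>2" unfolding abs_mult by linarith
      then show "norm (Y \<omega> * a n \<omega>) \<le> norm ((Y \<omega>)\<^sup>2 + a n \<omega> ^ 2)" by simp
    qed
  qed measurable
  have eq: "(\<Sum>i<Suc n. a i \<omega> * \<phi> (\<omega> (e i)))\<^sup>2 =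
      (Y \<omega>)\<^sup>2 + (2 * ((Y \<omega> * a n \<omega>) * \<phi> (\<omega> (e n))) + a n \<omega> ^ 2 * (\<phi> (\<omega> (e n)))\<^sup>2)" for \<omega>
    by (simp add: Y_def power2_sum power_mult_distrib)
  have dep1: "depends_on (S n) (\<lambda>\<omega>. Y \<omega> * a n \<omega>)" using Yd a_dep[of n] by (auto simp: depends_on_def) metis
  have dep2: "depends_on (S n) (\<lambda>\<omega>. a n \<omega> ^ 2)" using a_dep[of n] by (auto simp: depends_on_def) metis
  note m1 = gauss_integral_mult[OF _ dep1 Ya fresh, of \<phi>]
  note m2 = gauss_integral_mult[OF _ dep2 a_integrable fresh, of "\<lambda>x. (\<phi> x)\<^sup>2"]
  have i1: "integrable gauss_space (\<lambda>\<omega>. (Y \<omega> * a n \<omega>) * \<phi> (\<omega> (e n)))"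
    "(\<integral>\<omega>. (Y \<omega> * a n \<omega>) * \<phi> (\<omega> (e n)) \<partial>gauss_space) = 0"
    using m1 int mean by auto
  have i2: "integrable gauss_space (\<lambda>\<omega>. a n \<omega> ^ 2 * (\<phi> (\<omega> (e n)))\<^sup>2)"
    "(\<integral>\<omega>. a n \<omega> ^ 2 * (\<phi> (\<omega> (e n)))\<^sup>2 \<partial>gauss_space) = (\<integral>\<omega>. (a n \<omega>)\<^sup>2 \<partial>gauss_space) * (\<integral>x. \<phi> x ^ 2 \<partial>std_normal_distribution)"
    using m2 int by auto
  { case 1 show ?case unfolding eq
      by (intro Bochner_Integration.integrable_add Y2 integrable_mult_right i1 i2)
  next
    case 2
    have "(\<integral>\<omega>. (\<Sum>i<Suc n. a i \<omega> * \<phi> (\<omega> (e i)))\<^sup>2 \<partial>gauss_space) = (\<integral>\<omega>. (Y \<omega>)\<^sup>2 \<partial>gauss_space)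
        + (2 * (\<integral>\<omega>. (Y \<omega> * a n \<omega>) * \<phi> (\<omega> (e n)) \<partial>gauss_space) + (\<integral>\<omega>. a n \<omega> ^ 2 * (\<phi> (\<omega> (e n)))\<^sup>2 \<partial>gauss_space))"
      unfolding eq
      by (intro has_bochner_integral_integral_eq has_bochner_integral_add has_bochner_integral_mult_right
          has_bochner_integral_integrable Y2 i1 i2)
    also have "\<dots> = (\<integral>x. \<phi> x ^ 2 \<partial>std_normal_distribution) * (\<Sum>i<Suc n. \<integral>\<omega>. (a i \<omega>)\<^sup>2 \<partial>gauss_space)"
      using Suc(2) unfolding i1 i2 by (simp add: Y_def algebra_simps)
    finally show ?case .
  }
qed

text \<open>When the fourth power is expanded in the last summand, odd powers of the fresh Gaussian
  integrate to 0. What remains adds at most 6 K^4 n + 3 K^4, which is exactly 3 K^4 ((n + 1)^2 -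
  n^2), so the quadratic bound reproduces itself.\<close>

lemma fourth_moment:
  "integrable gauss_space (\<lambda>\<omega>. (\<Sum>i<n. a i \<omega> * \<omega> (e i)) ^ 4)"
  "(\<integral>\<omega>. (\<Sum>i<n. a i \<omega> * \<omega> (e i)) ^ 4 \<partial>gauss_space) \<le> 3 * K ^ 4 * (real n)\<^sup>2"
proof (induction n)
  case 0
  { case 1 then show ?case by simp next case 2 then show ?case by simp }
next
  case (Suc n)
  define Y where "Y \<omega> = (\<Sum>i<n. a i \<omega> * \<omega> (e i))" for \<omega>
  have K0: "0 \<le> K" using a_bound[of 0 undefined] by linarith
  have [measurable]: "Y \<in> borel_measurable borel" unfolding Y_def[abs_def] by measurable
  have Yd: "depends_on (S n) Y" unfolding Y_def[abs_def] by (rule depends_sum)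
  have Y4: "integrable gauss_space (\<lambda>\<omega>. Y \<omega> ^ 4)" using Suc(1) by (simp add: Y_def)
  \<comment> \<open>Since \<open>\<bar>y\<bar> ^ p \<le> 1 + y ^ 4\<close> for p at most 4, one
    majorant serves all mixed terms of the expansion.\<close>
  have Ya: "integrable gauss_space (\<lambda>\<omega>. Y \<omega> ^ p * a n \<omega> ^ q)" if "p \<le> 4" for p q
  proof (rule Bochner_Integration.integrable_bound)
    show "integrable gauss_space (\<lambda>\<omega>. (1 + Y \<omega> ^ 4) * K ^ q)" by (intro integrable_mult_left Bochner_Integration.integrable_add Y4) auto
    show "AE \<omega> in gauss_space. norm (Y \<omega> ^ p * a n \<omega> ^ q) \<le> norm ((1 + Y \<omega> ^ 4) * K ^ q)"
    proof (rule AE_I2)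
      fix \<omega>
      have "\<bar>Y \<omega>\<bar> ^ p \<le> 1 + \<bar>Y \<omega>\<bar> ^ 4"
      proof (cases "\<bar>Y \<omega>\<bar> \<le> 1")
        case True
        then have "\<bar>Y \<omega>\<bar> ^ p \<le> 1" by (intro power_le_one) auto
        moreover have "0 \<le> \<bar>Y \<omega>\<bar> ^ 4" by simp
        ultimately show ?thesis by linarith
      next
        case False then show ?thesis using power_increasing[OF that, of "\<bar>Y \<omega>\<bar>"] by linarith
      qed
      then have "\<bar>Y \<omega> ^ p\<bar> * \<bar>a n \<omega> ^ q\<bar> \<le> (1 + Y \<omega> ^ 4) * K ^ q"
        using a_pow_bound[of n \<omega> q] by (intro mult_mono) (auto simp: power_abs power_even_abs)
      then show "norm (Y \<omega> ^ p * a n \<omega> ^ q) \<le> norm ((1 + Y \<omega> ^ 4) * K ^ q)" using K0 by (simp add: abs_mult)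
    qed
  qed measurable
  have dep: "depends_on (S n) (\<lambda>\<omega>. Y \<omega> ^ p * a n \<omega> ^ q)" for p q
    using Yd a_dep[of n] by (auto simp: depends_on_def) metis
  have ig: "integrable gauss_space (\<lambda>\<omega>. (Y \<omega> ^ p * a n \<omega> ^ q) * \<omega> (e n) ^ r)"
    and vg: "(\<integral>\<omega>. (Y \<omega> ^ p * a n \<omega> ^ q) * \<omega> (e n) ^ r \<partial>gauss_space) =
        (\<integral>\<omega>. Y \<omega> ^ p * a n \<omega> ^ q \<partial>gauss_space) * (\<integral>\<omega>. \<omega> (e n) ^ r \<partial>gauss_space)" if "p \<le> 4" for p q r
    using gauss_integral_mult[OF _ dep[of p q] Ya[OF that, of q] fresh, of "\<lambda>x. x ^ r"]
      integrable_std_normal_distribution_moment[of r] gauss_integral_coordinate(1)[of "\<lambda>x. x ^ r" "e n"] by auto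
  have eq: "(\<Sum>i<Suc n. a i \<omega> * \<omega> (e i)) ^ 4 = Y \<omega> ^ 4 +
      (4 * ((Y \<omega> ^ 3 * a n \<omega> ^ 1) * \<omega> (e n) ^ 1) + (6 * ((Y \<omega> ^ 2 * a n \<omega> ^ 2) * \<omega> (e n) ^ 2) +
      (4 * ((Y \<omega> ^ 1 * a n \<omega> ^ 3) * \<omega> (e n) ^ 3) + (Y \<omega> ^ 0 * a n \<omega> ^ 4) * \<omega> (e n) ^ 4)))" for \<omega>
    by (simp add: Y_def) (simp add: power4_eq_xxxx power3_eq_cube power2_eq_square algebra_simps)
  note ig' = ig[of 3 1 1] ig[of 2 2 2] ig[of 1 3 3] ig[of 0 4 4]
  { case 1 show ?case unfolding eq
      by (intro Bochner_Integration.integrable_add Y4 integrable_mult_right ig') auto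
  next
    case 2
    have b2: "(\<integral>\<omega>. Y \<omega> ^ 2 * a n \<omega> ^ 2 \<partial>gauss_space) \<le> K ^ 4 * n"
    proof -
      have sm: "integrable gauss_space (\<lambda>\<omega>. (Y \<omega>)\<^sup>2)" "(\<integral>\<omega>. (Y \<omega>)\<^sup>2 \<partial>gauss_space) = (\<Sum>i<n. \<integral>\<omega>. (a i \<omega>)\<^sup>2 \<partial>gauss_space)"
        using second_moment[OF _ std_moments(4,5,1), of n] unfolding std_moments(2) by (simp_all add: Y_def)
      have "(\<integral>\<omega>. Y \<omega> ^ 2 * a n \<omega> ^ 2 \<partial>gauss_space) \<le> (\<integral>\<omega>. Y \<omega> ^ 2 * K ^ 2 \<partial>gauss_space)"
        using Ya[of 2 2] sm(1) a_pow_bound[of n _ 2] by (intro integral_mono integrable_mult_left mult_left_mono) auto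
      also have "\<dots> = (\<Sum>i<n. \<integral>\<omega>. (a i \<omega>)\<^sup>2 \<partial>gauss_space) * K ^ 2" using sm by simp
      also have "\<dots> \<le> (\<Sum>i<n. K ^ 2) * K ^ 2"
      proof (intro mult_right_mono sum_mono)
        fix i
        have "(\<integral>\<omega>. (a i \<omega>)\<^sup>2 \<partial>gauss_space) \<le> (\<integral>\<omega>. K ^ 2 \<partial>(gauss_space :: ('i \<Rightarrow> real) measure))"
          using a_integrable[of i 2] a_pow_bound[of i _ 2] by (intro integral_mono) auto
        then show "(\<integral>\<omega>. (a i \<omega>)\<^sup>2 \<partial>gauss_space) \<le> K\<^sup>2" by simp
      qed auto
      also have "\<dots> = K ^ 4 * n" by (simp add: power2_eq_square power4_eq_xxxx)
      finally show ?thesis .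
    qed
    have b4: "(\<integral>\<omega>. Y \<omega> ^ 0 * a n \<omega> ^ 4 \<partial>gauss_space) \<le> K ^ 4"
    proof -
      have "(\<integral>\<omega>. (a n \<omega>) ^ 4 \<partial>gauss_space) \<le> (\<integral>\<omega>. K ^ 4 \<partial>(gauss_space :: ('i \<Rightarrow> real) measure))"
        using a_integrable[of n 4] a_pow_bound[of n _ 4] by (intro integral_mono) auto
      then show ?thesis by simp
    qed
    have "(\<integral>\<omega>. (\<Sum>i<Suc n. a i \<omega> * \<omega> (e i)) ^ 4 \<partial>gauss_space) = (\<integral>\<omega>. Y \<omega> ^ 4 \<partial>gauss_space)
      + (4 * (\<integral>\<omega>. (Y \<omega> ^ 3 * a n \<omega> ^ 1) * \<omega> (e n) ^ 1 \<partial>gauss_space)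
      + (6 * (\<integral>\<omega>. (Y \<omega> ^ 2 * a n \<omega> ^ 2) * \<omega> (e n) ^ 2 \<partial>gauss_space)
      + (4 * (\<integral>\<omega>. (Y \<omega> ^ 1 * a n \<omega> ^ 3) * \<omega> (e n) ^ 3 \<partial>gauss_space)
      + (\<integral>\<omega>. (Y \<omega> ^ 0 * a n \<omega> ^ 4) * \<omega> (e n) ^ 4 \<partial>gauss_space))))"
      unfolding eq
      by (intro has_bochner_integral_integral_eq has_bochner_integral_add has_bochner_integral_mult_right
          has_bochner_integral_integrable Y4 ig') auto
    also have "\<dots> = (\<integral>\<omega>. Y \<omega> ^ 4 \<partial>gauss_space) + (6 * (\<integral>\<omega>. Y \<omega> ^ 2 * a n \<omega> ^ 2 \<partial>gauss_space)
       + 3 * (\<integral>\<omega>. Y \<omega> ^ 0 * a n \<omega> ^ 4 \<partial>gauss_space))"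
      by (subst vg, simp)+ (simp add: gauss_moments)
    also have "\<dots> \<le> 3 * K ^ 4 * (real n)\<^sup>2 + (6 * (K ^ 4 * n) + 3 * K ^ 4)"
      using Suc(2) b2 b4 by (simp add: Y_def)
    also have "\<dots> = 3 * K ^ 4 * (real (Suc n))\<^sup>2" by (simp add: power2_eq_square algebra_simps)
    finally show ?case .
  }
qed

end

section \<open>The rotation scheme\<close>

lemma abs_sin_minus_le2: "\<bar>sin t - t\<bar> \<le> t\<^sup>2 / 2" for t :: real
  using Maclaurin_sin_bound[of t 2] by (simp add: numeral_2_eq_2 sin_coeff_def)

lemma abs_sin_minus_le3: "\<bar>sin t - t\<bar> \<le> \<bar>t\<bar> ^ 3 / 6" for t :: real
  using Maclaurin_sin_bound[of t 3] by (simp add: numeral_3_eq_3 numeral_2_eq_2 sin_coeff_def divide_simps)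

lemma abs_cos_minus_le1: "\<bar>cos t - 1\<bar> \<le> \<bar>t\<bar>" for t :: real
proof -
  obtain s where "cos t = (\<Sum>m<1. cos_coeff m * t ^ m) + (cos (s + 1/2 * real (1::nat) * pi) / fact 1) * t ^ 1"
    using Maclaurin_cos_expansion[of t 1] by auto
  then have "cos t - 1 = cos (s + 1/2 * pi) * t" by simp
  then show ?thesis using mult_right_mono[OF abs_cos_le_one, of "\<bar>t\<bar>" "s + 1/2 * pi"] by (simp add: abs_mult)
qed

lemma abs_cos_minus_le2: "\<bar>cos t - 1\<bar> \<le> t\<^sup>2 / 2" for t :: real
proof -
  obtain s where "cos t = (\<Sum>m<2. cos_coeff m * t ^ m) + (cos (s + 1/2 * real (2::nat) * pi) / fact 2) * t ^ 2"
    using Maclaurin_cos_expansion[of t 2] by auto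
  then have "cos t - 1 = cos (s + pi) * (t\<^sup>2 / 2)" by (simp add: numeral_2_eq_2 cos_coeff_def)
  then show ?thesis using mult_right_mono[OF abs_cos_le_one, of "t\<^sup>2 / 2" "s + pi"] by (simp add: abs_mult)
qed

lemma abs_cos_minus_le3: "\<bar>cos t - 1 + t\<^sup>2 / 2\<bar> \<le> \<bar>t\<bar> ^ 3 / 6" for t :: real
proof -
  obtain s where "cos t = (\<Sum>m<3. cos_coeff m * t ^ m) + (cos (s + 1/2 * real (3::nat) * pi) / fact 3) * t ^ 3"
    using Maclaurin_cos_expansion[of t 3] by blast
  then have "cos t - 1 + t\<^sup>2 / 2 = cos (s + 1/2 * real (3::nat) * pi) * (t ^ 3 / 6)"
    by (simp add: numeral_3_eq_3 numeral_2_eq_2 cos_coeff_def)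
  then have "\<bar>cos t - 1 + t\<^sup>2 / 2\<bar> = \<bar>cos (s + 1/2 * real (3::nat) * pi) * (t ^ 3 / 6)\<bar>" by (rule arg_cong)
  also have "\<dots> = \<bar>cos (s + 1/2 * real (3::nat) * pi)\<bar> * (\<bar>t\<bar> ^ 3 / 6)" by (simp add: abs_mult power_abs)
  also have "\<dots> \<le> 1 * (\<bar>t\<bar> ^ 3 / 6)" by (rule mult_right_mono[OF abs_cos_le_one]) simp
  finally show ?thesis by simp
qed

text \<open>The angle of plane \<open>n\<close> acts after those of all lower planes: \<open>rot \<theta> y n\<close> is the value of mode \<open>n\<close> when the
  rotations \<open>0, \<dots>, n - 1\<close> have been applied, so that the infinite composition needs no truncation.\<close>

primrec rot :: "(nat \<Rightarrow> real) \<Rightarrow> (nat \<Rightarrow> real) \<Rightarrow> nat \<Rightarrow> real" where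
  "rot \<theta> y 0 = y 0"
| "rot \<theta> y (Suc n) = cos (\<theta> n) * y (Suc n) + sin (\<theta> n) * rot \<theta> y n"

text \<open>Plane n is the last one that moves mode n: the final value mixes the intermediate value
  left by the lower planes with mode n + 1, which is still untouched.\<close>

definition rot_step :: "(nat \<Rightarrow> real) \<Rightarrow> (nat \<Rightarrow> real) \<Rightarrow> nat \<Rightarrow> real" where
  "rot_step \<theta> y n = cos (\<theta> n) * rot \<theta> y n - sin (\<theta> n) * y (Suc n)"

text \<open>The first n planes act as an orthogonal map on the modes 0 to n; after them the modes
  below n are final and mode n is intermediate. The infinite composition may lose energy at
  infinity, so only inequalities are drawn from this identity.\<close>

lemma rot_energy: "(\<Sum>j<n. (rot_step \<theta> y j)\<^sup>2) + (rot \<theta> y n)\<^sup>2 = (\<Sum>j<Suc n. (y j)\<^sup>2)"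
proof (induction n)
  case (Suc n)
  let ?c = "cos (\<theta> n)" and ?s = "sin (\<theta> n)" and ?r = "rot \<theta> y n" and ?y = "y (Suc n)"
  have "(rot_step \<theta> y n)\<^sup>2 + (rot \<theta> y (Suc n))\<^sup>2 = (?c * ?r - ?s * ?y)\<^sup>2 + (?c * ?y + ?s * ?r)\<^sup>2"
    by (simp add: rot_step_def)
  also have "\<dots> = (?s\<^sup>2 + ?c\<^sup>2) * (?r\<^sup>2 + ?y\<^sup>2)" by (simp only: power2_eq_square) algebra
  also have "\<dots> = ?r\<^sup>2 + ?y\<^sup>2" by simp
  finally show ?case using Suc by simp
qed simp

lemma abs_le_of_sum_squares:
  fixes y :: "nat \<Rightarrow> real"
  assumes "\<And>n. (\<Sum>j<n. (y j)\<^sup>2) \<le> R\<^sup>2" "0 \<le> R"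
  shows "\<bar>y n\<bar> \<le> R"
proof -
  have "(y n)\<^sup>2 \<le> (\<Sum>j<Suc n. (y j)\<^sup>2)" by (simp add: sum_nonneg)
  also have "\<dots> \<le> R\<^sup>2" by (rule assms(1))
  finally show ?thesis using assms(2) by (simp add: abs_le_square_iff[symmetric])
qed

lemma rot_step_sum_le:
  assumes "\<And>n. (\<Sum>j<n. (y j)\<^sup>2) \<le> R\<^sup>2"
  shows "(\<Sum>j<n. (rot_step \<theta> y j)\<^sup>2) \<le> R\<^sup>2"
  using rot_energy[where n=n and \<theta>=\<theta> and y=y] assms[of "Suc n"] zero_le_power2[of "rot \<theta> y n"] by linarith

lemma abs_rot_le:
  assumes "\<And>n. (\<Sum>j<n. (y j)\<^sup>2) \<le> R\<^sup>2" "0 \<le> R"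
  shows "\<bar>rot \<theta> y n\<bar> \<le> R"
proof -
  have "0 \<le> (\<Sum>j<n. (rot_step \<theta> y j)\<^sup>2)" by (simp add: sum_nonneg)
  then have "(rot \<theta> y n)\<^sup>2 \<le> R\<^sup>2" using rot_energy[where n=n and \<theta>=\<theta> and y=y] assms(1)[of "Suc n"] by linarith
  then show ?thesis using assms(2) by (simp add: abs_le_square_iff[symmetric])
qed

lemma abs_mult_le: "\<bar>a\<bar> \<le> A \<Longrightarrow> \<bar>b\<bar> \<le> B \<Longrightarrow> \<bar>a * b\<bar> \<le> A * B" for a b A B :: real
  unfolding abs_mult by (rule mult_mono) auto

lemma abs_sum6_le: "\<bar>a\<bar> \<le> A \<Longrightarrow> \<bar>b\<bar> \<le> B \<Longrightarrow> \<bar>c\<bar> \<le> C \<Longrightarrow> \<bar>d\<bar> \<le> D \<Longrightarrow> \<bar>e\<bar> \<le> E \<Longrightarrow> \<bar>f\<bar> \<le> F \<Longrightarrow>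
    \<bar>a + b + c + d + e - f\<bar> \<le> A + B + C + D + E + F" for a b c d e f :: real
  by linarith

section \<open>The local error of one step\<close>

text \<open>First order expansion for angles \<open>e + d\<close> with noise part e and drift part
  d. X is the mode itself, \<open>X1\<close> the next mode, \<open>Xt0\<close> and \<open>Xt\<close>
  the intermediate values of the previous mode and of the mode itself. With y of order
  \<open>sqrt h\<close> and q of order h the error is of order h; drift and Ito terms stay in the
  remainder, which is enough for increment bounds.\<close>

lemma rotation_local_error2:
  fixes \<theta> \<theta>' e e' d d' X X1 Xt0 Xt R y q :: real
  assumes R: "\<bar>X\<bar> \<le> R" "\<bar>X1\<bar> \<le> R" "\<bar>Xt0\<bar> \<le> R" "\<bar>Xt\<bar> \<le> R"
    and \<theta>: "\<theta> = e + d" "\<bar>\<theta>\<bar> \<le> y" "\<bar>d\<bar> \<le> q"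
    and \<theta>': "\<theta>' = e' + d'" "\<bar>\<theta>'\<bar> \<le> y" "\<bar>d'\<bar> \<le> q"
  shows "\<bar>(sin \<theta> * Xt0 + (cos \<theta> - 1) * X + (cos \<theta>' - 1) * Xt - sin \<theta>' * X1) - (e * Xt0 - e' * X1)\<bar> \<le> 2 * R * (y\<^sup>2 + q)"
proof -
  have sq: "t\<^sup>2 / 2 \<le> y\<^sup>2 / 2" if "\<bar>t\<bar> \<le> y" for t using power_mono[OF that, of 2] by simp
  have s: "\<bar>sin \<theta> - e\<bar> \<le> y\<^sup>2 / 2 + q" "\<bar>sin \<theta>' - e'\<bar> \<le> y\<^sup>2 / 2 + q"
    using abs_sin_minus_le2[of \<theta>] sq[OF \<theta>(2)] \<theta> abs_sin_minus_le2[of \<theta>'] sq[OF \<theta>'(2)] \<theta>' by linarith+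
  have c: "\<bar>cos \<theta> - 1\<bar> \<le> y\<^sup>2 / 2" "\<bar>cos \<theta>' - 1\<bar> \<le> y\<^sup>2 / 2"
    using abs_cos_minus_le2[of \<theta>] sq[OF \<theta>(2)] abs_cos_minus_le2[of \<theta>'] sq[OF \<theta>'(2)] by linarith+
  have "(sin \<theta> * Xt0 + (cos \<theta> - 1) * X + (cos \<theta>' - 1) * Xt - sin \<theta>' * X1) - (e * Xt0 - e' * X1)
    = (sin \<theta> - e) * Xt0 + (cos \<theta> - 1) * X + (cos \<theta>' - 1) * Xt - (sin \<theta>' - e') * X1" by (simp add: algebra_simps)
  also have "\<bar>\<dots>\<bar> \<le> (y\<^sup>2 / 2 + q) * R + y\<^sup>2 / 2 * R + y\<^sup>2 / 2 * R + (y\<^sup>2 / 2 + q) * R"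
    using abs_mult_le[OF s(1) R(3)] abs_mult_le[OF c(1) R(1)] abs_mult_le[OF c(2) R(4)] abs_mult_le[OF s(2) R(2)] by linarith
  also have "\<dots> = 2 * R * (y\<^sup>2 + q)" by (simp add: field_simps)
  finally show ?thesis .
qed

text \<open>One order further, so that the error is of order \<open>h * sqrt h\<close>. The terms
  \<open>e\<^sup>2 / 2\<close> and \<open>e'\<^sup>2 / 2\<close> come from the two cosines, and
  \<open>e * (Xt0 - X0)\<close> accounts for the noise acting on the intermediate value of the
  previous mode instead of its value at the start of the step.\<close>

lemma rotation_local_error3:
  fixes \<theta> \<theta>' e e' d d' X X0 X1 Xt0 Xt R y q :: real
  assumes R: "\<bar>X\<bar> \<le> R" "\<bar>X1\<bar> \<le> R" "\<bar>Xt0\<bar> \<le> R" "0 \<le> R"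
    and diff: "\<bar>Xt0 - X0\<bar> \<le> 2 * R * y" "\<bar>Xt - X\<bar> \<le> 2 * R * y"
    and \<theta>: "\<theta> = e + d" "\<bar>\<theta>\<bar> \<le> y" "\<bar>d\<bar> \<le> q" "\<bar>e\<bar> \<le> y"
    and \<theta>': "\<theta>' = e' + d'" "\<bar>\<theta>'\<bar> \<le> y" "\<bar>d'\<bar> \<le> q" "\<bar>e'\<bar> \<le> y"
  shows "\<bar>(sin \<theta> * Xt0 + (cos \<theta> - 1) * X + (cos \<theta>' - 1) * Xt - sin \<theta>' * X1)
     - (d * X0 - d' * X1 + e * X0 - e' * X1 + e * (Xt0 - X0) - e\<^sup>2 / 2 * X - e'\<^sup>2 / 2 * X)\<bar> \<le> 4 * R * (y ^ 3 + q * y)"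
proof -
  have y: "0 \<le> y" using \<theta>(2) by linarith
  have cube: "\<bar>t\<bar> ^ 3 / 6 \<le> y ^ 3 / 6" if "\<bar>t\<bar> \<le> y" for t using power_mono[OF that, of 3] by simp
  have sq: "t\<^sup>2 / 2 \<le> y\<^sup>2 / 2" if "\<bar>t\<bar> \<le> y" for t using power_mono[OF that, of 2] by simp
  have s: "\<bar>sin \<theta> - \<theta>\<bar> \<le> y ^ 3 / 6" "\<bar>sin \<theta>' - \<theta>'\<bar> \<le> y ^ 3 / 6"
    using abs_sin_minus_le3[of \<theta>] cube[OF \<theta>(2)] abs_sin_minus_le3[of \<theta>'] cube[OF \<theta>'(2)] by linarith+
  have c: "\<bar>cos t - 1 + e\<^sup>2 / 2\<bar> \<le> y ^ 3 / 6 + q * y" if t: "t = e + d" "\<bar>t\<bar> \<le> y" "\<bar>d\<bar> \<le> q" "\<bar>e\<bar> \<le> y" for t e d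
  proof -
    have "\<bar>d * (t + e)\<bar> \<le> q * (2 * y)" by (rule abs_mult_le) (use t in linarith)+
    moreover have "t\<^sup>2 - e\<^sup>2 = d * (t + e)" using t(1) by (simp add: power2_eq_square algebra_simps)
    ultimately have "\<bar>t\<^sup>2 / 2 - e\<^sup>2 / 2\<bar> \<le> q * y" by (simp add: field_simps)
    then show ?thesis using abs_cos_minus_le3[of t] cube[OF t(2)] by linarith
  qed
  have c2: "\<bar>cos \<theta>' - 1\<bar> \<le> y\<^sup>2 / 2" using abs_cos_minus_le2[of \<theta>'] sq[OF \<theta>'(2)] by linarith
  have "(sin \<theta> * Xt0 + (cos \<theta> - 1) * X + (cos \<theta>' - 1) * Xt - sin \<theta>' * X1)
     - (d * X0 - d' * X1 + e * X0 - e' * X1 + e * (Xt0 - X0) - e\<^sup>2 / 2 * X - e'\<^sup>2 / 2 * X)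
    = (sin \<theta> - \<theta>) * Xt0 + d * (Xt0 - X0) + (cos \<theta> - 1 + e\<^sup>2 / 2) * X + (cos \<theta>' - 1) * (Xt - X)
      + (cos \<theta>' - 1 + e'\<^sup>2 / 2) * X - (sin \<theta>' - \<theta>') * X1"
    unfolding \<theta>(1) \<theta>'(1) by (simp add: algebra_simps)
  also have "\<bar>\<dots>\<bar> \<le> y ^ 3 / 6 * R + q * (2 * R * y) + (y ^ 3 / 6 + q * y) * R + y\<^sup>2 / 2 * (2 * R * y)
      + (y ^ 3 / 6 + q * y) * R + y ^ 3 / 6 * R"
    by (rule abs_sum6_le[OF abs_mult_le[OF s(1) R(3)] abs_mult_le[OF \<theta>(3) diff(1)] abs_mult_le[OF c[OF \<theta>] R(1)]
      abs_mult_le[OF c2 diff(2)] abs_mult_le[OF c[OF \<theta>'] R(1)] abs_mult_le[OF s(2) R(2)]])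
  \<comment> \<open>The terms in q y fix the constant 4; the cubic terms use 5/3 of it, and the
    surplus is 7/3.\<close>
  also have "\<dots> = 4 * R * (y ^ 3 + q * y) - 7 / 3 * (R * y ^ 3)" by (simp add: power3_eq_cube power2_eq_square field_simps)
  also have "\<dots> \<le> 4 * R * (y ^ 3 + q * y)" using R(4) y by simp
  finally show ?thesis .
qed

text \<open>The Cauchy-Schwarz inequality, applied twice.\<close>

lemma sum_power4_le:
  fixes u :: "nat \<Rightarrow> real"
  assumes "finite I"
  shows "(\<Sum>i\<in>I. u i) ^ 4 \<le> real (card I) ^ 3 * (\<Sum>i\<in>I. u i ^ 4)"
proof -
  have s: "(\<Sum>i\<in>I. w i)\<^sup>2 \<le> real (card I) * (\<Sum>i\<in>I. (w i)\<^sup>2)" for w :: "nat \<Rightarrow> real"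
    using sum_squared_le_sum_of_squares[of w I] by (simp add: mult.commute)
  have "(\<Sum>i\<in>I. u i) ^ 4 = ((\<Sum>i\<in>I. u i)\<^sup>2)\<^sup>2" by simp
  also have "\<dots> \<le> (real (card I) * (\<Sum>i\<in>I. (u i)\<^sup>2))\<^sup>2" by (rule power_mono[OF s]) simp
  also have "\<dots> = (real (card I))\<^sup>2 * (\<Sum>i\<in>I. (u i)\<^sup>2)\<^sup>2" by (rule power_mult_distrib)
  also have "\<dots> \<le> (real (card I))\<^sup>2 * (real (card I) * (\<Sum>i\<in>I. ((u i)\<^sup>2)\<^sup>2))"
    by (intro mult_left_mono s) simp
  also have "\<dots> = real (card I) ^ 3 * (\<Sum>i\<in>I. u i ^ 4)" by (simp add: power3_eq_cube power2_eq_square[of "real (card I)"])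
  finally show ?thesis .
qed

lemma power4_sum3_le: "(p - q + r) ^ 4 \<le> 27 * (p ^ 4 + q ^ 4 + r ^ 4)" for p q r :: real
proof -
  let ?u = "\<lambda>i::nat. if i = 0 then p else if i = 1 then - q else r"
  show ?thesis using sum_power4_le[of "{0,1,2}" ?u] by (simp add: algebra_simps)
qed

section \<open>A majorant for the noise and the information available at each step\<close>

text \<open>Common majorant of the noise that enters the increment of mode m + 1: the planes m and m
  + 1 rotate this mode, and plane m - 1 moves the intermediate value of mode m. The summand 1 makes
  the powers increasing, so that different remainders can be bounded by a single power.\<close>

definition gauss_abs :: "nat \<Rightarrow> (nat \<times> nat \<Rightarrow> real) \<Rightarrow> nat \<Rightarrow> real" where
  "gauss_abs m \<omega> i = 1 + \<bar>\<omega> (m - 1, i)\<bar> + \<bar>\<omega> (m, i)\<bar> + \<bar>\<omega> (Suc m, i)\<bar>"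

text \<open>Eighth moments are the highest that occur, as fourth moments of remainders quadratic in
  the noise. The factor \<open>4 ^ 8\<close> arises from bounding a sum of four numbers by four
  times their maximum.\<close>

definition gauss_abs_const :: real where
  "gauss_abs_const = 4 ^ 8 * (1 + 3 * (\<integral>x. x ^ 8 \<partial>std_normal_distribution))"

lemma gauss_abs_const_nonneg: "0 \<le> gauss_abs_const"
proof -
  have "0 \<le> (\<integral>x. x ^ 8 \<partial>std_normal_distribution)" by (rule Bochner_Integration.integral_nonneg) simp
  then show ?thesis by (simp add: gauss_abs_const_def)
qed

lemma gauss_abs_ge1: "1 \<le> gauss_abs m \<omega> i" by (simp add: gauss_abs_def)

lemma gauss_abs_measurable [measurable]: "(\<lambda>\<omega>. gauss_abs m \<omega> i) \<in> borel_measurable borel"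
  unfolding gauss_abs_def by measurable

lemma gauss_abs_moment:
  assumes "p \<le> 8"
  shows "integrable gauss_space (\<lambda>\<omega>. gauss_abs m \<omega> i ^ p)" "(\<integral>\<omega>. gauss_abs m \<omega> i ^ p \<partial>gauss_space) \<le> gauss_abs_const"
proof -
  let ?G = "\<lambda>\<omega>::nat \<times> nat \<Rightarrow> real. 4 ^ 8 * (1 + \<omega> (m - 1, i) ^ 8 + \<omega> (m, i) ^ 8 + \<omega> (Suc m, i) ^ 8)"
  have le: "gauss_abs m \<omega> i ^ p \<le> ?G \<omega>" for \<omega>
  proof -
    have "gauss_abs m \<omega> i ^ p \<le> gauss_abs m \<omega> i ^ 8" by (rule power_increasing[OF assms gauss_abs_ge1])
    also have "\<dots> \<le> ?G \<omega>"
    proof -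
      have gen: "(1 + a + b + c) ^ 8 \<le> 4 ^ 8 * (1 + a ^ 8 + b ^ 8 + c ^ 8)" if "0 \<le> a" "0 \<le> b" "0 \<le> c" for a b c :: real
      proof -
        define M where "M = max 1 (max a (max b c))"
        have "(1 + a + b + c) ^ 8 \<le> (4 * M) ^ 8" by (rule power_mono) (use that in \<open>auto simp: M_def\<close>)
        also have "\<dots> = 4 ^ 8 * M ^ 8" by (rule power_mult_distrib)
        also have "M ^ 8 \<le> 1 + a ^ 8 + b ^ 8 + c ^ 8"
        proof -
          have "M = 1 \<or> M = a \<or> M = b \<or> M = c" by (auto simp: M_def max_def)
          moreover have "0 \<le> a ^ 8" "0 \<le> b ^ 8" "0 \<le> c ^ 8" using that by auto
          ultimately show ?thesis by auto
        qed
        finally show ?thesis by simp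
      qed
      show ?thesis unfolding gauss_abs_def using gen[of "\<bar>\<omega> (m - 1, i)\<bar>" "\<bar>\<omega> (m, i)\<bar>" "\<bar>\<omega> (Suc m, i)\<bar>"]
        by (simp add: power_even_abs)
    qed
    finally show ?thesis .
  qed
  have pos: "0 \<le> gauss_abs m \<omega> i ^ p" for \<omega> using gauss_abs_ge1[of m \<omega> i] by simp
  have G: "integrable gauss_space ?G" by (intro integrable_mult_right Bochner_Integration.integrable_add) auto
  show int: "integrable gauss_space (\<lambda>\<omega>. gauss_abs m \<omega> i ^ p)"
    by (rule Bochner_Integration.integrable_bound[OF G]) (use le pos in \<open>auto intro: order_trans[OF _ abs_ge_self]\<close>)
  have "(\<integral>\<omega>. gauss_abs m \<omega> i ^ p \<partial>gauss_space) \<le> (\<integral>\<omega>. ?G \<omega> \<partial>gauss_space)"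
    by (rule integral_mono[OF int G le])
  also have "\<dots> = gauss_abs_const"
  proof -
    have "(\<integral>\<omega>. \<omega> j ^ 8 \<partial>gauss_space) = (\<integral>x. x ^ 8 \<partial>std_normal_distribution)" for j :: "nat \<times> nat"
      using gauss_integral_coordinate(1)[of "\<lambda>x. x ^ 8" j] by simp
    then show ?thesis by (simp add: gauss_abs_const_def)
  qed
  finally show "(\<integral>\<omega>. gauss_abs m \<omega> i ^ p \<partial>gauss_space) \<le> gauss_abs_const" .
qed

definition past :: "nat \<Rightarrow> (nat \<times> nat) set" where "past i = {(j, l). l < i}"
text \<open>In a pair (j, l), j is the plane and l the time step. Besides the completed steps, the
  planes below n of step i are known: this is the information contained in the intermediate value of
  mode n.\<close>

definition past_upto :: "nat \<Rightarrow> nat \<Rightarrow> (nat \<times> nat) set" where "past_upto n i = {(j, l). l < i \<or> l = i \<and> j < n}"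

lemma past_subset_upto: "past i \<subseteq> past_upto n i"
  by (auto simp: past_def past_upto_def)

lemma not_in_past_upto: "(n, i) \<notin> past_upto n i"
  by (simp add: past_upto_def)

lemma past_mono: "i \<le> j \<Longrightarrow> past i \<subseteq> past j"
  by (auto simp: past_def)

section \<open>The scheme, its energy bound and its adaptedness\<close>

locale dyadic =
  fixes T \<sigma> :: real and k x :: "nat \<Rightarrow> real" and R :: real
  assumes T_pos: "0 < T" and k0: "k 0 = 0" and x0: "x 0 = 0" and R0: "0 \<le> R"
    and x_sum: "\<And>n. (\<Sum>j<n. (x j)\<^sup>2) \<le> R\<^sup>2"
begin

primrec X :: "real \<Rightarrow> (nat \<times> nat \<Rightarrow> real) \<Rightarrow> nat \<Rightarrow> nat \<Rightarrow> real" where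
  "X h \<omega> 0 = x"
| "X h \<omega> (Suc i) = rot_step (\<lambda>n. k n * (h * X h \<omega> i n + \<sigma> * sqrt h * \<omega> (n, i))) (X h \<omega> i)"

definition angle :: "real \<Rightarrow> (nat \<times> nat \<Rightarrow> real) \<Rightarrow> nat \<Rightarrow> nat \<Rightarrow> real" where
  "angle h \<omega> i n = k n * (h * X h \<omega> i n + \<sigma> * sqrt h * \<omega> (n, i))"

definition Xt :: "real \<Rightarrow> (nat \<times> nat \<Rightarrow> real) \<Rightarrow> nat \<Rightarrow> nat \<Rightarrow> real" where
  "Xt h \<omega> i = rot (angle h \<omega> i) (X h \<omega> i)"

lemma X_Suc: "X h \<omega> (Suc i) = rot_step (angle h \<omega> i) (X h \<omega> i)"
  by (simp add: angle_def[abs_def])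

lemma X_sum: "(\<Sum>j<n. (X h \<omega> i j)\<^sup>2) \<le> R\<^sup>2"
  by (induction i arbitrary: n) (simp_all only: X_Suc rot_step_sum_le X.simps(1) x_sum)

lemma X_bound: "\<bar>X h \<omega> i n\<bar> \<le> R"
  using X_sum R0 by (rule abs_le_of_sum_squares)

lemma Xt_bound: "\<bar>Xt h \<omega> i n\<bar> \<le> R"
  unfolding Xt_def using X_sum R0 by (rule abs_rot_le)

text \<open>Plane 0 never turns because \<open>k 0 = 0\<close>, so the convention of a vanishing
  mode 0 is preserved by the scheme.\<close>

lemma X_0 [simp]: "X h \<omega> i 0 = 0"
proof (induction i)
  case (Suc i)
  have "angle h \<omega> i 0 = 0" by (simp add: angle_def k0)
  then show ?case using Suc by (simp only: X_Suc) (simp add: rot_step_def)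
qed (simp add: x0)

lemma rot_measurable:
  assumes [measurable]: "\<And>n. (\<lambda>\<omega>. \<theta> \<omega> n) \<in> borel_measurable M" "\<And>n. (\<lambda>\<omega>. y \<omega> n) \<in> borel_measurable M"
  shows "(\<lambda>\<omega>. rot (\<theta> \<omega>) (y \<omega>) n) \<in> borel_measurable M"
  by (induction n) simp_all

lemma X_measurable [measurable]: "(\<lambda>\<omega>. X h \<omega> i n) \<in> borel_measurable borel"
proof (induction i arbitrary: n)
  case (Suc i)
  note [measurable] = Suc
  have [measurable]: "(\<lambda>\<omega>. angle h \<omega> i n) \<in> borel_measurable borel" for n unfolding angle_def by measurable
  note [measurable] = rot_measurable[of "\<lambda>\<omega>. angle h \<omega> i" borel "\<lambda>\<omega>. X h \<omega> i", OF this Suc]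
  show ?case unfolding X_Suc rot_step_def by measurable
qed simp

lemma angle_measurable [measurable]: "(\<lambda>\<omega>. angle h \<omega> i n) \<in> borel_measurable borel"
  unfolding angle_def by measurable

lemma Xt_measurable [measurable]: "(\<lambda>\<omega>. Xt h \<omega> i n) \<in> borel_measurable borel"
  unfolding Xt_def by (rule rot_measurable) measurable

lemma X_eq_past: "(\<And>p. p \<in> past i \<Longrightarrow> \<omega> p = \<omega>' p) \<Longrightarrow> X h \<omega> i = X h \<omega>' i"
proof (induction i)
  case (Suc i)
  have X: "X h \<omega> i = X h \<omega>' i" by (rule Suc) (use Suc(2) past_mono[of i "Suc i"] in auto)
  have "\<omega> (n, i) = \<omega>' (n, i)" for n by (rule Suc(2)) (simp add: past_def)
  then have "angle h \<omega> i = angle h \<omega>' i" by (simp add: angle_def fun_eq_iff X)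
  then show ?case unfolding X_Suc X by simp
qed simp

lemma depends_X: "depends_on (past i) (\<lambda>\<omega>. X h \<omega> i n)"
  unfolding depends_on_def by (metis X_eq_past)

text \<open>Planes act in increasing order, so the intermediate value of mode n at step i has not
  met the noise of plane n. Hence \<open>Xt h \<omega> i n * \<omega> (n, i)\<close> is a martingale
  increment although \<open>Xt\<close> already uses noise of the current step.\<close>

lemma depends_Xt: "depends_on (past_upto n i) (\<lambda>\<omega>. Xt h \<omega> i n)"
  unfolding depends_on_def
proof (intro allI impI)
  fix \<omega> \<omega>' :: "nat \<times> nat \<Rightarrow> real" assume eq: "\<forall>p\<in>past_upto n i. \<omega> p = \<omega>' p"
  have X: "X h \<omega> i = X h \<omega>' i" by (rule X_eq_past) (use eq past_subset_upto in blast)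
  have "m \<le> n \<Longrightarrow> rot (angle h \<omega> i) (X h \<omega> i) m = rot (angle h \<omega>' i) (X h \<omega>' i) m" for m
  proof (induction m)
    case (Suc m)
    have "\<omega> (m, i) = \<omega>' (m, i)" using eq Suc(2) by (auto simp: past_upto_def)
    then have "angle h \<omega> i m = angle h \<omega>' i m" by (simp add: angle_def X)
    then show ?case using Suc by (simp add: X)
  qed (simp add: X)
  then show "Xt h \<omega> i n = Xt h \<omega>' i n" by (simp add: Xt_def)
qed

lemma stoch_predictable:
  assumes [measurable]: "\<And>l. c l \<in> borel_measurable borel" and dep: "\<And>l. depends_on (past_upto j l) (c l)"
    and b: "\<And>l \<omega>. \<bar>c l \<omega>\<bar> \<le> K"
  shows "predictable (\<lambda>l \<omega>. c (a + l) \<omega>) (\<lambda>l. (j, a + l)) (\<lambda>l. past_upto j (a + l)) K"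
  by unfold_locales (use dep b not_in_past_upto in \<open>auto simp: past_upto_def\<close>)

lemma stoch_fourth:
  assumes c: "\<And>l. c l \<in> borel_measurable borel" "\<And>l. depends_on (past_upto j l) (c l)" "\<And>l \<omega>. \<bar>c l \<omega>\<bar> \<le> K"
    and h: "0 \<le> h" and ab: "a \<le> b"
  shows "integrable gauss_space (\<lambda>\<omega>. (\<Sum>l\<in>{a..<b}. c l \<omega> * (sqrt h * \<omega> (j, l))) ^ 4)"
    "(\<integral>\<omega>. (\<Sum>l\<in>{a..<b}. c l \<omega> * (sqrt h * \<omega> (j, l))) ^ 4 \<partial>gauss_space) \<le> 3 * K ^ 4 * (real (b - a) * h)\<^sup>2"
proof -
  interpret predictable "\<lambda>l \<omega>. c (a + l) \<omega>" "\<lambda>l. (j, a + l)" "\<lambda>l. past_upto j (a + l)" K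
    by (rule stoch_predictable[OF c])
  have eq: "(\<Sum>l\<in>{a..<b}. c l \<omega> * (sqrt h * \<omega> (j, l))) ^ 4 = h\<^sup>2 * (\<Sum>l<b - a. c (a + l) \<omega> * \<omega> (j, a + l)) ^ 4" for \<omega>
  proof -
    have "(\<Sum>l\<in>{a..<b}. c l \<omega> * (sqrt h * \<omega> (j, l))) = (\<Sum>l<b - a. c (a + l) \<omega> * (sqrt h * \<omega> (j, a + l)))"
      by (rule sum.reindex_bij_witness[of _ "\<lambda>l. a + l" "\<lambda>l. l - a"]) (use ab in auto)
    also have "\<dots> = sqrt h * (\<Sum>l<b - a. c (a + l) \<omega> * \<omega> (j, a + l))" by (simp add: sum_distrib_left mult_ac)
    finally have "(\<Sum>l\<in>{a..<b}. c l \<omega> * (sqrt h * \<omega> (j, l))) ^ 4 = sqrt h ^ 4 * (\<Sum>l<b - a. c (a + l) \<omega> * \<omega> (j, a + l)) ^ 4"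
      by (simp add: power_mult_distrib)
    also have "sqrt h ^ 4 = (sqrt h ^ 2) ^ 2" by simp
    also have "\<dots> = h\<^sup>2" using h by simp
    finally show ?thesis .
  qed
  show "integrable gauss_space (\<lambda>\<omega>. (\<Sum>l\<in>{a..<b}. c l \<omega> * (sqrt h * \<omega> (j, l))) ^ 4)"
    unfolding eq by (intro integrable_mult_right fourth_moment)
  have "(\<integral>\<omega>. (\<Sum>l\<in>{a..<b}. c l \<omega> * (sqrt h * \<omega> (j, l))) ^ 4 \<partial>gauss_space) \<le> h\<^sup>2 * (3 * K ^ 4 * (real (b - a))\<^sup>2)"
    unfolding eq using fourth_moment(2)[of "b - a"] by (simp add: mult_left_mono)
  then show "(\<integral>\<omega>. (\<Sum>l\<in>{a..<b}. c l \<omega> * (sqrt h * \<omega> (j, l))) ^ 4 \<partial>gauss_space) \<le> 3 * K ^ 4 * (real (b - a) * h)\<^sup>2"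
    by (simp add: power_mult_distrib mult_ac)
qed

lemma stoch_second:
  fixes \<phi> :: "real \<Rightarrow> real"
  assumes c: "\<And>l. c l \<in> borel_measurable borel" "\<And>l. depends_on (past_upto j l) (c l)" "\<And>l \<omega>. \<bar>c l \<omega>\<bar> \<le> K"
    and \<phi>: "\<phi> \<in> borel_measurable borel" "integrable std_normal_distribution \<phi>" "integrable std_normal_distribution (\<lambda>x. \<phi> x ^ 2)"
    "(\<integral>x. \<phi> x \<partial>std_normal_distribution) = 0"
    and le: "\<And>l. l < b \<Longrightarrow> (\<integral>\<omega>. (c l \<omega>)\<^sup>2 \<partial>gauss_space) \<le> D"
  shows "integrable gauss_space (\<lambda>\<omega>. (\<Sum>l<b. c l \<omega> * \<phi> (\<omega> (j, l)))\<^sup>2)"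
    "(\<integral>\<omega>. (\<Sum>l<b. c l \<omega> * \<phi> (\<omega> (j, l)))\<^sup>2 \<partial>gauss_space) \<le> (\<integral>x. \<phi> x ^ 2 \<partial>std_normal_distribution) * (real b * D)"
proof -
  interpret predictable c "\<lambda>l. (j, l)" "\<lambda>l. past_upto j l" K
    using stoch_predictable[of c j K 0, OF c] by simp
  note m = second_moment[OF \<phi>, of b]
  show "integrable gauss_space (\<lambda>\<omega>. (\<Sum>l<b. c l \<omega> * \<phi> (\<omega> (j, l)))\<^sup>2)" by (rule m(1))
  have "(\<Sum>l<b. \<integral>\<omega>. (c l \<omega>)\<^sup>2 \<partial>gauss_space) \<le> (\<Sum>l<b. D)" by (intro sum_mono le) simp
  then show "(\<integral>\<omega>. (\<Sum>l<b. c l \<omega> * \<phi> (\<omega> (j, l)))\<^sup>2 \<partial>gauss_space) \<le> (\<integral>x. \<phi> x ^ 2 \<partial>std_normal_distribution) * (real b * D)"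
    unfolding m(2) by (intro mult_left_mono Bochner_Integration.integral_nonneg) auto
qed

text \<open>Large enough to bound the noise part, the drift part and the whole angle at once, for
  the planes m - 1, m and m + 1. The factor \<open>sqrt T\<close> comes from
  \<open>h \<le> sqrt T * sqrt h\<close>, which rates the drift part of an angle as
  \<open>sqrt h\<close>.\<close>

definition angle_const :: "nat \<Rightarrow> real" where
  "angle_const m = (\<bar>k (m - 1)\<bar> + \<bar>k m\<bar> + \<bar>k (Suc m)\<bar>) * ((sqrt T + 1) * R + \<bar>\<sigma>\<bar>)"

lemma angle_const_nonneg: "0 \<le> angle_const m" using R0 T_pos by (simp add: angle_const_def)

lemma angle_bounds:
  assumes h: "0 \<le> h" "h \<le> T" and j: "j = m - 1 \<or> j = m \<or> j = Suc m"
  shows "\<bar>angle h \<omega> i j\<bar> \<le> angle_const m * sqrt h * gauss_abs m \<omega> i"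
    "\<bar>k j * h * X h \<omega> i j\<bar> \<le> angle_const m * h"
    "\<bar>k j * (\<sigma> * sqrt h * \<omega> (j, i))\<bar> \<le> angle_const m * sqrt h * gauss_abs m \<omega> i"
proof -
  define \<kappa> where "\<kappa> = \<bar>k (m - 1)\<bar> + \<bar>k m\<bar> + \<bar>k (Suc m)\<bar>"
  define v where "v = gauss_abs m \<omega> i"
  have k: "\<bar>k j\<bar> \<le> \<kappa>" using j by (auto simp: \<kappa>_def)
  have \<kappa>0: "0 \<le> \<kappa>" by (simp add: \<kappa>_def)
  have v: "1 \<le> v" "\<bar>\<omega> (j, i)\<bar> \<le> v" using gauss_abs_ge1 j by (auto simp: v_def gauss_abs_def)
  have hs: "h \<le> sqrt T * sqrt h"
  proof -
    have "h = sqrt h * sqrt h" using h by simp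
    also have "\<dots> \<le> sqrt T * sqrt h" using h by (intro mult_right_mono) auto
    finally show ?thesis .
  qed
  have sh: "0 \<le> sqrt h" "0 \<le> sqrt T" using h T_pos by auto
  have Q: "angle_const m = \<kappa> * (sqrt T * R) + \<kappa> * R + \<kappa> * \<bar>\<sigma>\<bar>" by (simp add: angle_const_def \<kappa>_def algebra_simps)
  have d1: "\<bar>k j * h * X h \<omega> i j\<bar> \<le> \<kappa> * h * R"
    by (intro abs_mult_le X_bound) (use k h in auto)
  have d2: "\<kappa> * h * R \<le> \<kappa> * (sqrt T * R) * sqrt h * v"
  proof -
    have "\<kappa> * h * R \<le> \<kappa> * (sqrt T * sqrt h) * R" using hs \<kappa>0 R0 by (intro mult_right_mono mult_left_mono)
    also have "\<dots> = (\<kappa> * (sqrt T * R) * sqrt h) * 1" by simp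
    also have "\<dots> \<le> (\<kappa> * (sqrt T * R) * sqrt h) * v" using v \<kappa>0 R0 sh by (intro mult_left_mono) auto
    finally show ?thesis .
  qed
  have e: "\<bar>k j * (\<sigma> * sqrt h * \<omega> (j, i))\<bar> \<le> \<kappa> * (\<bar>\<sigma>\<bar> * sqrt h * v)"
    by (intro abs_mult_le k v) (use sh in auto)
  have pos: "0 \<le> \<kappa> * R * sqrt h * v" "0 \<le> \<kappa> * (sqrt T * R) * sqrt h * v" "0 \<le> \<kappa> * \<bar>\<sigma>\<bar> * sqrt h * v" "0 \<le> \<kappa> * (sqrt T * R) * h" "0 \<le> \<kappa> * \<bar>\<sigma>\<bar> * h"
    using \<kappa>0 R0 sh v h by auto
  have eq: "angle_const m * sqrt h * v = \<kappa> * (sqrt T * R) * sqrt h * v + \<kappa> * R * sqrt h * v + \<kappa> * \<bar>\<sigma>\<bar> * sqrt h * v"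
    by (simp add: Q algebra_simps)
  have eq2: "angle_const m * h = \<kappa> * (sqrt T * R) * h + \<kappa> * h * R + \<kappa> * \<bar>\<sigma>\<bar> * h"
    by (simp add: Q algebra_simps)
  have e': "\<kappa> * (\<bar>\<sigma>\<bar> * sqrt h * v) = \<kappa> * \<bar>\<sigma>\<bar> * sqrt h * v" by simp
  show "\<bar>k j * h * X h \<omega> i j\<bar> \<le> angle_const m * h" using d1 pos unfolding eq2 by linarith
  show "\<bar>k j * (\<sigma> * sqrt h * \<omega> (j, i))\<bar> \<le> angle_const m * sqrt h * gauss_abs m \<omega> i"
    using e pos unfolding v_def[symmetric] eq e' by linarith
  have "angle h \<omega> i j = k j * (\<sigma> * sqrt h * \<omega> (j, i)) + k j * h * X h \<omega> i j" by (simp add: angle_def algebra_simps)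
  then show "\<bar>angle h \<omega> i j\<bar> \<le> angle_const m * sqrt h * gauss_abs m \<omega> i"
    using e d1 d2 pos unfolding v_def[symmetric] eq e' by linarith
qed

lemma Xt_minus_X:
  assumes h: "0 \<le> h" "h \<le> T" and j: "j = m \<or> j = Suc m"
  shows "\<bar>Xt h \<omega> i j - X h \<omega> i j\<bar> \<le> 2 * R * (angle_const m * sqrt h * gauss_abs m \<omega> i)"
proof (cases j)
  case 0
  have "0 \<le> gauss_abs m \<omega> i" using gauss_abs_ge1[of m \<omega> i] by linarith
  then show ?thesis using 0 h R0 angle_const_nonneg[of m] by (simp add: Xt_def)
next
  case (Suc j')
  have a: "\<bar>angle h \<omega> i j'\<bar> \<le> angle_const m * sqrt h * gauss_abs m \<omega> i" by (rule angle_bounds(1)[OF h]) (use Suc j in auto)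
  have "Xt h \<omega> i j - X h \<omega> i j = (cos (angle h \<omega> i j') - 1) * X h \<omega> i j + sin (angle h \<omega> i j') * Xt h \<omega> i j'"
    unfolding Xt_def Suc by (simp add: algebra_simps)
  also have "\<bar>\<dots>\<bar> \<le> (angle_const m * sqrt h * gauss_abs m \<omega> i) * R + (angle_const m * sqrt h * gauss_abs m \<omega> i) * R"
    by (intro order_trans[OF abs_triangle_ineq] add_mono abs_mult_le X_bound Xt_bound
        order_trans[OF abs_cos_minus_le1 a] order_trans[OF abs_sin_x_le_abs_x a])
  finally show ?thesis by (simp add: algebra_simps)
qed

text \<open>Only the planes m and m + 1 touch mode m + 1, so its increment is an exact expression in
  two angles; it has the shape to which the local error bounds apply.\<close>

lemma X_increment:
  "X h \<omega> (Suc i) (Suc m) - X h \<omega> i (Suc m) = sin (angle h \<omega> i m) * Xt h \<omega> i m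
    + (cos (angle h \<omega> i m) - 1) * X h \<omega> i (Suc m) + (cos (angle h \<omega> i (Suc m)) - 1) * Xt h \<omega> i (Suc m)
    - sin (angle h \<omega> i (Suc m)) * X h \<omega> i (Suc (Suc m))"
proof -
  have "Xt h \<omega> i (Suc m) = cos (angle h \<omega> i m) * X h \<omega> i (Suc m) + sin (angle h \<omega> i m) * Xt h \<omega> i m"
    by (simp add: Xt_def)
  then show ?thesis unfolding X_Suc rot_step_def Xt_def[symmetric] by (simp add: algebra_simps)
qed

definition local_const2 :: "nat \<Rightarrow> real" where "local_const2 m = 2 * R * ((angle_const m)\<^sup>2 + angle_const m)"
definition local_const3 :: "nat \<Rightarrow> real" where "local_const3 m = 4 * R * (angle_const m ^ 3 + (angle_const m)\<^sup>2)"

lemma X_local2: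
  assumes h: "0 \<le> h" "h \<le> T"
  shows "\<bar>X h \<omega> (Suc i) (Suc m) - X h \<omega> i (Suc m)
    - (\<sigma> * k m * Xt h \<omega> i m * (sqrt h * \<omega> (m, i)) - \<sigma> * k (Suc m) * X h \<omega> i (Suc (Suc m)) * (sqrt h * \<omega> (Suc m, i)))\<bar>
    \<le> local_const2 m * h * gauss_abs m \<omega> i ^ 2"
proof -
  let ?y = "angle_const m * sqrt h * gauss_abs m \<omega> i" and ?q = "angle_const m * h"
  let ?e = "\<lambda>j. k j * (\<sigma> * sqrt h * \<omega> (j, i))" and ?d = "\<lambda>j. k j * h * X h \<omega> i j"
  have a: "angle h \<omega> i j = ?e j + ?d j" for j by (simp add: angle_def algebra_simps)
  note err = rotation_local_error2[OF X_bound[of h \<omega> i "Suc m"] X_bound[of h \<omega> i "Suc (Suc m)"] Xt_bound[of h \<omega> i m] Xt_bound[of h \<omega> i "Suc m"]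
      a angle_bounds(1,2)[OF h, of m m \<omega> i, simplified] a angle_bounds(1,2)[OF h, of "Suc m" m \<omega> i, simplified]]
  have "2 * R * (?y\<^sup>2 + ?q) \<le> local_const2 m * h * gauss_abs m \<omega> i ^ 2"
  proof -
    have y2: "?y\<^sup>2 = (angle_const m)\<^sup>2 * (h * (gauss_abs m \<omega> i)\<^sup>2)" using h by (simp add: power_mult_distrib)
    have "1 \<le> (gauss_abs m \<omega> i)\<^sup>2" using gauss_abs_ge1[of m \<omega> i] by (simp add: one_le_power)
    then have "?q * 1 \<le> ?q * (gauss_abs m \<omega> i)\<^sup>2" using angle_const_nonneg h by (intro mult_left_mono) auto
    then have "2 * R * (?y\<^sup>2 + ?q) \<le> 2 * R * (?y\<^sup>2 + ?q * (gauss_abs m \<omega> i)\<^sup>2)" using R0 by (intro mult_left_mono) auto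
    also have "\<dots> = local_const2 m * h * gauss_abs m \<omega> i ^ 2" unfolding y2 local_const2_def by (simp add: algebra_simps)
    finally show ?thesis .
  qed
  moreover have "?e m * Xt h \<omega> i m - ?e (Suc m) * X h \<omega> i (Suc (Suc m)) =
    \<sigma> * k m * Xt h \<omega> i m * (sqrt h * \<omega> (m, i)) - \<sigma> * k (Suc m) * X h \<omega> i (Suc (Suc m)) * (sqrt h * \<omega> (Suc m, i))" by simp
  ultimately show ?thesis unfolding X_increment using err by linarith
qed

definition drift :: "nat \<Rightarrow> (nat \<Rightarrow> real) \<Rightarrow> real" where
  "drift n y = (k (n - 1) * (y (n - 1))\<^sup>2 - k n * y n * y (Suc n)) - \<sigma>\<^sup>2 / 2 * ((k n)\<^sup>2 + (k (n - 1))\<^sup>2) * y n"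

text \<open>Writing the squared noise as 1 plus a centred part separates the Ito correction, which
  completes \<open>drift\<close>, from fluctuations. The fluctuations are kept explicitly: they are
  of size h per step, and only their orthogonality makes the sum over all steps small.\<close>

lemma X_local3:
  assumes h: "0 \<le> h" "h \<le> T"
  shows "\<bar>X h \<omega> (Suc i) (Suc m) - X h \<omega> i (Suc m) -
     (h * drift (Suc m) (X h \<omega> i)
      + \<sigma> * k m * X h \<omega> i m * (sqrt h * \<omega> (m, i)) - \<sigma> * k (Suc m) * X h \<omega> i (Suc (Suc m)) * (sqrt h * \<omega> (Suc m, i))
      + \<sigma> * k m * sqrt h * (Xt h \<omega> i m - X h \<omega> i m) * \<omega> (m, i)
      - (k m)\<^sup>2 * \<sigma>\<^sup>2 * h / 2 * X h \<omega> i (Suc m) * ((\<omega> (m, i))\<^sup>2 - 1)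
      - (k (Suc m))\<^sup>2 * \<sigma>\<^sup>2 * h / 2 * X h \<omega> i (Suc m) * ((\<omega> (Suc m, i))\<^sup>2 - 1))\<bar>
    \<le> local_const3 m * (h * sqrt h) * gauss_abs m \<omega> i ^ 3"
proof -
  let ?y = "angle_const m * sqrt h * gauss_abs m \<omega> i" and ?q = "angle_const m * h"
  let ?e = "\<lambda>j. k j * (\<sigma> * sqrt h * \<omega> (j, i))" and ?d = "\<lambda>j. k j * h * X h \<omega> i j"
  have a: "angle h \<omega> i j = ?e j + ?d j" for j by (simp add: angle_def algebra_simps)
  have e2: "(?e j)\<^sup>2 / 2 * X h \<omega> i (Suc m) = (k j)\<^sup>2 * \<sigma>\<^sup>2 * h / 2 * X h \<omega> i (Suc m) * (\<omega> (j, i))\<^sup>2" for j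
    using h by (simp add: power_mult_distrib)
  note err = rotation_local_error3[OF X_bound X_bound Xt_bound R0 Xt_minus_X[OF h, of m m \<omega> i, simplified] Xt_minus_X[OF h, of "Suc m" m \<omega> i, simplified]
      a angle_bounds[OF h, of m m \<omega> i, simplified] a angle_bounds[OF h, of "Suc m" m \<omega> i, simplified],
      of h \<omega> i "Suc (Suc m)"]
  have "4 * R * (?y ^ 3 + ?q * ?y) \<le> local_const3 m * (h * sqrt h) * gauss_abs m \<omega> i ^ 3"
  proof -
    let ?v = "gauss_abs m \<omega> i"
    have "sqrt h ^ 3 = h * sqrt h" using h by (simp add: power3_eq_cube)
    then have y3: "?y ^ 3 = angle_const m ^ 3 * (h * sqrt h) * ?v ^ 3" by (simp add: power_mult_distrib)
    have qy: "?q * ?y = (angle_const m)\<^sup>2 * (h * sqrt h) * ?v" by (simp add: power2_eq_square)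
    have "?v \<le> ?v ^ 3" using power_increasing[of 1 3 ?v] gauss_abs_ge1[of m \<omega> i] by simp
    then have "(angle_const m)\<^sup>2 * (h * sqrt h) * ?v \<le> (angle_const m)\<^sup>2 * (h * sqrt h) * ?v ^ 3" using h by (intro mult_left_mono) auto
    then have "4 * R * (?y ^ 3 + ?q * ?y) \<le> 4 * R * (angle_const m ^ 3 * (h * sqrt h) * ?v ^ 3 + (angle_const m)\<^sup>2 * (h * sqrt h) * ?v ^ 3)"
      unfolding y3 qy using R0 by (intro mult_left_mono) auto
    also have "\<dots> = local_const3 m * (h * sqrt h) * ?v ^ 3" unfolding local_const3_def by (simp add: algebra_simps)
    finally show ?thesis .
  qed
  moreover have "?d m * X h \<omega> i m - ?d (Suc m) * X h \<omega> i (Suc (Suc m)) + ?e m * X h \<omega> i m - ?e (Suc m) * X h \<omega> i (Suc (Suc m))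
      + ?e m * (Xt h \<omega> i m - X h \<omega> i m) - (?e m)\<^sup>2 / 2 * X h \<omega> i (Suc m) - (?e (Suc m))\<^sup>2 / 2 * X h \<omega> i (Suc m)
    = h * drift (Suc m) (X h \<omega> i)
      + \<sigma> * k m * X h \<omega> i m * (sqrt h * \<omega> (m, i)) - \<sigma> * k (Suc m) * X h \<omega> i (Suc (Suc m)) * (sqrt h * \<omega> (Suc m, i))
      + \<sigma> * k m * sqrt h * (Xt h \<omega> i m - X h \<omega> i m) * \<omega> (m, i)
      - (k m)\<^sup>2 * \<sigma>\<^sup>2 * h / 2 * X h \<omega> i (Suc m) * ((\<omega> (m, i))\<^sup>2 - 1)
      - (k (Suc m))\<^sup>2 * \<sigma>\<^sup>2 * h / 2 * X h \<omega> i (Suc m) * ((\<omega> (Suc m, i))\<^sup>2 - 1)"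
    unfolding e2 drift_def by (simp add: field_simps power2_eq_square)
  ultimately show ?thesis unfolding X_increment using err by linarith
qed

end

lemma sum_lessThan_diff: "a \<le> b \<Longrightarrow> (\<Sum>l<b. f l) - (\<Sum>l<a. f l) = (\<Sum>l\<in>{a..<b}. f l)" for f :: "nat \<Rightarrow> real"
  using sum_diff_nat_ivl[of 0 a b f] by (simp add: atLeast0LessThan)

lemma sum_square_le: "finite I \<Longrightarrow> (\<Sum>i\<in>I. w i)\<^sup>2 \<le> real (card I) * (\<Sum>i\<in>I. (w i)\<^sup>2)" for w :: "'i \<Rightarrow> real"
  using sum_squared_le_sum_of_squares[of w I] by (simp add: mult.commute)

lemma square_sum5_le: "(a - b - c + d + e)\<^sup>2 \<le> 5 * (a\<^sup>2 + b\<^sup>2 + c\<^sup>2 + d\<^sup>2 + e\<^sup>2)" for a b c d e :: real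
proof -
  let ?u = "\<lambda>i::nat. if i = 0 then a else if i = 1 then - b else if i = 2 then - c else if i = 3 then d else e"
  show ?thesis using sum_square_le[of "{0,1,2,3,4}" ?u] by (simp add: algebra_simps)
qed

lemma square_sum3_le: "(a + b + c)\<^sup>2 \<le> 3 * (a\<^sup>2 + b\<^sup>2 + c\<^sup>2)" for a b c :: real
proof -
  let ?u = "\<lambda>i::nat. if i = 0 then a else if i = 1 then b else c"
  show ?thesis using sum_square_le[of "{0,1,2}" ?u] by (simp add: algebra_simps)
qed

lemma abs_sub3_le: "\<bar>a\<bar> \<le> A \<Longrightarrow> \<bar>b\<bar> \<le> B \<Longrightarrow> \<bar>c\<bar> \<le> C \<Longrightarrow> \<bar>a - b - c\<bar> \<le> A + B + C" for a b c :: real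
  by linarith

lemma depends_on_comp: "depends_on S f \<Longrightarrow> depends_on S (\<lambda>\<omega>. F (f \<omega>))"
  unfolding depends_on_def by metis

lemma depends_on_comp2: "depends_on S f \<Longrightarrow> depends_on S g \<Longrightarrow> depends_on S (\<lambda>\<omega>. F (f \<omega>) (g \<omega>))"
  unfolding depends_on_def by metis

lemma depends_on_coordinate: "p \<in> S \<Longrightarrow> depends_on S (\<lambda>\<omega>. \<omega> p)"
  unfolding depends_on_def by auto

lemma depends_on_sum: "(\<And>l. l < i \<Longrightarrow> depends_on S (f l)) \<Longrightarrow> depends_on S (\<lambda>\<omega>. \<Sum>l<(i::nat). f l \<omega>)"
  unfolding depends_on_def by (intro allI impI sum.cong) auto

context dyadic
begin

section \<open>Moments of the increments of the scheme\<close>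

definition X_const :: "nat \<Rightarrow> real" where
  "X_const n = (case n of 0 \<Rightarrow> 0 | Suc m \<Rightarrow>
     27 * (3 * (\<bar>\<sigma> * k m\<bar> * R) ^ 4 + 3 * (\<bar>\<sigma> * k (Suc m)\<bar> * R) ^ 4 + local_const2 m ^ 4 * gauss_abs_const * T\<^sup>2))"

lemma X_const_nonneg: "0 \<le> X_const n"
  using gauss_abs_const_nonneg by (auto simp: X_const_def split: nat.split intro!: add_nonneg_nonneg mult_nonneg_nonneg)

lemma X_diff_integrable: "integrable gauss_space (\<lambda>\<omega>. (X h \<omega> b n - X h \<omega> a n) ^ p)"
proof (rule gauss.integrable_const_bound[of _ "(2 * R) ^ p"])
  have "\<bar>X h \<omega> b n - X h \<omega> a n\<bar> \<le> 2 * R" for \<omega> using X_bound[of h \<omega> b n] X_bound[of h \<omega> a n] by linarith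
  from power_mono[OF this, where n=p] show "AE \<omega> in gauss_space. norm ((X h \<omega> b n - X h \<omega> a n) ^ p) \<le> (2 * R) ^ p"
    by (simp add: power_abs)
qed measurable

text \<open>An increment is a difference of two sums with bounded predictable coefficients plus a
  remainder of first order in the elapsed time. The fourth power of the remainder is of fourth order
  in that time, and two of these factors are estimated by T. The factor 27 belongs to the fourth
  power of a sum of three terms.\<close>

lemma X_fourth:
  assumes h: "0 \<le> h" "h \<le> T" and ab: "a \<le> b" and bT: "real b * h \<le> T"
  shows "(\<integral>\<omega>. (X h \<omega> b n - X h \<omega> a n) ^ 4 \<partial>gauss_space) \<le> X_const n * (real (b - a) * h)\<^sup>2"
proof (cases n)
  case 0
  then show ?thesis by (simp add: X_const_def)
next
  case (Suc m)
  let ?c1 = "\<lambda>l \<omega>. \<sigma> * k m * Xt h \<omega> l m" and ?c2 = "\<lambda>l \<omega>. \<sigma> * k n * X h \<omega> l (Suc n)"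
  let ?S1 = "\<lambda>\<omega>. \<Sum>l\<in>{a..<b}. ?c1 l \<omega> * (sqrt h * \<omega> (m, l))" and ?S2 = "\<lambda>\<omega>. \<Sum>l\<in>{a..<b}. ?c2 l \<omega> * (sqrt h * \<omega> (n, l))"
  let ?K1 = "\<bar>\<sigma> * k m\<bar> * R" and ?K2 = "\<bar>\<sigma> * k n\<bar> * R"
  let ?V = "\<lambda>\<omega>. real (b - a) ^ 3 * (\<Sum>l\<in>{a..<b}. (local_const2 m * h) ^ 4 * gauss_abs m \<omega> l ^ 8)"
  let ?G = "\<lambda>\<omega>. 27 * (?S1 \<omega> ^ 4 + ?S2 \<omega> ^ 4 + ?V \<omega>)"
  have d1: "depends_on (past_upto m l) (?c1 l)" for l by (rule depends_on_comp[OF depends_Xt])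
  have d2: "depends_on (past_upto n l) (?c2 l)" for l
  proof -
    have "depends_on (past_upto n l) (\<lambda>\<omega>. X h \<omega> l (Suc n))" by (rule depends_on_mono[OF depends_X past_subset_upto])
    then show ?thesis by (rule depends_on_comp)
  qed
  have b1: "\<bar>?c1 l \<omega>\<bar> \<le> ?K1" for l \<omega> by (intro abs_mult_le[OF order_refl Xt_bound])
  have b2: "\<bar>?c2 l \<omega>\<bar> \<le> ?K2" for l \<omega> by (intro abs_mult_le[OF order_refl X_bound])
  note s1 = stoch_fourth[of ?c1 m ?K1 h a b, OF _ d1 b1 h(1) ab]
  note s2 = stoch_fourth[of ?c2 n ?K2 h a b, OF _ d2 b2 h(1) ab]
  have S1: "integrable gauss_space (\<lambda>\<omega>. ?S1 \<omega> ^ 4)" "(\<integral>\<omega>. ?S1 \<omega> ^ 4 \<partial>gauss_space) \<le> 3 * ?K1 ^ 4 * (real (b - a) * h)\<^sup>2"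
    by (rule s1; measurable)+
  have S2: "integrable gauss_space (\<lambda>\<omega>. ?S2 \<omega> ^ 4)" "(\<integral>\<omega>. ?S2 \<omega> ^ 4 \<partial>gauss_space) \<le> 3 * ?K2 ^ 4 * (real (b - a) * h)\<^sup>2"
    by (rule s2; measurable)+
  have le: "(X h \<omega> b n - X h \<omega> a n) ^ 4 \<le> ?G \<omega>" for \<omega>
  proof -
    define r where "r l = X h \<omega> (Suc l) n - X h \<omega> l n - (?c1 l \<omega> * (sqrt h * \<omega> (m, l)) - ?c2 l \<omega> * (sqrt h * \<omega> (n, l)))" for l
    have r: "\<bar>r l\<bar> \<le> local_const2 m * h * gauss_abs m \<omega> l ^ 2" for l using X_local2[OF h, of \<omega> l m] by (simp add: r_def Suc)
    have "X h \<omega> b n - X h \<omega> a n = (\<Sum>l\<in>{a..<b}. X h \<omega> (Suc l) n - X h \<omega> l n)"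
      using sum_Suc_diff'[OF ab, of "\<lambda>l. X h \<omega> l n"] by simp
    also have "\<dots> = (\<Sum>l\<in>{a..<b}. ?c1 l \<omega> * (sqrt h * \<omega> (m, l)) - ?c2 l \<omega> * (sqrt h * \<omega> (n, l)) + r l)"
      by (simp add: r_def)
    also have "\<dots> = ?S1 \<omega> - ?S2 \<omega> + (\<Sum>l\<in>{a..<b}. r l)" by (simp add: sum.distrib sum_subtractf)
    finally have "(X h \<omega> b n - X h \<omega> a n) ^ 4 \<le> 27 * (?S1 \<omega> ^ 4 + ?S2 \<omega> ^ 4 + (\<Sum>l\<in>{a..<b}. r l) ^ 4)"
      using power4_sum3_le by simp
    also have "(\<Sum>l\<in>{a..<b}. r l) ^ 4 \<le> real (b - a) ^ 3 * (\<Sum>l\<in>{a..<b}. r l ^ 4)"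
      using sum_power4_le[of "{a..<b}" r] by simp
    also have "\<dots> \<le> ?V \<omega>"
    proof (intro mult_left_mono sum_mono)
      fix l
      have "r l ^ 4 = \<bar>r l\<bar> ^ 4" by (simp add: power_even_abs)
      also have "\<dots> \<le> (local_const2 m * h * gauss_abs m \<omega> l ^ 2) ^ 4" by (rule power_mono[OF r]) simp
      also have "\<dots> = (local_const2 m * h) ^ 4 * gauss_abs m \<omega> l ^ 8" by (simp add: power_mult_distrib flip: power_mult)
      finally show "r l ^ 4 \<le> (local_const2 m * h) ^ 4 * gauss_abs m \<omega> l ^ 8" .
    qed simp
    finally show ?thesis by simp
  qed
  have V: "integrable gauss_space ?V" by (intro integrable_mult_right Bochner_Integration.integrable_sum gauss_abs_moment) simp
  have G: "integrable gauss_space ?G" by (intro integrable_mult_right Bochner_Integration.integrable_add S1 S2 V)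
  have iV: "(\<integral>\<omega>. ?V \<omega> \<partial>gauss_space) \<le> local_const2 m ^ 4 * gauss_abs_const * T\<^sup>2 * (real (b - a) * h)\<^sup>2"
  proof -
    have "(\<integral>\<omega>. ?V \<omega> \<partial>gauss_space) = real (b - a) ^ 3 * (\<Sum>l\<in>{a..<b}. (local_const2 m * h) ^ 4 * (\<integral>\<omega>. gauss_abs m \<omega> l ^ 8 \<partial>gauss_space))"
      using gauss_abs_moment(1)[of 8 m] by (subst integral_mult_right_zero, subst Bochner_Integration.integral_sum) auto
    also have "\<dots> \<le> real (b - a) ^ 3 * (\<Sum>l\<in>{a..<b}. (local_const2 m * h) ^ 4 * gauss_abs_const)"
      using gauss_abs_moment(2)[of 8 m] by (intro mult_left_mono sum_mono) auto
    also have "\<dots> = local_const2 m ^ 4 * gauss_abs_const * (real (b - a) * h)\<^sup>2 * (real (b - a) * h)\<^sup>2"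
      by (simp add: power_mult_distrib power4_eq_xxxx power3_eq_cube power2_eq_square)
    also have "\<dots> \<le> local_const2 m ^ 4 * gauss_abs_const * T\<^sup>2 * (real (b - a) * h)\<^sup>2"
    proof (intro mult_right_mono mult_left_mono power_mono)
      have "real (b - a) * h \<le> real b * h" using h by (intro mult_right_mono) auto
      then show "real (b - a) * h \<le> T" using bT by linarith
    qed (use h gauss_abs_const_nonneg in auto)
    finally show ?thesis .
  qed
  have "(\<integral>\<omega>. (X h \<omega> b n - X h \<omega> a n) ^ 4 \<partial>gauss_space) \<le> (\<integral>\<omega>. ?G \<omega> \<partial>gauss_space)"
    by (rule integral_mono[OF X_diff_integrable G le])
  also have "\<dots> = 27 * ((\<integral>\<omega>. ?S1 \<omega> ^ 4 \<partial>gauss_space) + (\<integral>\<omega>. ?S2 \<omega> ^ 4 \<partial>gauss_space) + (\<integral>\<omega>. ?V \<omega> \<partial>gauss_space))"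
    by (intro has_bochner_integral_integral_eq has_bochner_integral_mult_right has_bochner_integral_add has_bochner_integral_integrable S1 S2 V)
  also have "\<dots> \<le> 27 * (3 * ?K1 ^ 4 * (real (b - a) * h)\<^sup>2 + 3 * ?K2 ^ 4 * (real (b - a) * h)\<^sup>2 + local_const2 m ^ 4 * gauss_abs_const * T\<^sup>2 * (real (b - a) * h)\<^sup>2)"
    by (intro mult_left_mono add_mono S1 S2 iV) simp
  also have "\<dots> = X_const n * (real (b - a) * h)\<^sup>2" unfolding Suc X_const_def nat.case by (simp only: distrib_left distrib_right mult.assoc)
  finally show ?thesis .
qed

text \<open>By \<open>d\<^sup>2 \<le> d ^ 4 / (2 * \<delta>) + \<delta> / 2\<close> a fourth moment
  of order \<open>\<delta>\<^sup>2\<close> gives a second moment of order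
  \<open>\<delta>\<close>.\<close>

lemma X_second:
  assumes h: "0 \<le> h" "h \<le> T" and ab: "a \<le> b" and bT: "real b * h \<le> T" and \<delta>: "real (b - a) * h \<le> \<delta>" "0 < \<delta>"
  shows "(\<integral>\<omega>. (X h \<omega> b n - X h \<omega> a n)\<^sup>2 \<partial>gauss_space) \<le> (X_const n + 1) / 2 * \<delta>"
proof -
  let ?D = "\<lambda>\<omega>. X h \<omega> b n - X h \<omega> a n"
  have "(\<integral>\<omega>. (?D \<omega>)\<^sup>2 \<partial>gauss_space) \<le> (\<integral>\<omega>. 1 / (2 * \<delta>) * ?D \<omega> ^ 4 + \<delta> / 2 \<partial>gauss_space)"
  proof (intro integral_mono X_diff_integrable Bochner_Integration.integrable_add integrable_mult_right)
    fix \<omega>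
    have "0 \<le> ((?D \<omega>)\<^sup>2 - \<delta>)\<^sup>2" by simp
    also have "\<dots> = ?D \<omega> ^ 4 - 2 * \<delta> * (?D \<omega>)\<^sup>2 + \<delta>\<^sup>2"
    proof -
      have "(d\<^sup>2 - \<delta>)\<^sup>2 = d ^ 4 - 2 * \<delta> * d\<^sup>2 + \<delta>\<^sup>2" for d :: real
        by (simp add: power2_eq_square power4_eq_xxxx algebra_simps)
      then show ?thesis .
    qed
    finally show "(?D \<omega>)\<^sup>2 \<le> 1 / (2 * \<delta>) * ?D \<omega> ^ 4 + \<delta> / 2" using \<delta> by (simp add: field_simps power2_eq_square)
  qed simp
  also have "\<dots> = 1 / (2 * \<delta>) * (\<integral>\<omega>. ?D \<omega> ^ 4 \<partial>gauss_space) + \<delta> / 2"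
    by (subst Bochner_Integration.integral_add) (auto intro!: integrable_divide X_diff_integrable)
  also have "\<dots> \<le> 1 / (2 * \<delta>) * (X_const n * \<delta>\<^sup>2) + \<delta> / 2"
  proof (intro add_right_mono mult_left_mono)
    have "(real (b - a) * h)\<^sup>2 \<le> \<delta>\<^sup>2" using h \<delta> by (intro power_mono) auto
    then have "X_const n * (real (b - a) * h)\<^sup>2 \<le> X_const n * \<delta>\<^sup>2" using X_const_nonneg by (intro mult_left_mono)
    then show "(\<integral>\<omega>. ?D \<omega> ^ 4 \<partial>gauss_space) \<le> X_const n * \<delta>\<^sup>2" using X_fourth[OF h ab bT, of n] by linarith
  qed (use \<delta> in auto)
  also have "\<dots> = (X_const n + 1) / 2 * \<delta>" using \<delta> by (simp add: power2_eq_square field_simps)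
  finally show ?thesis .
qed

text \<open>Freezing the integrand at an earlier index \<open>q l\<close> leaves a sum of orthogonal
  terms, so the error is the total of h times the mean square oscillation of X over a time at most
  \<open>\<delta>\<close>. With \<open>q l\<close> the left end of a coarse cell this compares a
  discrete integral with its coarse Riemann sum.\<close>

lemma stoch_replace:
  assumes h: "0 \<le> h" "h \<le> T" and bT: "real b * h \<le> T" and q: "\<And>l. q l \<le> l"
    and \<delta>: "\<And>l. l < b \<Longrightarrow> real (l - q l) * h \<le> \<delta>" "0 < \<delta>"
  shows "integrable gauss_space (\<lambda>\<omega>. (\<Sum>l<b. \<sigma> * k n * (X h \<omega> l p - X h \<omega> (q l) p) * (sqrt h * \<omega> (n, l)))\<^sup>2)"
    "(\<integral>\<omega>. (\<Sum>l<b. \<sigma> * k n * (X h \<omega> l p - X h \<omega> (q l) p) * (sqrt h * \<omega> (n, l)))\<^sup>2 \<partial>gauss_space)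
      \<le> (\<sigma> * k n)\<^sup>2 * T * (X_const p + 1) / 2 * \<delta>"
proof -
  let ?c = "\<lambda>l \<omega>. \<sigma> * k n * sqrt h * (X h \<omega> l p - X h \<omega> (q l) p)"
  let ?D = "(\<sigma> * k n)\<^sup>2 * h * ((X_const p + 1) / 2 * \<delta>)"
  have d: "depends_on (past_upto n l) (?c l)" for l
  proof -
    have "depends_on (past_upto n l) (\<lambda>\<omega>. X h \<omega> l p)" by (rule depends_on_mono[OF depends_X past_subset_upto])
    moreover have "depends_on (past_upto n l) (\<lambda>\<omega>. X h \<omega> (q l) p)"
      by (rule depends_on_mono[OF depends_X order_trans[OF past_mono[OF q] past_subset_upto]])
    ultimately show ?thesis by (rule depends_on_comp2)
  qed
  have bd: "\<bar>?c l \<omega>\<bar> \<le> \<bar>\<sigma> * k n * sqrt h\<bar> * (2 * R)" for l \<omega>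
    using X_bound[of h \<omega> l p] X_bound[of h \<omega> "q l" p] by (intro abs_mult_le) linarith+
  have D: "(\<integral>\<omega>. (?c l \<omega>)\<^sup>2 \<partial>gauss_space) \<le> ?D" if "l < b" for l
  proof -
    have "real l * h \<le> real b * h" using that h by (intro mult_right_mono) auto
    then have lT: "real l * h \<le> T" using bT by linarith
    have "(\<integral>\<omega>. (?c l \<omega>)\<^sup>2 \<partial>gauss_space) = (\<sigma> * k n)\<^sup>2 * h * (\<integral>\<omega>. (X h \<omega> l p - X h \<omega> (q l) p)\<^sup>2 \<partial>gauss_space)"
    proof -
      have "(?c l \<omega>)\<^sup>2 = (\<sigma> * k n)\<^sup>2 * h * (X h \<omega> l p - X h \<omega> (q l) p)\<^sup>2" for \<omega>
        using h by (simp add: power_mult_distrib)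
      then show ?thesis by simp
    qed
    also have "\<dots> \<le> ?D" using X_second[OF h q lT \<delta>(1)[OF that] \<delta>(2), of p] h by (intro mult_left_mono) auto
    finally show ?thesis .
  qed
  have eq: "(\<Sum>l<b. \<sigma> * k n * (X h \<omega> l p - X h \<omega> (q l) p) * (sqrt h * \<omega> (n, l))) = (\<Sum>l<b. ?c l \<omega> * \<omega> (n, l))" for \<omega>
    by (simp add: mult_ac)
  note s = stoch_second[of ?c n _ "\<lambda>x. x" b ?D, OF _ d bd _ std_moments(4) std_moments(5) std_moments(1) D]
  show "integrable gauss_space (\<lambda>\<omega>. (\<Sum>l<b. \<sigma> * k n * (X h \<omega> l p - X h \<omega> (q l) p) * (sqrt h * \<omega> (n, l)))\<^sup>2)"
    unfolding eq by (rule s(1)) measurable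
  have "(\<integral>\<omega>. (\<Sum>l<b. ?c l \<omega> * \<omega> (n, l))\<^sup>2 \<partial>gauss_space) \<le> (\<integral>x. x\<^sup>2 \<partial>std_normal_distribution) * (real b * ?D)"
    by (rule s(2)) measurable
  also have "\<dots> = 1 * (real b * ?D)" by (simp only: std_moments(2))
  also have "\<dots> = (\<sigma> * k n)\<^sup>2 * ((X_const p + 1) / 2 * \<delta>) * (real b * h)" by simp
  also have "\<dots> \<le> (\<sigma> * k n)\<^sup>2 * ((X_const p + 1) / 2 * \<delta>) * T"
    using bT X_const_nonneg[of p] \<delta>(2) by (intro mult_left_mono) auto
  finally show "(\<integral>\<omega>. (\<Sum>l<b. \<sigma> * k n * (X h \<omega> l p - X h \<omega> (q l) p) * (sqrt h * \<omega> (n, l)))\<^sup>2 \<partial>gauss_space)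
      \<le> (\<sigma> * k n)\<^sup>2 * T * (X_const p + 1) / 2 * \<delta>"
    unfolding eq by (simp add: mult_ac)
qed

section \<open>Discrete Brownian motions, stochastic integrals and drift\<close>

definition W :: "real \<Rightarrow> (nat \<times> nat \<Rightarrow> real) \<Rightarrow> nat \<Rightarrow> nat \<Rightarrow> real" where
  "W h \<omega> i n = (\<Sum>l<i. sqrt h * \<omega> (n, l))"
text \<open>\<open>A\<close> and \<open>B\<close> at index n are both driven by the noise of plane
  n: \<open>A\<close> enters the equation of mode n + 1 with a plus sign, \<open>B\<close> that of
  mode n with a minus sign.\<close>

definition A :: "real \<Rightarrow> (nat \<times> nat \<Rightarrow> real) \<Rightarrow> nat \<Rightarrow> nat \<Rightarrow> real" where
  "A h \<omega> i n = (\<Sum>l<i. \<sigma> * k n * X h \<omega> l n * (sqrt h * \<omega> (n, l)))"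
definition B :: "real \<Rightarrow> (nat \<times> nat \<Rightarrow> real) \<Rightarrow> nat \<Rightarrow> nat \<Rightarrow> real" where
  "B h \<omega> i n = (\<Sum>l<i. \<sigma> * k n * X h \<omega> l (Suc n) * (sqrt h * \<omega> (n, l)))"

lemma WAB_measurable [measurable]:
  "(\<lambda>\<omega>. W h \<omega> i n) \<in> borel_measurable borel" "(\<lambda>\<omega>. A h \<omega> i n) \<in> borel_measurable borel" "(\<lambda>\<omega>. B h \<omega> i n) \<in> borel_measurable borel"
  unfolding W_def A_def B_def by measurable

lemma depends_WAB: "depends_on (past i) (\<lambda>\<omega>. W h \<omega> i n)" "depends_on (past i) (\<lambda>\<omega>. A h \<omega> i n)" "depends_on (past i) (\<lambda>\<omega>. B h \<omega> i n)"
proof -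
  have c: "depends_on (past i) (\<lambda>\<omega>. a * (sqrt h * \<omega> (n, l)))" if "l < i" for a l
    by (rule depends_on_comp[OF depends_on_coordinate]) (use that in \<open>auto simp: past_def\<close>)
  have X: "depends_on (past i) (\<lambda>\<omega>. \<sigma> * k n * X h \<omega> l p)" if "l < i" for l p
    by (rule depends_on_comp[OF depends_on_mono[OF depends_X]]) (use that past_mono in auto)
  show "depends_on (past i) (\<lambda>\<omega>. W h \<omega> i n)" unfolding W_def by (rule depends_on_sum) (use c[of _ 1] in simp)
  show "depends_on (past i) (\<lambda>\<omega>. A h \<omega> i n)" "depends_on (past i) (\<lambda>\<omega>. B h \<omega> i n)"
    unfolding A_def B_def by (intro depends_on_sum depends_on_comp2[where F="(*)"] X c[of _ 1, simplified]; simp)+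
qed

lemma WAB_fourth:
  assumes h: "0 \<le> h" "h \<le> T" and ab: "a \<le> b"
  shows "integrable gauss_space (\<lambda>\<omega>. (W h \<omega> b n - W h \<omega> a n) ^ 4)"
    "(\<integral>\<omega>. (W h \<omega> b n - W h \<omega> a n) ^ 4 \<partial>gauss_space) \<le> 3 * (real (b - a) * h)\<^sup>2"
    "integrable gauss_space (\<lambda>\<omega>. (A h \<omega> b n - A h \<omega> a n) ^ 4)"
    "(\<integral>\<omega>. (A h \<omega> b n - A h \<omega> a n) ^ 4 \<partial>gauss_space) \<le> 3 * (\<bar>\<sigma> * k n\<bar> * R) ^ 4 * (real (b - a) * h)\<^sup>2"
    "integrable gauss_space (\<lambda>\<omega>. (B h \<omega> b n - B h \<omega> a n) ^ 4)"
    "(\<integral>\<omega>. (B h \<omega> b n - B h \<omega> a n) ^ 4 \<partial>gauss_space) \<le> 3 * (\<bar>\<sigma> * k n\<bar> * R) ^ 4 * (real (b - a) * h)\<^sup>2"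
proof -
  have dX: "depends_on (past_upto n l) (\<lambda>\<omega>. X h \<omega> l p)" for l p by (rule depends_on_mono[OF depends_X past_subset_upto])
  then have d: "depends_on (past_upto n l) (\<lambda>\<omega>. \<sigma> * k n * X h \<omega> l p)" for l p by (rule depends_on_comp)
  have bd: "\<bar>\<sigma> * k n * X h \<omega> l p\<bar> \<le> \<bar>\<sigma> * k n\<bar> * R" for \<omega> l p by (intro abs_mult_le[OF order_refl X_bound])
  have W': "W h \<omega> b n - W h \<omega> a n = (\<Sum>l\<in>{a..<b}. 1 * (sqrt h * \<omega> (n, l)))" for \<omega>
    unfolding W_def using sum_lessThan_diff[OF ab] by simp
  have A': "A h \<omega> b n - A h \<omega> a n = (\<Sum>l\<in>{a..<b}. \<sigma> * k n * X h \<omega> l n * (sqrt h * \<omega> (n, l)))" for \<omega>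
    unfolding A_def by (rule sum_lessThan_diff[OF ab])
  have B': "B h \<omega> b n - B h \<omega> a n = (\<Sum>l\<in>{a..<b}. \<sigma> * k n * X h \<omega> l (Suc n) * (sqrt h * \<omega> (n, l)))" for \<omega>
    unfolding B_def by (rule sum_lessThan_diff[OF ab])
  show "integrable gauss_space (\<lambda>\<omega>. (W h \<omega> b n - W h \<omega> a n) ^ 4)"
    "(\<integral>\<omega>. (W h \<omega> b n - W h \<omega> a n) ^ 4 \<partial>gauss_space) \<le> 3 * (real (b - a) * h)\<^sup>2"
    using stoch_fourth[of "\<lambda>_ _. 1" n 1, OF _ _ _ h(1) ab] unfolding W' by (simp_all add: depends_on_def)
  show "integrable gauss_space (\<lambda>\<omega>. (A h \<omega> b n - A h \<omega> a n) ^ 4)"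
    "(\<integral>\<omega>. (A h \<omega> b n - A h \<omega> a n) ^ 4 \<partial>gauss_space) \<le> 3 * (\<bar>\<sigma> * k n\<bar> * R) ^ 4 * (real (b - a) * h)\<^sup>2"
    unfolding A' by (rule stoch_fourth[OF _ d bd h(1) ab]; measurable)+
  show "integrable gauss_space (\<lambda>\<omega>. (B h \<omega> b n - B h \<omega> a n) ^ 4)"
    "(\<integral>\<omega>. (B h \<omega> b n - B h \<omega> a n) ^ 4 \<partial>gauss_space) \<le> 3 * (\<bar>\<sigma> * k n\<bar> * R) ^ 4 * (real (b - a) * h)\<^sup>2"
    unfolding B' by (rule stoch_fourth[OF _ d bd h(1) ab]; measurable)+
qed

definition drift_lip :: "nat \<Rightarrow> real" where
  "drift_lip n = \<bar>k (n - 1)\<bar> * (2 * R) + \<bar>k n\<bar> * R + \<sigma>\<^sup>2 / 2 * ((k n)\<^sup>2 + (k (n - 1))\<^sup>2)"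

text \<open>The drift is quadratic, hence Lipschitz on states bounded by R, and it involves three
  neighbouring modes only.\<close>

lemma drift_lipschitz:
  assumes y: "\<And>n. \<bar>y n\<bar> \<le> R" and z: "\<And>n. \<bar>z n\<bar> \<le> R"
  shows "\<bar>drift n y - drift n z\<bar> \<le> drift_lip n * (\<bar>y (n - 1) - z (n - 1)\<bar> + \<bar>y n - z n\<bar> + \<bar>y (Suc n) - z (Suc n)\<bar>)"
proof -
  let ?d = "\<lambda>n. \<bar>y n - z n\<bar>" and ?s = "\<sigma>\<^sup>2 / 2 * ((k n)\<^sup>2 + (k (n - 1))\<^sup>2)"
  have eq: "drift n y - drift n z = k (n - 1) * ((y (n - 1) + z (n - 1)) * (y (n - 1) - z (n - 1)))
      - k n * ((y n - z n) * y (Suc n) + z n * (y (Suc n) - z (Suc n))) - ?s * (y n - z n)"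
  proof -
    have "(a * y1\<^sup>2 - b * y2 * y3 - s * y2) - (a * z1\<^sup>2 - b * z2 * z3 - s * z2)
      = a * ((y1 + z1) * (y1 - z1)) - b * ((y2 - z2) * y3 + z2 * (y3 - z3)) - s * (y2 - z2)" for a b s y1 y2 y3 z1 z2 z3 :: real
      by (simp add: algebra_simps power2_eq_square)
    then show ?thesis unfolding drift_def .
  qed
  have 1: "\<bar>k (n - 1) * ((y (n - 1) + z (n - 1)) * (y (n - 1) - z (n - 1)))\<bar> \<le> \<bar>k (n - 1)\<bar> * (2 * R * ?d (n - 1))"
  proof (intro abs_mult_le order_refl)
    show "\<bar>y (n - 1) + z (n - 1)\<bar> \<le> 2 * R" using y[of "n - 1"] z[of "n - 1"] by linarith
  qed
  have 2: "\<bar>k n * ((y n - z n) * y (Suc n) + z n * (y (Suc n) - z (Suc n)))\<bar> \<le> \<bar>k n\<bar> * (?d n * R + R * ?d (Suc n))"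
    by (intro abs_mult_le order_refl order_trans[OF abs_triangle_ineq] add_mono y z)
  have 3: "\<bar>?s * (y n - z n)\<bar> \<le> ?s * ?d n" by (simp add: abs_mult)
  have "\<bar>drift n y - drift n z\<bar> \<le> \<bar>k (n - 1)\<bar> * (2 * R * ?d (n - 1)) + \<bar>k n\<bar> * (?d n * R + R * ?d (Suc n)) + ?s * ?d n"
    unfolding eq using 1 2 3 by (rule abs_sub3_le)
  also have "\<dots> \<le> drift_lip n * (?d (n - 1) + ?d n + ?d (Suc n))"
  proof -
    have "a * (2 * R * d1) + b * (d2 * R + R * d3) + s * d2 \<le> (a * (2 * R) + b * R + s) * (d1 + d2 + d3)"
      if "0 \<le> a" "0 \<le> b" "0 \<le> s" "0 \<le> d1" "0 \<le> d2" "0 \<le> d3" for a b s d1 d2 d3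
    proof -
      have "0 \<le> a * (2 * R) * (d2 + d3) + b * R * d1 + s * (d1 + d3)" using that R0 by simp
      then show ?thesis by (simp add: algebra_simps)
    qed
    note gen = this
    show ?thesis unfolding drift_lip_def by (rule gen) auto
  qed
  finally show ?thesis .
qed

end

lemma sum5_bound_mono: "e \<le> 5 * (a + b + c + r + d) \<Longrightarrow> r \<le> r' \<Longrightarrow> d \<le> d' \<Longrightarrow> e \<le> 5 * (a + b + c + r' + d')"
  for a b c d e r d' r' :: real
  by (erule order_trans) (intro mult_left_mono add_mono order_refl; simp)

context dyadic
begin

section \<open>The mean square error of the discrete equation\<close>

text \<open>One summand for each source of error: the intermediate value, the quadratic fluctuations
  of two planes, the local remainder and the freezing of the drift. The factor 5 belongs to the
  square of a sum of five terms.\<close>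

definition equation_const :: "nat \<Rightarrow> real" where
  "equation_const m = 5 * ((\<sigma> * k m)\<^sup>2 * (2 * R * angle_const m)\<^sup>2 * gauss_abs_const * T + 2 * ((k m)\<^sup>2 * \<sigma>\<^sup>2 / 2 * R)\<^sup>2 * T
     + 2 * ((k (Suc m))\<^sup>2 * \<sigma>\<^sup>2 / 2 * R)\<^sup>2 * T + (local_const3 m)\<^sup>2 * gauss_abs_const * T\<^sup>2
     + 3 * (drift_lip (Suc m))\<^sup>2 * T\<^sup>2 * ((X_const m + 1) / 2 + (X_const (Suc m) + 1) / 2 + (X_const (Suc (Suc m)) + 1) / 2))"

lemma chaos_moments:
  "integrable std_normal_distribution (\<lambda>x. x\<^sup>2 - 1)" "integrable std_normal_distribution (\<lambda>x. (x\<^sup>2 - 1)\<^sup>2)"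
  "(\<integral>x. x\<^sup>2 - 1 \<partial>std_normal_distribution) = 0" "(\<integral>x. (x\<^sup>2 - 1)\<^sup>2 \<partial>std_normal_distribution) = 2"
proof -
  interpret N: prob_space std_normal_distribution using real_dist_normal_dist by (simp add: real_distribution_def)
  have u: "measure std_normal_distribution UNIV = 1" using N.prob_space by simp
  have eq: "(x\<^sup>2 - 1)\<^sup>2 = x ^ 4 + (- 2 * x\<^sup>2 + 1)" for x :: real by (simp add: power2_eq_square power4_eq_xxxx algebra_simps)
  have one: "integrable std_normal_distribution (\<lambda>_. 1 :: real)" by simp
  note i = std_moments(5)[of 2] std_moments(5)[of 4]
  show "integrable std_normal_distribution (\<lambda>x. x\<^sup>2 - 1)" by (intro Bochner_Integration.integrable_diff i one)
  show "integrable std_normal_distribution (\<lambda>x. (x\<^sup>2 - 1)\<^sup>2)"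
    unfolding eq by (intro Bochner_Integration.integrable_add integrable_mult_right i one)
  have "(\<integral>x. x\<^sup>2 - 1 \<partial>std_normal_distribution) = (\<integral>x. x\<^sup>2 \<partial>std_normal_distribution) - (\<integral>x. 1 \<partial>std_normal_distribution)"
    by (intro has_bochner_integral_integral_eq has_bochner_integral_diff has_bochner_integral_integrable i one)
  then show "(\<integral>x. x\<^sup>2 - 1 \<partial>std_normal_distribution) = 0" by (simp add: std_moments u)
  have "(\<integral>x. (x\<^sup>2 - 1)\<^sup>2 \<partial>std_normal_distribution) =
    (\<integral>x. x ^ 4 \<partial>std_normal_distribution) + (- 2 * (\<integral>x. x\<^sup>2 \<partial>std_normal_distribution) + (\<integral>x. 1 \<partial>std_normal_distribution))"
    unfolding eq by (intro has_bochner_integral_integral_eq has_bochner_integral_add has_bochner_integral_mult_right has_bochner_integral_integrable i one)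
  then show "(\<integral>x. (x\<^sup>2 - 1)\<^sup>2 \<partial>std_normal_distribution) = 2" by (simp add: std_moments u)
qed

text \<open>Each term is of size h, but the terms are orthogonal: b of them with
  \<open>b * h \<le> T\<close> have a variance of order h. The factor 2 is the variance of x^2 -
  1.\<close>

lemma chaos_second:
  assumes h: "0 \<le> h" and bT: "real b * h \<le> T"
  shows "integrable gauss_space (\<lambda>\<omega>. (\<Sum>l<b. (k j)\<^sup>2 * \<sigma>\<^sup>2 * h / 2 * X h \<omega> l p * ((\<omega> (j, l))\<^sup>2 - 1))\<^sup>2)"
    "(\<integral>\<omega>. (\<Sum>l<b. (k j)\<^sup>2 * \<sigma>\<^sup>2 * h / 2 * X h \<omega> l p * ((\<omega> (j, l))\<^sup>2 - 1))\<^sup>2 \<partial>gauss_space) \<le> 2 * ((k j)\<^sup>2 * \<sigma>\<^sup>2 / 2 * R)\<^sup>2 * T * h"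
proof -
  let ?c = "\<lambda>l \<omega>. (k j)\<^sup>2 * \<sigma>\<^sup>2 * h / 2 * X h \<omega> l p" and ?K = "(k j)\<^sup>2 * \<sigma>\<^sup>2 * h / 2 * R"
  have d: "depends_on (past_upto j l) (?c l)" for l
    by (rule depends_on_comp[OF depends_on_mono[OF depends_X past_subset_upto]])
  have bd: "\<bar>?c l \<omega>\<bar> \<le> ?K" for l \<omega> using h by (intro abs_mult_le X_bound) auto
  have D: "(\<integral>\<omega>. (?c l \<omega>)\<^sup>2 \<partial>gauss_space) \<le> ?K\<^sup>2" for l
  proof -
    have b2: "(?c l \<omega>)\<^sup>2 \<le> ?K\<^sup>2" for \<omega>
    proof -
      have "\<bar>?c l \<omega>\<bar>\<^sup>2 \<le> ?K\<^sup>2" by (rule power_mono[OF bd]) simp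
      then show ?thesis by (simp only: power2_abs)
    qed
    have "(\<integral>\<omega>. (?c l \<omega>)\<^sup>2 \<partial>gauss_space) \<le> (\<integral>\<omega>. ?K\<^sup>2 \<partial>(gauss_space :: (nat \<times> nat \<Rightarrow> real) measure))"
    proof (rule integral_mono[OF _ _ b2])
      show "integrable gauss_space (\<lambda>\<omega>. (?c l \<omega>)\<^sup>2)"
        by (rule gauss.integrable_const_bound[of _ "?K\<^sup>2"]) (use b2 in auto)
    qed simp
    then show ?thesis by simp
  qed
  note s = stoch_second[of ?c j ?K "\<lambda>x. x\<^sup>2 - 1" b "?K\<^sup>2", OF _ d bd _ chaos_moments(1,2,3) D]
  show "integrable gauss_space (\<lambda>\<omega>. (\<Sum>l<b. ?c l \<omega> * ((\<omega> (j, l))\<^sup>2 - 1))\<^sup>2)" by (rule s(1)) measurable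
  have "(\<integral>\<omega>. (\<Sum>l<b. ?c l \<omega> * ((\<omega> (j, l))\<^sup>2 - 1))\<^sup>2 \<partial>gauss_space) \<le> (\<integral>x. (x\<^sup>2 - 1)\<^sup>2 \<partial>std_normal_distribution) * (real b * ?K\<^sup>2)"
    by (rule s(2)) measurable
  also have "\<dots> = 2 * ((k j)\<^sup>2 * \<sigma>\<^sup>2 / 2 * R)\<^sup>2 * h * (real b * h)"
  proof -
    have "?K = (k j)\<^sup>2 * \<sigma>\<^sup>2 / 2 * R * h" by simp
    then have "?K\<^sup>2 = ((k j)\<^sup>2 * \<sigma>\<^sup>2 / 2 * R)\<^sup>2 * (h * h)" by (simp only: power_mult_distrib power2_eq_square[of h])
    then show ?thesis unfolding chaos_moments(4) by simp
  qed
  also have "\<dots> \<le> 2 * ((k j)\<^sup>2 * \<sigma>\<^sup>2 / 2 * R)\<^sup>2 * h * T" using bT h by (intro mult_left_mono) auto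
  finally show "(\<integral>\<omega>. (\<Sum>l<b. ?c l \<omega> * ((\<omega> (j, l))\<^sup>2 - 1))\<^sup>2 \<partial>gauss_space) \<le> 2 * ((k j)\<^sup>2 * \<sigma>\<^sup>2 / 2 * R)\<^sup>2 * T * h"
    by (simp only: mult_ac)
qed

text \<open>The deviation of the intermediate value is of order \<open>sqrt h\<close> and does not
  involve the noise of plane m in the current step. The terms are therefore of size h and
  orthogonal, and their sum has a variance of order h.\<close>

lemma cross_second:
  assumes h: "0 \<le> h" "h \<le> T" and bT: "real b * h \<le> T"
  shows "integrable gauss_space (\<lambda>\<omega>. (\<Sum>l<b. \<sigma> * k m * sqrt h * (Xt h \<omega> l m - X h \<omega> l m) * \<omega> (m, l))\<^sup>2)"
    "(\<integral>\<omega>. (\<Sum>l<b. \<sigma> * k m * sqrt h * (Xt h \<omega> l m - X h \<omega> l m) * \<omega> (m, l))\<^sup>2 \<partial>gauss_space)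
      \<le> (\<sigma> * k m)\<^sup>2 * (2 * R * angle_const m)\<^sup>2 * gauss_abs_const * T * h"
proof -
  let ?c = "\<lambda>l \<omega>. \<sigma> * k m * sqrt h * (Xt h \<omega> l m - X h \<omega> l m)" and ?K = "\<bar>\<sigma> * k m * sqrt h\<bar> * (2 * R)"
  let ?D = "(\<sigma> * k m)\<^sup>2 * h * ((2 * R * angle_const m)\<^sup>2 * h * gauss_abs_const)"
  have d: "depends_on (past_upto m l) (?c l)" for l
    by (rule depends_on_comp2[OF depends_Xt depends_on_mono[OF depends_X past_subset_upto]])
  have bd: "\<bar>?c l \<omega>\<bar> \<le> ?K" for l \<omega>
    using X_bound[of h \<omega> l m] Xt_bound[of h \<omega> l m] by (intro abs_mult_le) linarith+
  have D: "(\<integral>\<omega>. (?c l \<omega>)\<^sup>2 \<partial>gauss_space) \<le> ?D" for l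
  proof -
    let ?e = "\<lambda>\<omega>. (\<sigma> * k m)\<^sup>2 * h * ((2 * R * angle_const m)\<^sup>2 * h * gauss_abs m \<omega> l ^ 2)"
    have le: "(?c l \<omega>)\<^sup>2 \<le> ?e \<omega>" for \<omega>
    proof -
      have "(Xt h \<omega> l m - X h \<omega> l m)\<^sup>2 \<le> (2 * R * (angle_const m * sqrt h * gauss_abs m \<omega> l))\<^sup>2"
        using power_mono[OF Xt_minus_X[OF h, of m m \<omega> l], of 2] by simp
      also have "\<dots> = (2 * R * angle_const m)\<^sup>2 * h * gauss_abs m \<omega> l ^ 2" using h by (simp add: power_mult_distrib)
      finally have "(\<sigma> * k m)\<^sup>2 * h * (Xt h \<omega> l m - X h \<omega> l m)\<^sup>2 \<le> ?e \<omega>" using h by (intro mult_left_mono) auto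
      then show ?thesis using h by (simp add: power_mult_distrib)
    qed
    have int: "integrable gauss_space ?e" by (intro integrable_mult_right gauss_abs_moment) simp
    have "integrable gauss_space (\<lambda>\<omega>. (?c l \<omega>)\<^sup>2)"
      by (rule Bochner_Integration.integrable_bound[OF int]) (use le in \<open>auto intro: order_trans[OF _ abs_ge_self]\<close>)
    then have "(\<integral>\<omega>. (?c l \<omega>)\<^sup>2 \<partial>gauss_space) \<le> (\<integral>\<omega>. ?e \<omega> \<partial>gauss_space)" by (rule integral_mono[OF _ int le])
    also have "\<dots> = (\<sigma> * k m)\<^sup>2 * h * ((2 * R * angle_const m)\<^sup>2 * h * (\<integral>\<omega>. gauss_abs m \<omega> l ^ 2 \<partial>gauss_space))"
      by (simp only: integral_mult_right_zero)
    also have "\<dots> \<le> ?D" using gauss_abs_moment(2)[of 2 m l] h by (intro mult_left_mono) auto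
    finally show ?thesis .
  qed
  note s = stoch_second[of ?c m ?K "\<lambda>x. x" b ?D, OF _ d bd _ std_moments(4,5,1) D]
  show "integrable gauss_space (\<lambda>\<omega>. (\<Sum>l<b. ?c l \<omega> * \<omega> (m, l))\<^sup>2)" by (rule s(1)) measurable
  have "(\<integral>\<omega>. (\<Sum>l<b. ?c l \<omega> * \<omega> (m, l))\<^sup>2 \<partial>gauss_space) \<le> (\<integral>x. x\<^sup>2 \<partial>std_normal_distribution) * (real b * ?D)"
    by (rule s(2)) measurable
  also have "\<dots> = (\<sigma> * k m)\<^sup>2 * (2 * R * angle_const m)\<^sup>2 * gauss_abs_const * h * (real b * h)"
    unfolding std_moments(2) by simp
  also have "\<dots> \<le> (\<sigma> * k m)\<^sup>2 * (2 * R * angle_const m)\<^sup>2 * gauss_abs_const * h * T" using bT h gauss_abs_const_nonneg by (intro mult_left_mono) auto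
  finally show "(\<integral>\<omega>. (\<Sum>l<b. ?c l \<omega> * \<omega> (m, l))\<^sup>2 \<partial>gauss_space) \<le> (\<sigma> * k m)\<^sup>2 * (2 * R * angle_const m)\<^sup>2 * gauss_abs_const * T * h"
    by (simp only: mult_ac)
qed

text \<open>In the bound, h stems from the scheme itself and \<open>\<delta>\<close> from evaluating
  the drift at the earlier index \<open>q l\<close>. The stochastic terms are not frozen here, since
  \<open>A\<close> and \<open>B\<close> are the full discrete integrals.\<close>

lemma equation_error:
  assumes h: "0 \<le> h" "h \<le> T" and bT: "real b * h \<le> T" and q: "\<And>l. q l \<le> l"
    and \<delta>: "\<And>l. l < b \<Longrightarrow> real (l - q l) * h \<le> \<delta>" "0 < \<delta>"
  shows "(\<integral>\<^sup>+\<omega>. ennreal ((X h \<omega> b (Suc m) - x (Suc m) - A h \<omega> b m + B h \<omega> b (Suc m)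
      - h * (\<Sum>l<b. drift (Suc m) (X h \<omega> (q l))))\<^sup>2) \<partial>gauss_space) \<le> ennreal (equation_const m * (\<delta> + h))"
proof -
  let ?n = "Suc m"
  let ?S1 = "\<lambda>\<omega>. \<Sum>l<b. \<sigma> * k m * sqrt h * (Xt h \<omega> l m - X h \<omega> l m) * \<omega> (m, l)"
  let ?S2 = "\<lambda>j \<omega>. \<Sum>l<b. (k j)\<^sup>2 * \<sigma>\<^sup>2 * h / 2 * X h \<omega> l ?n * ((\<omega> (j, l))\<^sup>2 - 1)"
  let ?\<Delta> = "\<lambda>\<omega> l j. X h \<omega> l j - X h \<omega> (q l) j"
  let ?S4 = "\<lambda>\<omega>. real b * (\<Sum>l<b. (local_const3 m * (h * sqrt h))\<^sup>2 * gauss_abs m \<omega> l ^ 6)"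
  let ?S5 = "\<lambda>\<omega>. h\<^sup>2 * (real b * (\<Sum>l<b. 3 * (drift_lip ?n)\<^sup>2 * ((?\<Delta> \<omega> l m)\<^sup>2 + (?\<Delta> \<omega> l ?n)\<^sup>2 + (?\<Delta> \<omega> l (Suc ?n))\<^sup>2)))"
  let ?G = "\<lambda>\<omega>. 5 * ((?S1 \<omega>)\<^sup>2 + (?S2 m \<omega>)\<^sup>2 + (?S2 ?n \<omega>)\<^sup>2 + ?S4 \<omega> + ?S5 \<omega>)"
  let ?err = "\<lambda>\<omega>. X h \<omega> b ?n - x ?n - A h \<omega> b m + B h \<omega> b ?n - h * (\<Sum>l<b. drift ?n (X h \<omega> (q l)))"
  have le: "(?err \<omega>)\<^sup>2 \<le> ?G \<omega>" for \<omega>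
  proof -
    define main where "main l = h * drift ?n (X h \<omega> l)
      + \<sigma> * k m * X h \<omega> l m * (sqrt h * \<omega> (m, l)) - \<sigma> * k ?n * X h \<omega> l (Suc ?n) * (sqrt h * \<omega> (?n, l))
      + \<sigma> * k m * sqrt h * (Xt h \<omega> l m - X h \<omega> l m) * \<omega> (m, l)
      - (k m)\<^sup>2 * \<sigma>\<^sup>2 * h / 2 * X h \<omega> l ?n * ((\<omega> (m, l))\<^sup>2 - 1)
      - (k ?n)\<^sup>2 * \<sigma>\<^sup>2 * h / 2 * X h \<omega> l ?n * ((\<omega> (?n, l))\<^sup>2 - 1)" for l
    define r where "r l = X h \<omega> (Suc l) ?n - X h \<omega> l ?n - main l" for l
    define d where "d l = drift ?n (X h \<omega> l) - drift ?n (X h \<omega> (q l))" for l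
    have "X h \<omega> b ?n - x ?n = (\<Sum>l<b. X h \<omega> (Suc l) ?n - X h \<omega> l ?n)"
      by (subst sum_lessThan_telescope) simp
    also have "\<dots> = (\<Sum>l<b. main l + r l)" by (simp add: r_def)
    also have "\<dots> = h * (\<Sum>l<b. drift ?n (X h \<omega> l)) + A h \<omega> b m - B h \<omega> b ?n + ?S1 \<omega> - ?S2 m \<omega> - ?S2 ?n \<omega> + (\<Sum>l<b. r l)"
      unfolding main_def A_def B_def by (simp only: sum.distrib sum_subtractf sum_distrib_left)
    finally have "?err \<omega> = ?S1 \<omega> - ?S2 m \<omega> - ?S2 ?n \<omega> + (\<Sum>l<b. r l) + h * (\<Sum>l<b. d l)"
      unfolding d_def sum_subtractf right_diff_distrib by linarith
    then have "(?err \<omega>)\<^sup>2 \<le> 5 * ((?S1 \<omega>)\<^sup>2 + (?S2 m \<omega>)\<^sup>2 + (?S2 ?n \<omega>)\<^sup>2 + (\<Sum>l<b. r l)\<^sup>2 + (h * (\<Sum>l<b. d l))\<^sup>2)"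
      by (simp only: square_sum5_le)
    moreover have "(\<Sum>l<b. r l)\<^sup>2 \<le> ?S4 \<omega>"
    proof -
      have "(r l)\<^sup>2 \<le> (local_const3 m * (h * sqrt h))\<^sup>2 * gauss_abs m \<omega> l ^ 6" for l
      proof -
        have "\<bar>r l\<bar> \<le> local_const3 m * (h * sqrt h) * gauss_abs m \<omega> l ^ 3"
          unfolding r_def main_def by (rule X_local3[OF h])
        from power_mono[OF this, of 2] show ?thesis by (simp add: power_mult_distrib flip: power_mult)
      qed
      then have "real b * (\<Sum>l<b. (r l)\<^sup>2) \<le> ?S4 \<omega>" by (intro mult_left_mono sum_mono) auto
      then show ?thesis using sum_square_le[of "{..<b}" r] by simp
    qed
    moreover have "(h * (\<Sum>l<b. d l))\<^sup>2 \<le> ?S5 \<omega>"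
    proof -
      have "(d l)\<^sup>2 \<le> 3 * (drift_lip ?n)\<^sup>2 * ((?\<Delta> \<omega> l m)\<^sup>2 + (?\<Delta> \<omega> l ?n)\<^sup>2 + (?\<Delta> \<omega> l (Suc ?n))\<^sup>2)" for l
      proof -
        have "\<bar>d l\<bar> \<le> drift_lip ?n * (\<bar>?\<Delta> \<omega> l m\<bar> + \<bar>?\<Delta> \<omega> l ?n\<bar> + \<bar>?\<Delta> \<omega> l (Suc ?n)\<bar>)"
          unfolding d_def using drift_lipschitz[of "X h \<omega> l" "X h \<omega> (q l)" ?n] X_bound by simp
        from power_mono[OF this, of 2] have "(d l)\<^sup>2 \<le> (drift_lip ?n)\<^sup>2 * (\<bar>?\<Delta> \<omega> l m\<bar> + \<bar>?\<Delta> \<omega> l ?n\<bar> + \<bar>?\<Delta> \<omega> l (Suc ?n)\<bar>)\<^sup>2"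
          by (simp add: power_mult_distrib)
        also have "\<dots> \<le> (drift_lip ?n)\<^sup>2 * (3 * (\<bar>?\<Delta> \<omega> l m\<bar>\<^sup>2 + \<bar>?\<Delta> \<omega> l ?n\<bar>\<^sup>2 + \<bar>?\<Delta> \<omega> l (Suc ?n)\<bar>\<^sup>2))"
          by (intro mult_left_mono square_sum3_le) simp
        finally show ?thesis by (simp only: power2_abs mult_ac)
      qed
      then have "h\<^sup>2 * (real b * (\<Sum>l<b. (d l)\<^sup>2)) \<le> ?S5 \<omega>" by (intro mult_left_mono sum_mono) auto
      moreover have "h\<^sup>2 * (\<Sum>l<b. d l)\<^sup>2 \<le> h\<^sup>2 * (real b * (\<Sum>l<b. (d l)\<^sup>2))"
        using sum_square_le[of "{..<b}" d] by (intro mult_left_mono) auto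
      ultimately show ?thesis by (simp only: power_mult_distrib)
    qed
    ultimately show ?thesis by (rule sum5_bound_mono)
  qed
  note i1 = cross_second[OF h bT, of m]
  note i2 = chaos_second[OF h(1) bT, of _ ?n]
  have i4: "integrable gauss_space ?S4" by (intro integrable_mult_right Bochner_Integration.integrable_sum gauss_abs_moment) simp
  have i5: "integrable gauss_space ?S5"
    by (intro integrable_mult_right Bochner_Integration.integrable_sum Bochner_Integration.integrable_add X_diff_integrable)
  have G: "integrable gauss_space ?G" by (intro integrable_mult_right Bochner_Integration.integrable_add i1 i2 i4 i5)
  have G0: "0 \<le> ?G \<omega>" for \<omega> using le[of \<omega>] zero_le_power2[of "?err \<omega>"] by linarith
  have b0: "0 \<le> real b * h" using h by simp
  have e4: "(\<integral>\<omega>. ?S4 \<omega> \<partial>gauss_space) \<le> (local_const3 m)\<^sup>2 * gauss_abs_const * T\<^sup>2 * h"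
  proof -
    have "(\<integral>\<omega>. ?S4 \<omega> \<partial>gauss_space) = real b * (\<Sum>l<b. (local_const3 m * (h * sqrt h))\<^sup>2 * (\<integral>\<omega>. gauss_abs m \<omega> l ^ 6 \<partial>gauss_space))"
      using gauss_abs_moment(1)[of 6 m] by (subst integral_mult_right_zero, subst Bochner_Integration.integral_sum) auto
    also have "\<dots> \<le> real b * (\<Sum>l<b. (local_const3 m * (h * sqrt h))\<^sup>2 * gauss_abs_const)"
      using gauss_abs_moment(2)[of 6 m] by (intro mult_left_mono sum_mono) auto
    also have "\<dots> = (local_const3 m)\<^sup>2 * gauss_abs_const * h * (real b * h)\<^sup>2"
    proof -
      have "(local_const3 m * (h * sqrt h))\<^sup>2 = (local_const3 m)\<^sup>2 * (h * h * h)" using h by (simp add: power_mult_distrib power2_eq_square)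
      then show ?thesis using h by (simp add: power2_eq_square)
    qed
    also have "\<dots> \<le> (local_const3 m)\<^sup>2 * gauss_abs_const * h * T\<^sup>2"
      using h gauss_abs_const_nonneg power_mono[OF bT b0, of 2] by (intro mult_left_mono) auto
    finally show ?thesis by (simp only: mult_ac)
  qed
  have e5: "(\<integral>\<omega>. ?S5 \<omega> \<partial>gauss_space) \<le>
      3 * (drift_lip ?n)\<^sup>2 * T\<^sup>2 * ((X_const m + 1) / 2 + (X_const ?n + 1) / 2 + (X_const (Suc ?n) + 1) / 2) * \<delta>"
  proof -
    let ?c = "(X_const m + 1) / 2 * \<delta> + (X_const ?n + 1) / 2 * \<delta> + (X_const (Suc ?n) + 1) / 2 * \<delta>"
    have c0: "0 \<le> ?c" using X_const_nonneg[of m] X_const_nonneg[of ?n] X_const_nonneg[of "Suc ?n"] \<delta>(2) by (intro add_nonneg_nonneg mult_nonneg_nonneg) auto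
    have "(\<integral>\<omega>. ?S5 \<omega> \<partial>gauss_space) = h\<^sup>2 * (real b * (\<Sum>l<b. 3 * (drift_lip ?n)\<^sup>2 *
        ((\<integral>\<omega>. (?\<Delta> \<omega> l m)\<^sup>2 \<partial>gauss_space) + (\<integral>\<omega>. (?\<Delta> \<omega> l ?n)\<^sup>2 \<partial>gauss_space) + (\<integral>\<omega>. (?\<Delta> \<omega> l (Suc ?n))\<^sup>2 \<partial>gauss_space))))"
      by (intro has_bochner_integral_integral_eq has_bochner_integral_mult_right has_bochner_integral_sum has_bochner_integral_add
          has_bochner_integral_integrable X_diff_integrable)
    also have "\<dots> \<le> h\<^sup>2 * (real b * (\<Sum>l<b. 3 * (drift_lip ?n)\<^sup>2 * ?c))"
    proof (intro mult_left_mono sum_mono add_mono)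
      fix l assume l: "l \<in> {..<b}"
      then have "real l * h \<le> real b * h" using h by (intro mult_right_mono) auto
      then have lT: "real l * h \<le> T" using bT by linarith
      have l': "l < b" using l by simp
      show "(\<integral>\<omega>. (?\<Delta> \<omega> l m)\<^sup>2 \<partial>gauss_space) \<le> (X_const m + 1) / 2 * \<delta>" "(\<integral>\<omega>. (?\<Delta> \<omega> l ?n)\<^sup>2 \<partial>gauss_space) \<le> (X_const ?n + 1) / 2 * \<delta>"
        "(\<integral>\<omega>. (?\<Delta> \<omega> l (Suc ?n))\<^sup>2 \<partial>gauss_space) \<le> (X_const (Suc ?n) + 1) / 2 * \<delta>"
        by (rule X_second[OF h q lT \<delta>(1)[OF l'] \<delta>(2)])+
    qed auto
    also have "\<dots> = 3 * (drift_lip ?n)\<^sup>2 * ?c * (real b * h)\<^sup>2" by (simp add: power2_eq_square)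
    also have "\<dots> \<le> 3 * (drift_lip ?n)\<^sup>2 * ?c * T\<^sup>2"
      using c0 power_mono[OF bT b0, of 2] by (intro mult_left_mono) auto
    also have "\<dots> = 3 * (drift_lip ?n)\<^sup>2 * T\<^sup>2 * ((X_const m + 1) / 2 + (X_const ?n + 1) / 2 + (X_const (Suc ?n) + 1) / 2) * \<delta>"
      by (simp only: distrib_right distrib_left mult_ac)
    finally show ?thesis .
  qed
  have "(\<integral>\<^sup>+\<omega>. ennreal ((?err \<omega>)\<^sup>2) \<partial>gauss_space) \<le> (\<integral>\<^sup>+\<omega>. ennreal (?G \<omega>) \<partial>gauss_space)"
    by (intro nn_integral_mono ennreal_leI le)
  also have "\<dots> = ennreal (\<integral>\<omega>. ?G \<omega> \<partial>gauss_space)"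
    by (rule nn_integral_eq_integral[OF G]) (use G0 in auto)
  also have "\<dots> \<le> ennreal (equation_const m * (\<delta> + h))"
  proof (rule ennreal_leI)
    define E1 where "E1 = (\<sigma> * k m)\<^sup>2 * (2 * R * angle_const m)\<^sup>2 * gauss_abs_const * T"
    define E2 where "E2 = 2 * ((k m)\<^sup>2 * \<sigma>\<^sup>2 / 2 * R)\<^sup>2 * T"
    define E3 where "E3 = 2 * ((k ?n)\<^sup>2 * \<sigma>\<^sup>2 / 2 * R)\<^sup>2 * T"
    define E4 where "E4 = (local_const3 m)\<^sup>2 * gauss_abs_const * T\<^sup>2"
    define E5 where "E5 = 3 * (drift_lip ?n)\<^sup>2 * T\<^sup>2 * ((X_const m + 1) / 2 + (X_const ?n + 1) / 2 + (X_const (Suc ?n) + 1) / 2)"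
    have E0: "0 \<le> E1" "0 \<le> E2" "0 \<le> E3" "0 \<le> E4" "0 \<le> E5"
      using gauss_abs_const_nonneg T_pos X_const_nonneg[of m] X_const_nonneg[of ?n] X_const_nonneg[of "Suc ?n"]
      by (auto simp: E1_def E2_def E3_def E4_def E5_def)
    have "(\<integral>\<omega>. ?G \<omega> \<partial>gauss_space) = 5 * ((\<integral>\<omega>. (?S1 \<omega>)\<^sup>2 \<partial>gauss_space) + (\<integral>\<omega>. (?S2 m \<omega>)\<^sup>2 \<partial>gauss_space) + (\<integral>\<omega>. (?S2 ?n \<omega>)\<^sup>2 \<partial>gauss_space)
        + (\<integral>\<omega>. ?S4 \<omega> \<partial>gauss_space) + (\<integral>\<omega>. ?S5 \<omega> \<partial>gauss_space))"
      by (intro has_bochner_integral_integral_eq has_bochner_integral_mult_right has_bochner_integral_add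
          has_bochner_integral_integrable[OF i1(1)] has_bochner_integral_integrable[OF i2(1)]
          has_bochner_integral_integrable[OF i4] has_bochner_integral_integrable[OF i5])
    also have "\<dots> \<le> 5 * (E1 * h + E2 * h + E3 * h + E4 * h + E5 * \<delta>)"
      unfolding E1_def E2_def E3_def E4_def E5_def by (intro mult_left_mono add_mono i1(2) i2(2) e4 e5) simp
    also have "\<dots> \<le> 5 * ((E1 + E2 + E3 + E4 + E5) * (\<delta> + h))"
    proof -
      have "0 \<le> (E1 + E2 + E3 + E4) * \<delta>" "0 \<le> E5 * h" using E0 h \<delta>(2) by auto
      then show ?thesis by (simp add: algebra_simps)
    qed
    also have "\<dots> = equation_const m * (\<delta> + h)" unfolding equation_const_def E1_def E2_def E3_def E4_def E5_def by simp
    finally show "(\<integral>\<omega>. ?G \<omega> \<partial>gauss_space) \<le> equation_const m * (\<delta> + h)" .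
  qed
  finally show ?thesis .
qed

text \<open>Division by the standard deviation makes the law independent of h and of the two
  indices, as \<open>distr_limit\<close> requires.\<close>

lemma W_increment_law:
  assumes h: "0 < h" and ab: "a < b"
  shows "distr gauss_space borel (\<lambda>\<omega>. (W h \<omega> b n - W h \<omega> a n) / sqrt (real (b - a) * h)) = std_normal_distribution"
proof -
  let ?S = "\<lambda>\<omega>. \<Sum>l\<in>{a..<b}. \<omega> (n, l)"
  have "gauss.indep_vars (\<lambda>_. borel) (\<lambda>p \<omega>. \<omega> (n, p)) {a..<b}"
    by (rule gauss_indep_vars_family[where S="\<lambda>l. {(n, l)}"]) (auto simp: disjoint_family_on_def depends_on_def)
  moreover have "distributed gauss_space lborel (\<lambda>\<omega>. \<omega> (n, l)) (normal_density 0 1)" for l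
    unfolding distributed_def
  proof (intro conjI)
    have "distr gauss_space lborel (\<lambda>\<omega>. \<omega> (n, l)) = distr gauss_space borel (\<lambda>\<omega>. \<omega> (n, l))" by (rule distr_cong) auto
    then show "distr gauss_space lborel (\<lambda>\<omega>. \<omega> (n, l)) = density lborel (\<lambda>x. ennreal (normal_density 0 1 x))"
      by (simp add: gauss_coordinate)
  qed auto
  ultimately have "distributed gauss_space lborel ?S (normal_density (\<Sum>l\<in>{a..<b}. 0) (sqrt (\<Sum>l\<in>{a..<b}. 1\<^sup>2)))"
    using ab by (intro gauss.sum_indep_normal[where \<sigma>="\<lambda>_. 1" and \<mu>="\<lambda>_. 0"]) auto
  then have "distributed gauss_space lborel ?S (normal_density 0 (sqrt (real (b - a))))" by simp
  then have "distributed gauss_space lborel (\<lambda>\<omega>. (?S \<omega> - 0) / sqrt (real (b - a))) std_normal_density"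
    using ab by (subst (asm) gauss.normal_standard_normal_convert) auto
  then have law: "distr gauss_space lborel (\<lambda>\<omega>. ?S \<omega> / sqrt (real (b - a))) = std_normal_distribution"
    by (simp add: distributed_def)
  have eq: "(W h \<omega> b n - W h \<omega> a n) / sqrt (real (b - a) * h) = ?S \<omega> / sqrt (real (b - a))" for \<omega>
  proof -
    have "W h \<omega> b n - W h \<omega> a n = sqrt h * ?S \<omega>"
      unfolding W_def using ab by (simp add: sum_lessThan_diff sum_distrib_left)
    then show ?thesis using h by (simp add: real_sqrt_mult)
  qed
  have "distr gauss_space borel (\<lambda>\<omega>. (W h \<omega> b n - W h \<omega> a n) / sqrt (real (b - a) * h))
      = distr gauss_space lborel (\<lambda>\<omega>. ?S \<omega> / sqrt (real (b - a)))"
    unfolding eq by (rule distr_cong) auto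
  then show ?thesis using law by simp
qed

end

section \<open>Dyadic times and the continuity criterion\<close>

text \<open>Independence of functions \<open>\<phi> j\<close> of a single variable is a property of
  the law of that variable, so the copies inherit it from the Gaussian samples.\<close>

lemma indep_vars_transfer:
  fixes Z :: "'a \<Rightarrow> 'c::topological_space" and z :: "'b \<Rightarrow> 'c" and \<phi> :: "'i \<Rightarrow> 'c \<Rightarrow> 'd::topological_space"
  assumes M: "prob_space M" and M': "prob_space M'"
    and Z: "Z \<in> borel_measurable M" and z: "z \<in> borel_measurable M'"
    and law: "distr M borel Z = distr M' borel z"
    and \<phi>: "\<And>j. j \<in> I \<Longrightarrow> \<phi> j \<in> borel_measurable borel"
    and indep: "prob_space.indep_vars M' (\<lambda>_. borel) (\<lambda>j \<omega>. \<phi> j (z \<omega>)) I"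
  shows "prob_space.indep_vars M (\<lambda>_. borel) (\<lambda>j \<omega>. \<phi> j (Z \<omega>)) I"
proof -
  interpret M: prob_space M by fact
  interpret M': prob_space M' by fact
  have rv: "(\<lambda>\<omega>. \<phi> j (Z \<omega>)) \<in> borel_measurable M" if "j \<in> I" for j
    using measurable_compose[OF Z \<phi>[OF that]] .
  have eq: "measure M (\<Inter>j\<in>J. (\<lambda>\<omega>. \<phi> j (Z \<omega>)) -` A j \<inter> space M) = measure M' (\<Inter>j\<in>J. (\<lambda>\<omega>. \<phi> j (z \<omega>)) -` A j \<inter> space M')"
    if J: "J \<subseteq> I" "J \<noteq> {}" "finite J" and A: "\<And>j. j \<in> J \<Longrightarrow> A j \<in> sets borel" for J A
  proof -
    let ?E = "\<Inter>j\<in>J. \<phi> j -` A j"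
    have E: "?E \<in> sets borel"
    proof (rule sets.finite_INT)
      fix j assume "j \<in> J"
      then show "\<phi> j -` A j \<in> sets borel" using measurable_sets[OF \<phi> A, of j j] J by auto
    qed (use J in auto)
    have "(\<Inter>j\<in>J. (\<lambda>\<omega>. \<phi> j (Z \<omega>)) -` A j \<inter> space M) = Z -` ?E \<inter> space M" using J by auto
    moreover have "(\<Inter>j\<in>J. (\<lambda>\<omega>. \<phi> j (z \<omega>)) -` A j \<inter> space M') = z -` ?E \<inter> space M'" using J by auto
    moreover have "measure M (Z -` ?E \<inter> space M) = measure (distr M borel Z) ?E" by (rule measure_distr[OF Z E, symmetric])
    moreover have "measure M' (z -` ?E \<inter> space M') = measure (distr M' borel z) ?E" by (rule measure_distr[OF z E, symmetric])
    ultimately show ?thesis by (simp add: law)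
  qed
  show ?thesis
  proof (subst M.indep_vars_finite_subsets, intro conjI ballI allI impI rv)
    fix J assume J: "J \<subseteq> I" "J \<noteq> {}" "finite J"
    show "M.indep_vars (\<lambda>_. borel) (\<lambda>j \<omega>. \<phi> j (Z \<omega>)) J"
    proof (subst M.indep_vars_finite[where E="\<lambda>_. sets borel"])
      show "\<forall>A\<in>(\<Pi> i\<in>J. sets borel). measure M (\<Inter>j\<in>J. (\<lambda>\<omega>. \<phi> j (Z \<omega>)) -` A j \<inter> space M)
          = (\<Prod>j\<in>J. measure M ((\<lambda>\<omega>. \<phi> j (Z \<omega>)) -` A j \<inter> space M))"
      proof
        fix A :: "'i \<Rightarrow> 'd set" assume "A \<in> (\<Pi> i\<in>J. sets borel)"
        then have A: "A j \<in> sets borel" if "j \<in> J" for j using that by auto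
        have "measure M (\<Inter>j\<in>J. (\<lambda>\<omega>. \<phi> j (Z \<omega>)) -` A j \<inter> space M) = measure M' (\<Inter>j\<in>J. (\<lambda>\<omega>. \<phi> j (z \<omega>)) -` A j \<inter> space M')"
          by (rule eq[OF J A])
        also have "\<dots> = (\<Prod>j\<in>J. measure M' ((\<lambda>\<omega>. \<phi> j (z \<omega>)) -` A j \<inter> space M'))"
          by (rule M'.indep_varsD[OF indep J(2,3,1) A])
        also have "\<dots> = (\<Prod>j\<in>J. measure M ((\<lambda>\<omega>. \<phi> j (Z \<omega>)) -` A j \<inter> space M))"
        proof (rule prod.cong[OF refl])
          fix j assume j: "j \<in> J"
          show "measure M' ((\<lambda>\<omega>. \<phi> j (z \<omega>)) -` A j \<inter> space M') = measure M ((\<lambda>\<omega>. \<phi> j (Z \<omega>)) -` A j \<inter> space M)"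
            using eq[of "{j}" A] j J A by auto
        qed
        finally show "measure M (\<Inter>j\<in>J. (\<lambda>\<omega>. \<phi> j (Z \<omega>)) -` A j \<inter> space M)
          = (\<Prod>j\<in>J. measure M ((\<lambda>\<omega>. \<phi> j (Z \<omega>)) -` A j \<inter> space M))" .
      qed
    qed (use J rv sets.Int_stable[of borel] sets.sigma_sets_eq[of borel] in auto)
  qed
qed

section \<open>Dyadic times and rounding\<close>

definition dyad :: "real \<Rightarrow> nat \<Rightarrow> nat \<Rightarrow> real" where "dyad T j i = T * real i / 2 ^ j"
definition dyads :: "real \<Rightarrow> real set" where "dyads T = {dyad T j i | j i. i \<le> 2 ^ j}"
definition dfloor :: "real \<Rightarrow> nat \<Rightarrow> real \<Rightarrow> real" where "dfloor T j t = dyad T j (nat \<lfloor>t * 2 ^ j / T\<rfloor>)"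

lemma dyadsI: "i \<le> 2 ^ j \<Longrightarrow> dyad T j i \<in> dyads T" by (auto simp: dyads_def)

lemma countable_dyads: "countable (dyads T)"
proof -
  have "dyads T \<subseteq> (\<lambda>(j, i). dyad T j i) ` UNIV" by (auto simp: dyads_def)
  then show ?thesis by (rule countable_subset) simp
qed

lemma dyads_nonempty: "dyads T \<noteq> {}" using dyadsI[of 0 0 T] by auto

lemma dyads_bounds: "0 < T \<Longrightarrow> t \<in> dyads T \<Longrightarrow> 0 \<le> t \<and> t \<le> T"
proof -
  assume T: "0 < T" and "t \<in> dyads T"
  then obtain j i where t: "t = T * real i / 2 ^ j" and i: "i \<le> 2 ^ j" by (auto simp: dyads_def dyad_def)
  have "real i \<le> 2 ^ j" using i by (metis of_nat_le_iff of_nat_numeral of_nat_power)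
  then show "0 \<le> t \<and> t \<le> T" using T by (simp add: t field_simps)
qed

lemma dyad_refine: "dyad T (j + p) (i * 2 ^ p) = dyad T j i" by (simp add: dyad_def power_add)

text \<open>The common level can be taken as fine as desired, so that chaining may descend from it
  to a prescribed coarser level m.\<close>

lemma dyad_common:
  assumes "s \<in> dyads T" "t \<in> dyads T"
  shows "\<exists>j\<ge>m. \<exists>a b. a \<le> 2 ^ j \<and> b \<le> 2 ^ j \<and> s = dyad T j a \<and> t = dyad T j b"
proof -
  obtain j1 a where a: "s = dyad T j1 a" "a \<le> 2 ^ j1" using assms by (auto simp: dyads_def)
  obtain j2 b where b: "t = dyad T j2 b" "b \<le> 2 ^ j2" using assms by (auto simp: dyads_def)
  let ?j = "m + j1 + j2"
  have "s = dyad T ?j (a * 2 ^ (m + j2))" "t = dyad T ?j (b * 2 ^ (m + j1))"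
    using dyad_refine[of T j1 "m + j2" a] dyad_refine[of T j2 "m + j1" b] a b by (simp_all add: ac_simps)
  moreover have "a * 2 ^ (m + j2) \<le> 2 ^ ?j" "b * 2 ^ (m + j1) \<le> 2 ^ ?j"
    using mult_right_mono[OF a(2), of "2 ^ (m + j2)"] mult_right_mono[OF b(2), of "2 ^ (m + j1)"] by (simp_all add: power_add ac_simps)
  ultimately show ?thesis by (intro exI[of _ ?j] conjI exI[of _ "a * 2 ^ (m + j2)"] exI[of _ "b * 2 ^ (m + j1)"]) auto
qed

lemma dfloor_facts:
  assumes T: "0 < T" and t: "0 \<le> t" "t \<le> T"
  shows "nat \<lfloor>t * 2 ^ j / T\<rfloor> \<le> 2 ^ j" "dfloor T j t \<in> dyads T" "dfloor T j t \<le> t" "t < dfloor T j t + T / 2 ^ j"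
proof -
  let ?y = "t * 2 ^ j / T"
  have y: "0 \<le> ?y" "?y \<le> 2 ^ j" using T t by (auto simp: field_simps)
  have n: "real (nat \<lfloor>?y\<rfloor>) = of_int \<lfloor>?y\<rfloor>" using y by simp
  have "of_int \<lfloor>?y\<rfloor> \<le> (2 ^ j :: real)" using y by linarith
  then have "real (nat \<lfloor>?y\<rfloor>) \<le> real (2 ^ j)" using n by simp
  then show le: "nat \<lfloor>?y\<rfloor> \<le> 2 ^ j" by (simp only: of_nat_le_iff)
  show "dfloor T j t \<in> dyads T" unfolding dfloor_def by (rule dyadsI[OF le])
  have ty: "t = T * ?y / 2 ^ j" using T by simp
  have "T * of_int \<lfloor>?y\<rfloor> / 2 ^ j \<le> T * ?y / 2 ^ j" using T by (intro divide_right_mono mult_left_mono) auto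
  then show "dfloor T j t \<le> t" unfolding dfloor_def dyad_def n using ty by simp
  have "T * ?y / 2 ^ j < T * (of_int \<lfloor>?y\<rfloor> + 1) / 2 ^ j"
  proof (intro divide_strict_right_mono mult_strict_left_mono T)
    show "?y < of_int \<lfloor>?y\<rfloor> + 1" by linarith
  qed simp
  also have "\<dots> = dfloor T j t + T / 2 ^ j" unfolding dfloor_def dyad_def n by (simp add: field_simps)
  finally show "t < dfloor T j t + T / 2 ^ j" using ty by simp
qed

lemma power_half_tendsto: "(\<lambda>j. T / 2 ^ j) \<longlonglongrightarrow> (0::real)"
proof -
  have "(\<lambda>j. T * (1/2) ^ j) \<longlonglongrightarrow> T * 0" by (intro tendsto_intros LIMSEQ_realpow_zero) auto
  then show ?thesis by (simp add: power_divide)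
qed

lemma dfloor_tendsto:
  assumes T: "0 < T" and t: "0 \<le> t" "t \<le> T"
  shows "(\<lambda>j. dfloor T j t) \<longlonglongrightarrow> t"
proof (rule tendsto_sandwich)
  show "\<forall>\<^sub>F j in sequentially. t - T / 2 ^ j \<le> dfloor T j t"
    using dfloor_facts(4)[OF assms] by (intro always_eventually allI) (smt (verit))
  show "\<forall>\<^sub>F j in sequentially. dfloor T j t \<le> t" using dfloor_facts(3)[OF assms] by simp
  have "(\<lambda>j. t - T / 2 ^ j) \<longlonglongrightarrow> t - 0" by (intro tendsto_intros power_half_tendsto)
  then show "(\<lambda>j. t - T / 2 ^ j) \<longlonglongrightarrow> t" by simp
qed simp

lemma closure_dyads: "0 < T \<Longrightarrow> {0..T} \<subseteq> closure (dyads T)"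
proof
  fix t assume T: "0 < T" and t: "t \<in> {0..T}"
  show "t \<in> closure (dyads T)"
    unfolding closure_sequential
    by (rule exI[of _ "\<lambda>j. dfloor T j t"]) (use T t dfloor_tendsto[of T t] dfloor_facts(2)[of T t] in auto)
qed

section \<open>Chaining and Kolmogorov's criterion\<close>

text \<open>From level m + p to level m the index is halved p times, and each halving costs at most
  one increment of its level. The resulting bound telescopes, with 10 = 1 / (1 - 9/10).\<close>

lemma dyadic_chaining:
  fixes u :: "real \<Rightarrow> real"
  assumes K: "0 \<le> K" and inc: "\<And>j i. i < 2 ^ j \<Longrightarrow> \<bar>u (dyad T j (Suc i)) - u (dyad T j i)\<bar> \<le> K * (9/10) ^ j"
    and i: "i \<le> 2 ^ (m + p)"
  shows "\<bar>u (dyad T (m + p) i) - u (dyad T m (i div 2 ^ p))\<bar> \<le> 10 * K * ((9/10) ^ m - (9/10) ^ (m + p))"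
  using i
proof (induction p arbitrary: i)
  case (Suc p)
  define a where "a = i div 2"
  have a: "a \<le> 2 ^ (m + p)" using Suc(2) by (simp add: a_def)
  have ia: "i div 2 ^ Suc p = a div 2 ^ p" by (simp add: a_def div_mult2_eq)
  have step: "\<bar>u (dyad T (m + Suc p) i) - u (dyad T (m + p) a)\<bar> \<le> K * (9/10) ^ (m + Suc p)"
  proof -
    have ref: "dyad T (m + p) a = dyad T (m + Suc p) (2 * a)" using dyad_refine[of T "m + p" 1 a] by (simp add: mult.commute)
    consider "i = 2 * a" | "i = Suc (2 * a)" unfolding a_def by (metis div_mult_mod_eq mult.commute not_mod_2_eq_0_eq_1 Suc_eq_plus1 add_0_right)
    then show ?thesis
    proof cases
      case 1 then show ?thesis using K by (simp add: ref)
    next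
      case 2
      then show ?thesis using inc[of "2 * a" "m + Suc p"] Suc(2) by (simp only: ref)
    qed
  qed
  have "\<bar>u (dyad T (m + Suc p) i) - u (dyad T m (i div 2 ^ Suc p))\<bar>
      \<le> K * (9/10) ^ (m + Suc p) + 10 * K * ((9/10) ^ m - (9/10) ^ (m + p))"
    unfolding ia using step Suc.IH[OF a] by linarith
  also have "\<dots> \<le> 10 * K * ((9/10) ^ m - (9/10) ^ (m + Suc p))"
    using K by (simp add: algebra_simps)
  finally show ?case .
qed simp

text \<open>Dyadic points closer than \<open>T / 2 ^ m\<close> have ancestors at level m that
  coincide or are neighbours. Two descents and one increment give the factor 10 + 10 + 1 =
  21.\<close>

lemma dyadic_uniformly_continuous:
  fixes u :: "real \<Rightarrow> real"
  assumes T: "0 < T" and K: "0 \<le> K"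
    and inc: "\<And>j i. i < 2 ^ j \<Longrightarrow> \<bar>u (dyad T j (Suc i)) - u (dyad T j i)\<bar> \<le> K * (9/10) ^ j"
  shows "uniformly_continuous_on (dyads T) u"
  unfolding uniformly_continuous_on_def
proof (intro allI impI)
  fix e :: real assume e: "0 < e"
  have "(\<lambda>m. 21 * K * (9/10) ^ m) \<longlonglongrightarrow> 21 * K * 0" by (intro tendsto_intros LIMSEQ_realpow_zero) auto
  then have "\<forall>\<^sub>F m in sequentially. 21 * K * (9/10) ^ m < e" using e by (intro order_tendstoD) auto
  then obtain m where m: "21 * K * (9/10) ^ m < e" by (auto simp: eventually_sequentially)
  show "\<exists>d>0. \<forall>x\<in>dyads T. \<forall>x'\<in>dyads T. dist x' x < d \<longrightarrow> dist (u x') (u x) < e"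
  proof (intro exI[of _ "T / 2 ^ m"] conjI ballI impI)
    show "0 < T / 2 ^ m" using T by simp
    fix s t assume st: "s \<in> dyads T" "t \<in> dyads T" and d: "dist t s < T / 2 ^ m"
    obtain j a b where j: "j \<ge> m" and ab: "a \<le> 2 ^ j" "b \<le> 2 ^ j" "s = dyad T j a" "t = dyad T j b"
      using dyad_common[OF st, of m] by auto
    obtain p where p: "j = m + p" using j by (metis le_Suc_ex)
    define a' b' where "a' = a div 2 ^ p" and "b' = b div 2 ^ p"
    have close: "\<bar>real a - real b\<bar> < 2 ^ p"
    proof -
      have "\<bar>T * real b / 2 ^ j - T * real a / 2 ^ j\<bar> < T / 2 ^ m" using d ab by (simp add: dist_real_def dyad_def)
      then have "T * \<bar>real b - real a\<bar> / 2 ^ j < T / 2 ^ m" using T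
        by (simp add: abs_mult diff_divide_distrib[symmetric] right_diff_distrib[symmetric])
      then show ?thesis using T by (simp add: p power_add field_simps abs_minus_commute)
    qed
    have c': "a < b + 2 ^ p" "b < a + 2 ^ p"
    proof -
      have "real a < real (b + 2 ^ p)" "real b < real (a + 2 ^ p)" using close by auto
      then show "a < b + 2 ^ p" "b < a + 2 ^ p" by (simp_all only: of_nat_less_iff)
    qed
    have le1: "a' \<le> Suc b'" "b' \<le> Suc a'"
      using div_le_mono[of a "b + 2 ^ p" "2 ^ p"] div_le_mono[of b "a + 2 ^ p" "2 ^ p"] c' by (auto simp: a'_def b'_def)
    have bnd: "a' \<le> 2 ^ m" "b' \<le> 2 ^ m"
      using div_le_mono[OF ab(1), of "2 ^ p"] div_le_mono[OF ab(2), of "2 ^ p"] by (auto simp: a'_def b'_def p power_add)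
    have near: "\<bar>u (dyad T m a') - u (dyad T m b')\<bar> \<le> K * (9/10) ^ m"
    proof -
      consider "a' = b'" | "a' = Suc b'" | "b' = Suc a'" using le1 by linarith
      then show ?thesis
      proof cases
        case 1 then show ?thesis using K by simp
      next
        case 2 then show ?thesis using inc[of b' m] bnd by simp
      next
        case 3 then show ?thesis using inc[of a' m] bnd by (simp add: abs_minus_commute)
      qed
    qed
    have ch: "\<bar>u (dyad T j i) - u (dyad T m (i div 2 ^ p))\<bar> \<le> 10 * K * (9/10) ^ m" if "i \<le> 2 ^ j" for i
    proof -
      have "10 * K * ((9/10) ^ m - (9/10) ^ (m + p)) \<le> 10 * K * (9/10) ^ m" using K by (intro mult_left_mono) auto
      then show ?thesis using dyadic_chaining[OF K inc, of i m p] that unfolding p by linarith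
    qed
    have "\<bar>u t - u s\<bar> \<le> 21 * K * (9/10) ^ m"
      using ch[OF ab(1)] ch[OF ab(2)] near unfolding ab(3,4) a'_def b'_def by linarith
    then show "dist (u t) (u s) < e" using m by (simp add: dist_real_def)
  qed
qed

text \<open>The rate 9/10 satisfies 1/2 < (9/10)^4 < 1. At level j there are 2^j increments with
  fourth moments at most C (T / 2^j)^2; weighted by (10/9)^(4 j) = (10000/6561)^j their total
  expectation is at most C T^2 (5000/6561)^j, which is summable. Almost surely the weighted sums are
  then bounded in j, and chaining applies.\<close>

lemma kolmogorov_dyadic:
  fixes U :: "real \<Rightarrow> 'a \<Rightarrow> real"
  assumes M: "prob_space M" and T: "0 < T" and U: "\<And>t. t \<in> dyads T \<Longrightarrow> U t \<in> borel_measurable M" and C: "0 \<le> C"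
    and mom: "\<And>s t. s \<in> dyads T \<Longrightarrow> t \<in> dyads T \<Longrightarrow> s \<le> t \<Longrightarrow>
      (\<integral>\<^sup>+\<omega>. ennreal ((U t \<omega> - U s \<omega>) ^ 4) \<partial>M) \<le> ennreal (C * (t - s)\<^sup>2)"
  shows "AE \<omega> in M. \<exists>g. continuous_on {0..T} g \<and> (\<forall>t\<in>dyads T. g t = U t \<omega>)"
proof -
  interpret prob_space M by fact
  let ?D = "\<lambda>j i \<omega>. U (dyad T j (Suc i)) \<omega> - U (dyad T j i) \<omega>"
  have dm [measurable]: "?D j i \<in> borel_measurable M" if "i < 2 ^ j" for j i
    using U dyadsI[of i j T] dyadsI[of "Suc i" j T] that by simp
  define S where "S j \<omega> = (\<Sum>i<2 ^ j. (10000/6561) ^ j * (?D j i \<omega>) ^ 4)" for j :: nat and \<omega>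
  have Sm [measurable]: "S j \<in> borel_measurable M" for j unfolding S_def[abs_def] by (intro borel_measurable_sum) simp
  have S0: "0 \<le> S j \<omega>" for j \<omega> unfolding S_def by (intro sum_nonneg) simp
  have ES: "(\<integral>\<^sup>+\<omega>. ennreal (S j \<omega>) \<partial>M) \<le> ennreal (C * T\<^sup>2 * (5000/6561) ^ j)" for j
  proof -
    have "(\<integral>\<^sup>+\<omega>. ennreal (S j \<omega>) \<partial>M) = (\<integral>\<^sup>+\<omega>. (\<Sum>i<2 ^ j. ennreal ((10000/6561) ^ j) * ennreal ((?D j i \<omega>) ^ 4)) \<partial>M)"
      unfolding S_def by (intro nn_integral_cong) (simp add: ennreal_mult sum_nonneg sum_ennreal[symmetric] del: sum_ennreal)
    also have "\<dots> = (\<Sum>i<2 ^ j. ennreal ((10000/6561) ^ j) * (\<integral>\<^sup>+\<omega>. ennreal ((?D j i \<omega>) ^ 4) \<partial>M))"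
      by (subst nn_integral_sum) (auto simp: nn_integral_cmult)
    also have "\<dots> \<le> (\<Sum>i<(2::nat) ^ j. ennreal ((10000/6561) ^ j) * ennreal (C * (T / 2 ^ j)\<^sup>2))"
    proof (intro sum_mono mult_left_mono)
      fix i :: nat assume i: "i \<in> {..<2 ^ j}"
      have d: "dyad T j (Suc i) - dyad T j i = T / 2 ^ j" by (simp add: dyad_def field_simps)
      have "0 \<le> T / 2 ^ j" using T by simp
      then show "(\<integral>\<^sup>+\<omega>. ennreal ((?D j i \<omega>) ^ 4) \<partial>M) \<le> ennreal (C * (T / 2 ^ j)\<^sup>2)"
        using mom[of "dyad T j i" "dyad T j (Suc i)"] i d dyadsI[of i j T] dyadsI[of "Suc i" j T] by simp
    qed simp
    also have "\<dots> = ennreal (2 ^ j * ((10000/6561) ^ j * (C * (T / 2 ^ j)\<^sup>2)))"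
      using C by (simp add: ennreal_mult ennreal_power[symmetric] flip: ennreal_numeral)
    also have "2 ^ j * ((10000/6561) ^ j * (C * (T / 2 ^ j)\<^sup>2)) = C * T\<^sup>2 * (5000/6561) ^ j"
    proof -
      have "(10000/6561 :: real) ^ j = (5000/6561) ^ j * 2 ^ j" by (simp flip: power_mult_distrib)
      then show ?thesis by (simp add: power2_eq_square)
    qed
    finally show ?thesis .
  qed
  have "(\<integral>\<^sup>+\<omega>. (\<Sum>j. ennreal (S j \<omega>)) \<partial>M) = (\<Sum>j. \<integral>\<^sup>+\<omega>. ennreal (S j \<omega>) \<partial>M)"
    by (rule nn_integral_suminf) simp
  also have "\<dots> \<le> (\<Sum>j. ennreal (C * T\<^sup>2 * (5000/6561) ^ j))" by (intro suminf_le ES) auto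
  also have "\<dots> < \<infinity>"
    using C by (subst suminf_ennreal_eq[OF _ sums_mult[OF geometric_sums]]) (auto)
  finally have "(\<integral>\<^sup>+\<omega>. (\<Sum>j. ennreal (S j \<omega>)) \<partial>M) \<noteq> \<infinity>" by simp
  then have "AE \<omega> in M. (\<Sum>j. ennreal (S j \<omega>)) \<noteq> \<infinity>" by (intro nn_integral_noteq_infinite) auto
  then show ?thesis
  proof eventually_elim
    case (elim \<omega>)
    define s where "s = enn2real (\<Sum>j. ennreal (S j \<omega>))"
    have Ss: "S j \<omega> \<le> s" for j
    proof -
      have "ennreal (S j \<omega>) \<le> (\<Sum>j. ennreal (S j \<omega>))" using sum_le_suminf[of "\<lambda>j. ennreal (S j \<omega>)" "{j}"] by simp
      also have "\<dots> = ennreal s" using elim by (simp add: s_def less_top)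
      finally show ?thesis using S0 by (simp add: s_def ennreal_le_iff)
    qed
    have s0: "0 \<le> s" by (simp add: s_def)
    have "uniformly_continuous_on (dyads T) (\<lambda>t. U t \<omega>)"
    proof (rule dyadic_uniformly_continuous[OF T, of "1 + s"])
      fix j i :: nat assume i: "i < 2 ^ j"
      have "(10000/6561) ^ j * (?D j i \<omega>) ^ 4 \<le> S j \<omega>"
        unfolding S_def using i by (intro member_le_sum[of i "{..<2 ^ j}" "\<lambda>i. (10000/6561) ^ j * (?D j i \<omega>) ^ 4"]) auto
      also have "\<dots> \<le> s" by (rule Ss)
      \<comment> \<open>Replacing s by a fourth power allows the comparison of fourth powers to be
        turned into one of increments without a root of s.\<close>
      also have "\<dots> \<le> (1 + s) ^ 4" using s0 power_increasing[of 1 4 "1 + s"] by simp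
      finally have le: "(10000/6561) ^ j * (?D j i \<omega>) ^ 4 \<le> (1 + s) ^ 4" .
      have "\<bar>?D j i \<omega>\<bar> ^ 4 \<le> ((1 + s) * (9/10) ^ j) ^ 4"
      proof -
        have "((9/10 :: real) ^ j) ^ 4 * (10000/6561) ^ j = 1"
        proof -
          have "((9/10 :: real) ^ j) ^ 4 = (6561/10000) ^ j" 
          proof -
            have "((9/10 :: real) ^ j) ^ 4 = ((9/10) ^ 4) ^ j" by (simp add: power_mult[symmetric] mult.commute)
            also have "(9/10 :: real) ^ 4 = 6561/10000" by (simp add: power4_eq_xxxx)
            finally show ?thesis .
          qed
          then show ?thesis by (simp flip: power_mult_distrib)
        qed
        then have "\<bar>?D j i \<omega>\<bar> ^ 4 = ((9/10) ^ j) ^ 4 * ((10000/6561) ^ j * (?D j i \<omega>) ^ 4)"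
          by (simp add: power_even_abs mult.assoc[symmetric])
        also have "\<dots> \<le> ((9/10) ^ j) ^ 4 * (1 + s) ^ 4" by (intro mult_left_mono le) simp
        finally show ?thesis by (simp add: power_mult_distrib mult.commute)
      qed
      then show "\<bar>?D j i \<omega>\<bar> \<le> (1 + s) * (9/10) ^ j"
        using power_le_imp_le_base[of "\<bar>?D j i \<omega>\<bar>" 3 "(1 + s) * (9/10) ^ j"] s0 by (simp add: numeral_eq_Suc)
    qed (use s0 in simp)
    then obtain g where g: "uniformly_continuous_on (closure (dyads T)) g" "\<And>t. t \<in> dyads T \<Longrightarrow> U t \<omega> = g t"
      by (rule uniformly_continuous_on_extension_on_closure) metis
    have "continuous_on {0..T} g"
      by (rule continuous_on_subset[OF uniformly_continuous_imp_continuous[OF g(1)] closure_dyads[OF T]])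
    then show ?case using g(2) by (intro exI[of _ g]) auto
  qed
qed

text \<open>The existential statement to be proved fixes the type of the sample space, so a probability
  space on the reals is moved along the constant functions.\<close>

lemma real_space_embedding:
  fixes M :: "real measure" and Z :: "nat \<Rightarrow> real \<Rightarrow> nat \<Rightarrow> real"
  assumes M: "prob_space M" and Z: "\<And>N. Z N \<in> borel_measurable M" and V: "V \<in> borel_measurable M"
    and lim: "AE \<omega> in M. \<forall>i. (\<lambda>N. Z N \<omega> i) \<longlonglongrightarrow> V \<omega> i"
  shows "\<exists>(M' :: (nat \<Rightarrow> real \<Rightarrow> real) measure) Z' V'. prob_space M' \<and> (\<forall>N. Z' N \<in> borel_measurable M') \<and> V' \<in> borel_measurable M' \<and>
    (\<forall>N. distr M' borel (Z' N) = distr M borel (Z N)) \<and> (AE \<omega> in M'. \<forall>i. (\<lambda>N. Z' N \<omega> i) \<longlonglongrightarrow> (V' \<omega> i :: real))"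
proof -
  interpret prob_space M by fact
  define E :: "(nat \<Rightarrow> real \<Rightarrow> real) measure" where "E = embed_measure M (\<lambda>y _ _. y)"
  define \<pi> where "\<pi> f = f 0 0" for f :: "nat \<Rightarrow> real \<Rightarrow> real"
  have inj: "inj (\<lambda>y. (\<lambda>_ _. y) :: nat \<Rightarrow> real \<Rightarrow> real)" by (rule injI) (auto dest: fun_cong)
  have emb: "(\<lambda>y _ _. y) \<in> M \<rightarrow>\<^sub>M E" unfolding E_def using measurable_embed_measure2[OF inj] .
  have proj: "\<pi> \<in> E \<rightarrow>\<^sub>M M" unfolding E_def by (rule measurable_embed_measure1) (simp add: \<pi>_def)
  have E: "E = distr M E (\<lambda>y _ _. y)" unfolding E_def by (rule embed_measure_eq_distr[OF inj])
  have pE: "prob_space E" by (subst E) (rule prob_space_distr[OF emb])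
  have "distr E borel (\<lambda>f. Z N (\<pi> f)) = distr M borel (Z N)" for N
    by (subst E, subst distr_distr[OF measurable_compose[OF proj Z] emb]) (simp add: comp_def \<pi>_def)
  moreover have "AE f in E. \<forall>i. (\<lambda>N. Z N (\<pi> f) i) \<longlonglongrightarrow> V (\<pi> f) i"
    unfolding E_def by (subst AE_embed_measure[OF inj]) (use lim in \<open>simp add: \<pi>_def\<close>)
  ultimately show ?thesis
    by (intro exI[of _ E] exI[of _ "\<lambda>N f. Z N (\<pi> f)"] exI[of _ "\<lambda>f. V (\<pi> f)"] conjI allI pE
        measurable_compose[OF proj Z] measurable_compose[OF proj V]) auto
qed

section \<open>Coarse partitions of a fine grid\<close>

lemma partition_mono:
  fixes p :: "nat \<Rightarrow> 'a::order"
  assumes "\<And>j. j < L \<Longrightarrow> p j < p (Suc j)" "i \<le> j" "j \<le> L"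
  shows "p i \<le> p j"
  using assms(2,3)
proof (induction j rule: dec_induct)
  case (step j)
  then show ?case using assms(1)[of j] by (auto intro: order_trans less_imp_le)
qed simp

text \<open>\<open>q l\<close> is the left end of the coarse cell that contains the fine index l.
  From \<open>p L\<close> on it is the identity, so that \<open>q l \<le> l\<close> holds for every
  l, as the estimates for frozen integrands demand.\<close>

lemma partition_left_endpoint:
  fixes p :: "nat \<Rightarrow> nat"
  assumes p: "p 0 = 0" "\<And>j. j < L \<Longrightarrow> p j < p (Suc j)"
  obtains q where "\<And>l. q l \<le> l" "\<And>j l. j < L \<Longrightarrow> p j \<le> l \<Longrightarrow> l < p (Suc j) \<Longrightarrow> q l = p j"
    "\<And>l. l < p L \<Longrightarrow> \<exists>j<L. q l = p j \<and> p j \<le> l \<and> l < p (Suc j)"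
proof -
  define q where "q l = (if l < p L then p (LEAST j. l < p (Suc j)) else l)" for l
  have q1: "q l = p j" if "j < L" "p j \<le> l" "l < p (Suc j)" for j l
  proof -
    have "(LEAST j. l < p (Suc j)) = j"
    proof (rule Least_equality[of "\<lambda>j. l < p (Suc j)"])
      fix y assume y: "l < p (Suc y)"
      show "j \<le> y"
      proof (rule ccontr)
        assume "\<not> j \<le> y"
        then have "p (Suc y) \<le> p j" using partition_mono[of L p "Suc y" j] p(2) that by auto
        then show False using y that by simp
      qed
    qed (use that in simp)
    moreover have "l < p L" using partition_mono[of L p "Suc j" L] p(2) that by auto
    ultimately show ?thesis by (simp add: q_def)
  qed
  have ex: "\<exists>j<L. p j \<le> l \<and> l < p (Suc j)" if "l < p L" for l
    using that p
  proof (induction L)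
    case (Suc L)
    show ?case
    proof (cases "l < p L")
      case True then show ?thesis using Suc by (metis less_Suc_eq)
    next
      case False then show ?thesis using Suc by auto
    qed
  qed simp
  have q2: "\<exists>j<L. q l = p j \<and> p j \<le> l \<and> l < p (Suc j)" if "l < p L" for l
    using ex[OF that] q1 by blast
  have "q l \<le> l" for l using q2[of l] by (cases "l < p L") (auto simp: q_def)
  then show ?thesis using q1 q2 by (rule that)
qed

lemma sum_partition:
  fixes f :: "nat \<Rightarrow> real" and p :: "nat \<Rightarrow> nat"
  assumes p: "p 0 = 0" "\<And>j. j < L \<Longrightarrow> p j < p (Suc j)"
  shows "(\<Sum>l<p L. f l) = (\<Sum>j<L. \<Sum>l\<in>{p j..<p (Suc j)}. f l)"
  using p
proof (induction L)
  case (Suc L)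
  have "(\<Sum>l<p (Suc L). f l) = (\<Sum>l<p L. f l) + (\<Sum>l\<in>{p L..<p (Suc L)}. f l)"
    using sum_lessThan_diff[of "p L" "p (Suc L)" f] Suc(3)[of L] by simp
  then show ?case using Suc by simp
qed simp

context dyadic
begin

definition riemann_const :: "nat \<Rightarrow> nat \<Rightarrow> real" where "riemann_const n p = (\<sigma> * k n)\<^sup>2 * T * (X_const p + 1) / 2"

text \<open>Both coarse Riemann sums are fine sums in which the integrand is frozen at the left end
  of its cell, so the freezing estimates apply. Partition points are grid indices here, whereas the
  mesh is measured in real time.\<close>

lemma riemann_error:
  assumes h: "0 \<le> h" "h \<le> T" and p: "p 0 = 0" "\<And>j. j < L \<Longrightarrow> p j < p (Suc j)" and pT: "real (p L) * h \<le> T"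
    and \<delta>: "\<And>j. j < L \<Longrightarrow> real (p (Suc j) - p j) * h \<le> \<delta>" "0 < \<delta>"
  shows "(\<integral>\<^sup>+\<omega>. ennreal (((\<Sum>l<p L. \<sigma> * k n * X h \<omega> l s * (sqrt h * \<omega> (n, l)))
      - (\<Sum>j<L. \<sigma> * k n * X h \<omega> (p j) s * (W h \<omega> (p (Suc j)) n - W h \<omega> (p j) n)))\<^sup>2) \<partial>gauss_space) \<le> ennreal (riemann_const n s * \<delta>)"
    "(\<integral>\<^sup>+\<omega>. ennreal ((X h \<omega> (p L) (Suc m) - x (Suc m) - A h \<omega> (p L) m + B h \<omega> (p L) (Suc m)
      - (\<Sum>j<L. drift (Suc m) (X h \<omega> (p j)) * (real (p (Suc j) - p j) * h)))\<^sup>2) \<partial>gauss_space) \<le> ennreal (equation_const m * (\<delta> + h))"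
proof -
  obtain q where q: "\<And>l. q l \<le> l" "\<And>j l. j < L \<Longrightarrow> p j \<le> l \<Longrightarrow> l < p (Suc j) \<Longrightarrow> q l = p j"
    "\<And>l. l < p L \<Longrightarrow> \<exists>j<L. q l = p j \<and> p j \<le> l \<and> l < p (Suc j)"
    using partition_left_endpoint[of p L] p by blast
  have q\<delta>: "real (l - q l) * h \<le> \<delta>" if l: "l < p L" for l
  proof -
    obtain j where j: "j < L" "q l = p j" "p j \<le> l" "l < p (Suc j)" using q(3)[OF l] by blast
    then have "real (l - q l) * h \<le> real (p (Suc j) - p j) * h" using h by (intro mult_right_mono) auto
    then show ?thesis using \<delta>(1)[OF j(1)] by linarith
  qed
  have s1: "(\<Sum>l<p L. \<sigma> * k n * X h \<omega> l s * (sqrt h * \<omega> (n, l)))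
      - (\<Sum>j<L. \<sigma> * k n * X h \<omega> (p j) s * (W h \<omega> (p (Suc j)) n - W h \<omega> (p j) n))
     = (\<Sum>l<p L. \<sigma> * k n * (X h \<omega> l s - X h \<omega> (q l) s) * (sqrt h * \<omega> (n, l)))" for \<omega>
  proof -
    have "(\<Sum>j<L. \<sigma> * k n * X h \<omega> (p j) s * (W h \<omega> (p (Suc j)) n - W h \<omega> (p j) n))
      = (\<Sum>j<L. \<Sum>l\<in>{p j..<p (Suc j)}. \<sigma> * k n * X h \<omega> (q l) s * (sqrt h * \<omega> (n, l)))"
    proof (rule sum.cong[OF refl])
      fix j assume j: "j \<in> {..<L}"
      then have "W h \<omega> (p (Suc j)) n - W h \<omega> (p j) n = (\<Sum>l\<in>{p j..<p (Suc j)}. sqrt h * \<omega> (n, l))"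
        unfolding W_def using p(2)[of j] by (intro sum_lessThan_diff) auto
      then show "\<sigma> * k n * X h \<omega> (p j) s * (W h \<omega> (p (Suc j)) n - W h \<omega> (p j) n)
          = (\<Sum>l\<in>{p j..<p (Suc j)}. \<sigma> * k n * X h \<omega> (q l) s * (sqrt h * \<omega> (n, l)))"
        using q(2)[of j] j by (simp add: sum_distrib_left)
    qed
    also have "\<dots> = (\<Sum>l<p L. \<sigma> * k n * X h \<omega> (q l) s * (sqrt h * \<omega> (n, l)))" by (rule sum_partition[OF p, symmetric])
    finally show ?thesis by (simp add: sum_subtractf[symmetric] algebra_simps)
  qed
  note r = stoch_replace[OF h pT q(1) q\<delta> \<delta>(2), of n s]
  show "(\<integral>\<^sup>+\<omega>. ennreal (((\<Sum>l<p L. \<sigma> * k n * X h \<omega> l s * (sqrt h * \<omega> (n, l)))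
      - (\<Sum>j<L. \<sigma> * k n * X h \<omega> (p j) s * (W h \<omega> (p (Suc j)) n - W h \<omega> (p j) n)))\<^sup>2) \<partial>gauss_space) \<le> ennreal (riemann_const n s * \<delta>)"
    unfolding s1 riemann_const_def by (subst nn_integral_eq_integral[OF r(1)]) (use r(2) in \<open>auto intro!: ennreal_leI\<close>)
  have s2: "(\<Sum>j<L. drift (Suc m) (X h \<omega> (p j)) * (real (p (Suc j) - p j) * h)) = h * (\<Sum>l<p L. drift (Suc m) (X h \<omega> (q l)))" for \<omega>
  proof -
    have "(\<Sum>l<p L. drift (Suc m) (X h \<omega> (q l))) = (\<Sum>j<L. \<Sum>l\<in>{p j..<p (Suc j)}. drift (Suc m) (X h \<omega> (q l)))" by (rule sum_partition[OF p])
    also have "\<dots> = (\<Sum>j<L. real (p (Suc j) - p j) * drift (Suc m) (X h \<omega> (p j)))"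
      using q(2) by (intro sum.cong refl) simp
    finally show ?thesis by (simp add: sum_distrib_left mult_ac)
  qed
  show "(\<integral>\<^sup>+\<omega>. ennreal ((X h \<omega> (p L) (Suc m) - x (Suc m) - A h \<omega> (p L) m + B h \<omega> (p L) (Suc m)
      - (\<Sum>j<L. drift (Suc m) (X h \<omega> (p j)) * (real (p (Suc j) - p j) * h)))\<^sup>2) \<partial>gauss_space) \<le> ennreal (equation_const m * (\<delta> + h))"
    unfolding s2 by (rule equation_error[OF h pT q(1) q\<delta> \<delta>(2)])
qed

text \<open>The processes are numbered by \<open>c = 4 n + r\<close> with \<open>r = 0, 1, 2, 3\<close> for \<open>X\<close>, \<open>W\<close> and the stochastic integrals
  \<open>A = \<integral> \<sigma> k\<^sub>n X\<^sub>n dW\<^sub>n\<close> and \<open>B = \<integral> \<sigma> k\<^sub>n X\<^sub>n\<^sub>+\<^sub>1 dW\<^sub>n\<close>.\<close>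

definition component :: "real \<Rightarrow> (nat \<times> nat \<Rightarrow> real) \<Rightarrow> nat \<Rightarrow> nat \<Rightarrow> real" where
  "component h \<omega> c i = (if c mod 4 = 0 then X h \<omega> i (c div 4) else if c mod 4 = 1 then W h \<omega> i (c div 4)
     else if c mod 4 = 2 then A h \<omega> i (c div 4) else B h \<omega> i (c div 4))"

lemma component_simps: "component h \<omega> (4 * n) i = X h \<omega> i n" "component h \<omega> (4 * n + 1) i = W h \<omega> i n"
  "component h \<omega> (4 * n + 2) i = A h \<omega> i n" "component h \<omega> (4 * n + 3) i = B h \<omega> i n"
proof -
  have "(4 * n + 1) div 4 = n" "(4 * n + 2) div 4 = n" "(4 * n + 3) div 4 = n"
    "(4 * n + 1) mod 4 = 1" "(4 * n + 2) mod 4 = 2" "(4 * n + 3) mod 4 = 3" by presburger+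
  then show "component h \<omega> (4 * n) i = X h \<omega> i n" "component h \<omega> (4 * n + 1) i = W h \<omega> i n"
    "component h \<omega> (4 * n + 2) i = A h \<omega> i n" "component h \<omega> (4 * n + 3) i = B h \<omega> i n"
    by (simp_all only: component_def) simp_all
qed

text \<open>A sum in place of a case distinction: it dominates the constants of all four kinds of
  processes.\<close>

definition component_const :: "nat \<Rightarrow> real" where
  "component_const c = X_const (c div 4) + 3 + 3 * (\<bar>\<sigma> * k (c div 4)\<bar> * R) ^ 4"

lemma component_const_nonneg: "0 \<le> component_const c" using X_const_nonneg[of "c div 4"] by (simp add: component_const_def)

lemma component_measurable [measurable]: "(\<lambda>\<omega>. component h \<omega> c i) \<in> borel_measurable borel"
  by (cases "c mod 4 = 0"; cases "c mod 4 = 1"; cases "c mod 4 = 2") (simp_all add: component_def)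

lemma depends_component: "depends_on (past i) (\<lambda>\<omega>. component h \<omega> c i)"
  by (cases "c mod 4 = 0"; cases "c mod 4 = 1"; cases "c mod 4 = 2") (simp_all add: component_def depends_X depends_WAB)

lemma component_fourth:
  assumes h: "0 \<le> h" "h \<le> T" and ab: "a \<le> b" and bT: "real b * h \<le> T"
  shows "(\<integral>\<^sup>+\<omega>. ennreal ((component h \<omega> c b - component h \<omega> c a) ^ 4) \<partial>gauss_space) \<le> ennreal (component_const c * (real (b - a) * h)\<^sup>2)"
proof -
  let ?n = "c div 4"
  have gen: "(\<integral>\<^sup>+\<omega>. ennreal (F \<omega> ^ 4) \<partial>gauss_space) \<le> ennreal (component_const c * (real (b - a) * h)\<^sup>2)"
    if "integrable gauss_space (\<lambda>\<omega>. F \<omega> ^ 4)" "(\<integral>\<omega>. F \<omega> ^ 4 \<partial>gauss_space) \<le> K * (real (b - a) * h)\<^sup>2" "K \<le> component_const c" for F K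
  proof -
    have "K * (real (b - a) * h)\<^sup>2 \<le> component_const c * (real (b - a) * h)\<^sup>2" using that by (intro mult_right_mono) auto
    then have "(\<integral>\<omega>. F \<omega> ^ 4 \<partial>gauss_space) \<le> component_const c * (real (b - a) * h)\<^sup>2" using that(2) by linarith
    then show ?thesis by (subst nn_integral_eq_integral[OF that(1)]) (auto intro!: ennreal_leI)
  qed
  have K: "X_const ?n \<le> component_const c" "3 \<le> component_const c" "3 * (\<bar>\<sigma> * k ?n\<bar> * R) ^ 4 \<le> component_const c" using X_const_nonneg[of ?n] by (simp_all add: component_const_def)
  note w = WAB_fourth[OF h ab, of ?n]
  show ?thesis
    by (cases "c mod 4 = 0"; cases "c mod 4 = 1"; cases "c mod 4 = 2")
      (simp_all add: component_def gen[OF X_diff_integrable X_fourth[OF h ab bT] K(1)] gen[OF w(1,2) K(2)] gen[OF w(3,4) K(3)] gen[OF w(5,6) K(3)])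
qed

section \<open>Dyadic grids and the countable family of samples\<close>

definition step :: "nat \<Rightarrow> real" where "step N = T / 2 ^ N"
definition grid :: "nat \<Rightarrow> real \<Rightarrow> nat" where "grid N t = nat \<lfloor>t * 2 ^ N / T\<rfloor>"

lemma step_facts: "0 < step N" "0 \<le> step N" "step N \<le> T"
  using T_pos by (auto simp: step_def field_simps)

lemma step_tendsto: "step \<longlonglongrightarrow> 0" unfolding step_def[abs_def] by (rule power_half_tendsto)

text \<open>The steps are \<open>T / 2 ^ N\<close>, so a dyadic time is a grid point from its own
  level on. A statement about finitely many dyadic times is therefore free of rounding for all large
  N.\<close>

lemma grid_exact:
  assumes "t \<in> dyads T"
  shows "\<forall>\<^sub>F N in sequentially. real (grid N t) * step N = t"
proof -
  obtain j i where t: "t = dyad T j i" using assms by (auto simp: dyads_def)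
  have "real (grid N t) * step N = t" if "N \<ge> j" for N
  proof -
    obtain p where p: "N = j + p" using \<open>N \<ge> j\<close> le_Suc_ex by blast
    have "t * 2 ^ N / T = real (i * 2 ^ p)" using T_pos by (simp add: t dyad_def p power_add)
    then have "grid N t = i * 2 ^ p" unfolding grid_def by (simp only: floor_of_nat nat_int)
    then show ?thesis by (simp add: t dyad_def step_def p power_add)
  qed
  then show ?thesis by (auto simp: eventually_sequentially)
qed

lemma grid_le: "0 \<le> t \<Longrightarrow> t \<le> T \<Longrightarrow> real (grid N t) * step N \<le> t"
  using dfloor_facts(3)[OF T_pos, of t N] by (simp add: dfloor_def dyad_def grid_def step_def mult.commute)

lemma grid_mono: "s \<le> t \<Longrightarrow> grid N s \<le> grid N t"
  unfolding grid_def using T_pos by (intro nat_mono floor_mono divide_right_mono mult_right_mono) auto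

definition dyad_time :: "nat \<Rightarrow> real" where "dyad_time d = from_nat_into (dyads T) d"
definition dyad_index :: "nat \<Rightarrow> real \<Rightarrow> nat" where "dyad_index c t = prod_encode (c, to_nat_on (dyads T) t)"

lemma dyad_time_dyads [simp]: "dyad_time d \<in> dyads T" unfolding dyad_time_def by (rule from_nat_into[OF dyads_nonempty])
lemma dyad_time_code [simp]: "t \<in> dyads T \<Longrightarrow> dyad_time (snd (prod_decode (dyad_index c t))) = t" "fst (prod_decode (dyad_index c t)) = c"
  by (simp_all add: dyad_time_def dyad_index_def countable_dyads)

text \<open>Entry i codes a process number and a position in the enumeration of the dyadic times;
  the time is rounded down to the grid of level N.\<close>

definition samples :: "nat \<Rightarrow> (nat \<times> nat \<Rightarrow> real) \<Rightarrow> nat \<Rightarrow> real" where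
  "samples N \<omega> i = component (step N) \<omega> (fst (prod_decode i)) (grid N (dyad_time (snd (prod_decode i))))"

lemma samples_code: "t \<in> dyads T \<Longrightarrow> samples N \<omega> (dyad_index c t) = component (step N) \<omega> c (grid N t)"
  by (simp add: samples_def)

lemma samples_measurable [measurable]: "samples N \<in> borel_measurable borel"
  by (rule measurable_coordinatewise_then_product) (simp add: samples_def)

text \<open>At time 0 each process has a deterministic value a that does not depend on N, and
  \<open>y\<^sup>2 \<le> 2 * a\<^sup>2 + 1 + (y - a) ^ 4\<close> reduces the second moment to the
  fourth moment of the increment from time 0.\<close>

lemma samples_tight: "\<exists>C. \<forall>N. (\<integral>\<^sup>+\<omega>. ennreal ((samples N \<omega> i)\<^sup>2) \<partial>gauss_space) \<le> ennreal C"
proof -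
  let ?c = "fst (prod_decode i)" and ?t = "dyad_time (snd (prod_decode i))"
  define a where "a = (if ?c mod 4 = 0 then x (?c div 4) else 0)"
  have a: "component h \<omega> ?c 0 = a" for h \<omega> by (auto simp: component_def a_def W_def A_def B_def)
  have t: "0 \<le> ?t" "?t \<le> T" using dyads_bounds[OF T_pos dyad_time_dyads] by auto
  show ?thesis
  proof (intro exI allI)
    fix N
    let ?b = "grid N ?t"
    have b: "real ?b * step N \<le> T" using grid_le[OF t, of N] t by linarith
    have le: "(samples N \<omega> i)\<^sup>2 \<le> (2 * a\<^sup>2 + 1) + (component (step N) \<omega> ?c ?b - component (step N) \<omega> ?c 0) ^ 4" for \<omega>
    proof -
      have gen: "y\<^sup>2 \<le> (2 * a\<^sup>2 + 1) + (y - a) ^ 4" for y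
      proof -
        have "0 \<le> (y - 2 * a)\<^sup>2" "0 \<le> ((y - a)\<^sup>2 - 1)\<^sup>2" by simp_all
        then have "y\<^sup>2 \<le> 2 * a\<^sup>2 + 2 * (y - a)\<^sup>2" "2 * (y - a)\<^sup>2 \<le> 1 + ((y - a)\<^sup>2)\<^sup>2"
          by (simp_all add: power2_eq_square algebra_simps)
        then show ?thesis by simp
      qed
      show ?thesis unfolding samples_def a by (rule gen)
    qed
    have "(\<integral>\<^sup>+\<omega>. ennreal ((samples N \<omega> i)\<^sup>2) \<partial>gauss_space)
        \<le> (\<integral>\<^sup>+\<omega>. ennreal (2 * a\<^sup>2 + 1) + ennreal ((component (step N) \<omega> ?c ?b - component (step N) \<omega> ?c 0) ^ 4) \<partial>gauss_space)"
      using le by (intro nn_integral_mono) (simp flip: ennreal_plus)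
    also have "\<dots> = ennreal (2 * a\<^sup>2 + 1) + (\<integral>\<^sup>+\<omega>. ennreal ((component (step N) \<omega> ?c ?b - component (step N) \<omega> ?c 0) ^ 4) \<partial>gauss_space)"
      by (subst nn_integral_add) (auto simp: gauss.emeasure_space_1[simplified])
    also have "\<dots> \<le> ennreal (2 * a\<^sup>2 + 1) + ennreal (component_const ?c * T\<^sup>2)"
    proof (rule add_left_mono)
      have "component_const ?c * (real (?b - 0) * step N)\<^sup>2 \<le> component_const ?c * T\<^sup>2"
        using b step_facts(2)[of N] component_const_nonneg by (intro mult_left_mono power_mono) auto
      then show "(\<integral>\<^sup>+\<omega>. ennreal ((component (step N) \<omega> ?c ?b - component (step N) \<omega> ?c 0) ^ 4) \<partial>gauss_space) \<le> ennreal (component_const ?c * T\<^sup>2)"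
        using component_fourth[OF step_facts(2,3) le0 b, of ?c] by (rule order_trans[OF _ ennreal_leI, rotated])
    qed
    also have "\<dots> = ennreal (2 * a\<^sup>2 + 1 + component_const ?c * T\<^sup>2)" using component_const_nonneg[of ?c] by (subst ennreal_plus) auto
    finally show "(\<integral>\<^sup>+\<omega>. ennreal ((samples N \<omega> i)\<^sup>2) \<partial>gauss_space) \<le> ennreal (2 * a\<^sup>2 + 1 + component_const ?c * T\<^sup>2)" .
  qed
qed

section \<open>Defects of the integrals and of the equation\<close>

text \<open>The defects are polynomials in finitely many values of an abstract family f. The same
  expression is evaluated at the scheme, at its copies and at the limit, and it converges with them.
  Here c numbers the integral process, n is the plane of the noise and s the mode of the
  integrand.\<close>

definition ito_defect :: "(nat \<Rightarrow> real \<Rightarrow> real) \<Rightarrow> nat \<Rightarrow> nat \<Rightarrow> nat \<Rightarrow> (nat \<Rightarrow> real) \<Rightarrow> nat \<Rightarrow> real" where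
  "ito_defect f c n s p L = f c (p L)
    - (\<Sum>j<L. \<sigma> * k n * f (4 * s) (p j) * (f (4 * n + 1) (p (Suc j)) - f (4 * n + 1) (p j)))"

definition equation_defect :: "(nat \<Rightarrow> real \<Rightarrow> real) \<Rightarrow> nat \<Rightarrow> (nat \<Rightarrow> real) \<Rightarrow> nat \<Rightarrow> real" where
  "equation_defect f n p L = f (4 * Suc n) (p L) - x (Suc n) - f (4 * n + 2) (p L) + f (4 * Suc n + 3) (p L)
    - (\<Sum>j<L. drift (Suc n) (\<lambda>m. f (4 * m) (p j)) * (p (Suc j) - p j))"

lemma defect_tendsto:
  assumes f: "\<And>c j. j \<le> L \<Longrightarrow> (\<lambda>i. f i c (p i j)) \<longlonglongrightarrow> f' c (p' j)" and p: "\<And>j. j \<le> L \<Longrightarrow> (\<lambda>i. p i j) \<longlonglongrightarrow> p' j"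
  shows "(\<lambda>i. (ito_defect (f i) c n s (p i) L)\<^sup>2) \<longlonglongrightarrow> (ito_defect f' c n s p' L)\<^sup>2"
    "(\<lambda>i. (equation_defect (f i) n (p i) L)\<^sup>2) \<longlonglongrightarrow> (equation_defect f' n p' L)\<^sup>2"
  unfolding ito_defect_def equation_defect_def drift_def
  by (intro tendsto_power tendsto_diff tendsto_add tendsto_sum tendsto_mult tendsto_const f p; simp)+

lemma defect_measurable:
  assumes f: "\<And>c j. (\<lambda>\<omega>. f \<omega> c (p j)) \<in> borel_measurable M"
  shows "(\<lambda>\<omega>. (ito_defect (f \<omega>) c n s p L)\<^sup>2) \<in> borel_measurable M"
    "(\<lambda>\<omega>. (equation_defect (f \<omega>) n p L)\<^sup>2) \<in> borel_measurable M"
  unfolding ito_defect_def equation_defect_def drift_def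
  by (intro borel_measurable_power borel_measurable_diff borel_measurable_add borel_measurable_sum borel_measurable_times
      borel_measurable_const f)+

text \<open>The observations up to time s, placed in one sequence space for all s with 0 in place of
  later values. Entries are read at \<open>dyad_index\<close>, the positions at which convergence to
  the limit is stated later.\<close>

definition restrict_past :: "real \<Rightarrow> (nat \<Rightarrow> real) \<Rightarrow> nat \<Rightarrow> real" where
  "restrict_past s w i = (if dyad_time (snd (prod_decode i)) \<le> s then w (dyad_index (fst (prod_decode i)) (dyad_time (snd (prod_decode i)))) else 0)"

lemma restrict_past_measurable [measurable]: "restrict_past s \<in> borel_measurable borel"
proof (rule measurable_coordinatewise_then_product)
  show "(\<lambda>w. restrict_past s w i) \<in> borel_measurable borel" for i
    by (cases "dyad_time (snd (prod_decode i)) \<le> s") (simp_all add: restrict_past_def)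
qed

text \<open>The past up to s uses the noise of the steps before \<open>grid N s\<close>, the
  increment that of the steps from there on. The increment is written as a constant sequence because
  both variables of \<open>indep_var\<close> must have the same type.\<close>

lemma past_increment_indep:
  assumes s: "s \<in> dyads T" and t: "t \<in> dyads T" and st: "s < t"
  shows "gauss.indep_var borel (\<lambda>\<omega>. restrict_past s (samples N \<omega>)) borel (\<lambda>\<omega> (_::nat). samples N \<omega> (dyad_index (4 * n + 1) t) - samples N \<omega> (dyad_index (4 * n + 1) s))"
proof (rule gauss_indep_var[where S="past (grid N s)" and S'="{(j, l). grid N s \<le> l}"])
  show "(\<lambda>\<omega>. restrict_past s (samples N \<omega>)) \<in> borel_measurable borel" by measurable
  show "depends_on (past (grid N s)) (\<lambda>\<omega>. restrict_past s (samples N \<omega>))"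
    unfolding depends_on_def
  proof (intro allI impI ext)
    fix \<omega> \<omega>' :: "nat \<times> nat \<Rightarrow> real" and i assume eq: "\<forall>p\<in>past (grid N s). \<omega> p = \<omega>' p"
    show "restrict_past s (samples N \<omega>) i = restrict_past s (samples N \<omega>') i"
    proof (cases "dyad_time (snd (prod_decode i)) \<le> s")
      case True
      have "samples N \<omega> (dyad_index (fst (prod_decode i)) (dyad_time (snd (prod_decode i)))) = samples N \<omega>' (dyad_index (fst (prod_decode i)) (dyad_time (snd (prod_decode i))))"
        unfolding samples_code[OF dyad_time_dyads]
        using eq past_mono[OF grid_mono[OF True, of N]] by (intro depends_onD[OF depends_component]) auto
      then show ?thesis by (simp add: restrict_past_def)
    qed (simp add: restrict_past_def)
  qed
  have inc: "samples N \<omega> (dyad_index (4 * n + 1) t) - samples N \<omega> (dyad_index (4 * n + 1) s) = (\<Sum>l\<in>{grid N s..<grid N t}. sqrt (step N) * \<omega> (n, l))" for \<omega>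
    unfolding samples_code[OF s] samples_code[OF t] component_simps W_def using grid_mono[of s t N] st by (intro sum_lessThan_diff) auto
  show "(\<lambda>\<omega> (_::nat). samples N \<omega> (dyad_index (4 * n + 1) t) - samples N \<omega> (dyad_index (4 * n + 1) s)) \<in> borel_measurable borel"
    unfolding inc by (rule measurable_coordinatewise_then_product) simp
  show "depends_on {(j, l). grid N s \<le> l} (\<lambda>\<omega> (_::nat). samples N \<omega> (dyad_index (4 * n + 1) t) - samples N \<omega> (dyad_index (4 * n + 1) s))"
    unfolding inc depends_on_def by auto
  show "past (grid N s) \<inter> {(j, l). grid N s \<le> l} = {}" by (auto simp: past_def)
qed

text \<open>Process W of plane n reads only the noise of its own plane, and these sets of
  coordinates are disjoint.\<close>

lemma W_family_indep:
  "gauss.indep_vars (\<lambda>_. borel) (\<lambda>n \<omega> d. samples N \<omega> (dyad_index (4 * n + 1) (dyad_time d))) UNIV"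
proof (rule gauss_indep_vars_family[where S="\<lambda>n. {n} \<times> UNIV"])
  show "(\<lambda>\<omega> d. samples N \<omega> (dyad_index (4 * n + 1) (dyad_time d))) \<in> borel_measurable borel" for n
    by (rule measurable_coordinatewise_then_product) (simp add: samples_code)
  show "depends_on ({n} \<times> UNIV) (\<lambda>\<omega> d. samples N \<omega> (dyad_index (4 * n + 1) (dyad_time d)))" for n
    unfolding depends_on_def by (auto simp: samples_code component_simps W_def simp del: One_nat_def)
qed (auto simp: disjoint_family_on_def)

end

section \<open>Passage to the limit\<close>

lemma tendsto_fun: "(\<And>i. (\<lambda>N. f N i) \<longlonglongrightarrow> g i) \<Longrightarrow> f \<longlonglongrightarrow> g" for f :: "nat \<Rightarrow> nat \<Rightarrow> real"
  unfolding limitin_canonical_iff[symmetric] euclidean_product_topology[symmetric] by (simp add: limitin_componentwise)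

section \<open>Transfer from the scheme to its almost sure limit\<close>

text \<open>The outcome of the Skorohod construction is assumed abstractly and on an arbitrary
  sample space, so that the space can be exchanged before the limit is studied.\<close>

locale dyadic_limit = dyadic T \<sigma> k x R + prob_space M
  for T \<sigma> :: real and k x :: "nat \<Rightarrow> real" and R :: real and M :: "'b measure" +
  fixes r :: "nat \<Rightarrow> nat" and Z :: "nat \<Rightarrow> 'b \<Rightarrow> nat \<Rightarrow> real" and V :: "'b \<Rightarrow> nat \<Rightarrow> real"
  assumes r_mono: "strict_mono r" and Z_meas [measurable]: "\<And>N. Z N \<in> borel_measurable M"
    and V_meas [measurable]: "V \<in> borel_measurable M"
    and Z_law: "\<And>N. distr M borel (Z N) = distr gauss_space borel (samples (r N))"
    and Z_lim: "AE \<omega> in M. \<forall>i. (\<lambda>N. Z N \<omega> i) \<longlonglongrightarrow> V \<omega> i"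
begin

lemma Z_meas1 [measurable]: "(\<lambda>\<omega>. Z N \<omega> i) \<in> borel_measurable M"
  by (rule measurable_product_then_coordinatewise[OF Z_meas])

lemma V_meas1 [measurable]: "(\<lambda>\<omega>. V \<omega> i) \<in> borel_measurable M"
  by (rule measurable_product_then_coordinatewise[OF V_meas])

lemma law_nn:
  assumes [measurable]: "F \<in> borel_measurable borel"
  shows "(\<integral>\<^sup>+\<omega>. F (Z N \<omega>) \<partial>M) = (\<integral>\<^sup>+\<omega>. F (samples (r N) \<omega>) \<partial>gauss_space)"
proof -
  have "(\<integral>\<^sup>+\<omega>. F (Z N \<omega>) \<partial>M) = (\<integral>\<^sup>+w. F w \<partial>distr M borel (Z N))" by (subst nn_integral_distr) auto
  also have "\<dots> = (\<integral>\<^sup>+\<omega>. F (samples (r N) \<omega>) \<partial>gauss_space)" unfolding Z_law by (subst nn_integral_distr) auto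
  finally show ?thesis .
qed

lemma law_AE:
  assumes [measurable]: "Measurable.pred borel P" and P: "\<And>\<omega>. P (samples (r N) \<omega>)"
  shows "AE \<omega> in M. P (Z N \<omega>)"
proof -
  have "AE w in distr gauss_space borel (samples (r N)). P w" by (subst AE_distr_iff) (auto simp: P)
  then have "AE w in distr M borel (Z N). P w" unfolding Z_law .
  then show ?thesis by (subst (asm) AE_distr_iff) auto
qed

lemma eventually_r: "eventually P sequentially \<Longrightarrow> \<forall>\<^sub>F N in sequentially. P (r N)"
  using filterlim_subseq[OF r_mono] by (auto simp: filterlim_iff)

text \<open>A moment bound moves from the scheme to the copies by equality of laws, and from the
  copies to the limit by Fatou's lemma.\<close>

lemma moment_limit:
  fixes G :: "nat \<Rightarrow> (nat \<Rightarrow> real) \<Rightarrow> real"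
  assumes [measurable]: "\<And>N. G N \<in> borel_measurable borel"
    and lim: "AE \<omega> in M. (\<lambda>N. G (r N) (Z N \<omega>)) \<longlonglongrightarrow> Y \<omega>"
    and le: "\<forall>\<^sub>F N in sequentially. (\<integral>\<^sup>+\<omega>. ennreal (G N (samples N \<omega>)) \<partial>gauss_space) \<le> ennreal (c N)" and c: "c \<longlonglongrightarrow> C"
  shows "(\<integral>\<^sup>+\<omega>. ennreal (Y \<omega>) \<partial>M) \<le> ennreal C"
proof (rule nn_integral_limit_le[OF _ lim])
  show "(\<lambda>\<omega>. G (r N) (Z N \<omega>)) \<in> borel_measurable M" for N by measurable
  show "\<forall>\<^sub>F N in sequentially. (\<integral>\<^sup>+\<omega>. ennreal (G (r N) (Z N \<omega>)) \<partial>M) \<le> ennreal (c (r N))"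
    using eventually_r[OF le]
  proof eventually_elim
    case (elim N)
    then show ?case by (subst law_nn[of "\<lambda>w. ennreal (G (r N) w)"]) auto
  qed
  show "(\<lambda>N. c (r N)) \<longlonglongrightarrow> C" using LIMSEQ_subseq_LIMSEQ[OF c r_mono] by (simp add: comp_def)
qed

definition U :: "nat \<Rightarrow> real \<Rightarrow> 'b \<Rightarrow> real" where "U c t \<omega> = V \<omega> (dyad_index c t)"

lemma U_meas [measurable]: "U c t \<in> borel_measurable M" unfolding U_def[abs_def] by measurable

lemma U_fourth:
  assumes s: "s \<in> dyads T" and t: "t \<in> dyads T" and st: "s \<le> t"
  shows "(\<integral>\<^sup>+\<omega>. ennreal ((U c t \<omega> - U c s \<omega>) ^ 4) \<partial>M) \<le> ennreal (component_const c * (t - s)\<^sup>2)"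
proof (rule moment_limit[where G="\<lambda>N w. (w (dyad_index c t) - w (dyad_index c s)) ^ 4" and c="\<lambda>_. component_const c * (t - s)\<^sup>2"])
  show "AE \<omega> in M. (\<lambda>N. (Z N \<omega> (dyad_index c t) - Z N \<omega> (dyad_index c s)) ^ 4) \<longlonglongrightarrow> (U c t \<omega> - U c s \<omega>) ^ 4"
    using Z_lim unfolding U_def by eventually_elim (intro tendsto_intros, auto)
  show "\<forall>\<^sub>F N in sequentially. (\<integral>\<^sup>+\<omega>. ennreal ((samples N \<omega> (dyad_index c t) - samples N \<omega> (dyad_index c s)) ^ 4) \<partial>gauss_space) \<le> ennreal (component_const c * (t - s)\<^sup>2)"
    using grid_exact[OF s] grid_exact[OF t]
  proof eventually_elim
    case (elim N)
    have "real (grid N t - grid N s) * step N = t - s"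
      using grid_mono[OF st, of N] elim by (simp add: of_nat_diff left_diff_distrib)
    then show ?case
      using component_fourth[OF step_facts(2)[of N] step_facts(3)[of N] grid_mono[OF st, of N], of c] dyads_bounds[OF T_pos t] elim by (simp add: samples_code s t)
  qed
qed auto

text \<open>Only finitely many modes are tested at a time, so the bound survives entrywise
  convergence; the full energy is recovered later from its partial sums.\<close>

lemma U_energy:
  assumes t: "t \<in> dyads T"
  shows "AE \<omega> in M. (\<Sum>n<m. (U (4 * n) t \<omega>)\<^sup>2) \<le> R\<^sup>2"
proof -
  have "AE \<omega> in M. \<forall>N. (\<Sum>n<m. (Z N \<omega> (dyad_index (4 * n) t))\<^sup>2) \<le> R\<^sup>2"
    unfolding AE_all_countable
    by (intro allI law_AE[where P="\<lambda>w. (\<Sum>n<m. (w (dyad_index (4 * n) t))\<^sup>2) \<le> R\<^sup>2"]) (auto simp: samples_code[OF t] component_simps X_sum)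
  then show ?thesis using Z_lim
  proof eventually_elim
    case (elim \<omega>)
    have "(\<lambda>N. \<Sum>n<m. (Z N \<omega> (dyad_index (4 * n) t))\<^sup>2) \<longlonglongrightarrow> (\<Sum>n<m. (U (4 * n) t \<omega>)\<^sup>2)"
      unfolding U_def by (intro tendsto_intros) (use elim in auto)
    then show ?case by (rule LIMSEQ_le_const2) (use elim in auto)
  qed
qed

lemma zero_dyads: "0 \<in> dyads T" using dyadsI[of 0 0 T] by (simp add: dyad_def)

lemma U_W0: "AE \<omega> in M. U (4 * n + 1) 0 \<omega> = 0"
proof -
  have "grid N 0 = 0" for N by (simp add: grid_def)
  then have "AE \<omega> in M. \<forall>N. Z N \<omega> (dyad_index (4 * n + 1) 0) = 0"
    unfolding AE_all_countable
    by (intro allI law_AE[where P="\<lambda>w. w (dyad_index (4 * n + 1) 0) = 0"]) (simp_all only: samples_code[OF zero_dyads] component_simps, simp_all add: W_def)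
  then show ?thesis using Z_lim
  proof eventually_elim
    case (elim \<omega>)
    then have "(\<lambda>N. Z N \<omega> (dyad_index (4 * n + 1) 0)) \<longlonglongrightarrow> U (4 * n + 1) 0 \<omega>" unfolding U_def by blast
    then show ?case using elim(1) LIMSEQ_unique[OF _ tendsto_const] by (simp add: LIMSEQ_const_iff)
  qed
qed

section \<open>A version with continuous paths\<close>

definition nice :: "'b \<Rightarrow> bool" where
  "nice \<omega> \<longleftrightarrow> (\<forall>c. \<exists>g. continuous_on {0..T} g \<and> (\<forall>t\<in>dyads T. g t = U c t \<omega>)) \<and>
    (\<forall>t\<in>dyads T. \<forall>m. (\<Sum>n<m. (U (4 * n) t \<omega>)\<^sup>2) \<le> R\<^sup>2) \<and> (\<forall>n. U (4 * n + 1) 0 \<omega> = 0)"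

lemma AE_nice: "AE \<omega> in M. nice \<omega>"
proof -
  have "AE \<omega> in M. \<forall>c. \<exists>g. continuous_on {0..T} g \<and> (\<forall>t\<in>dyads T. g t = U c t \<omega>)"
    unfolding AE_all_countable
    by (intro allI kolmogorov_dyadic[OF prob_space_axioms T_pos _ component_const_nonneg U_fourth]) auto
  moreover have "AE \<omega> in M. \<forall>t\<in>dyads T. \<forall>m. (\<Sum>n<m. (U (4 * n) t \<omega>)\<^sup>2) \<le> R\<^sup>2"
    unfolding AE_ball_countable[OF countable_dyads] AE_all_countable using U_energy by blast
  moreover have "AE \<omega> in M. \<forall>n. U (4 * n + 1) 0 \<omega> = 0" unfolding AE_all_countable using U_W0 by blast
  ultimately show ?thesis unfolding nice_def by eventually_elim blast
qed

text \<open>The set of nice points asks for the existence of a continuous function and is not known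
  to be measurable; a measurable subset of full measure is chosen in its place.\<close>

definition good :: "'b set" where
  "good = (SOME G. G \<in> sets M \<and> (AE \<omega> in M. \<omega> \<in> G) \<and> (\<forall>\<omega>\<in>G. nice \<omega>))"

lemma good: "good \<in> sets M" "AE \<omega> in M. \<omega> \<in> good" "\<omega> \<in> good \<Longrightarrow> nice \<omega>"
proof -
  obtain N where N: "{\<omega> \<in> space M. \<not> nice \<omega>} \<subseteq> N" "emeasure M N = 0" "N \<in> sets M" using AE_E[OF AE_nice] by blast
  have "AE \<omega> in M. \<omega> \<in> space M - N" using AE_not_in[of N M] N AE_space by (auto simp: null_sets_def)
  then have "\<exists>G. G \<in> sets M \<and> (AE \<omega> in M. \<omega> \<in> G) \<and> (\<forall>\<omega>\<in>G. nice \<omega>)"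
    using N by (intro exI[of _ "space M - N"]) auto
  from someI_ex[OF this] show "good \<in> sets M" "AE \<omega> in M. \<omega> \<in> good" "\<omega> \<in> good \<Longrightarrow> nice \<omega>"
    unfolding good_def by blast+
qed

text \<open>The value 0 off \<open>good\<close> makes continuity, the zero start of the Brownian
  motions and the energy bound hold at every point, as \<open>brownian_motion\<close> and
  \<open>weak_solution\<close> demand. A limit along countably many rounded times keeps
  measurability evident.\<close>

definition Y :: "nat \<Rightarrow> real \<Rightarrow> 'b \<Rightarrow> real" where
  "Y c t \<omega> = (if \<omega> \<in> good then lim (\<lambda>j. U c (dfloor T j t) \<omega>) else 0)"

lemma Y_meas [measurable]: "Y c t \<in> borel_measurable M"
proof -
  note [measurable] = good(1)
  show ?thesis unfolding Y_def[abs_def] by measurable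
qed

lemma Y_good:
  assumes w: "\<omega> \<in> good"
  shows "\<exists>g. continuous_on {0..T} g \<and> (\<forall>t\<in>dyads T. g t = U c t \<omega>) \<and> (\<forall>t\<in>{0..T}. Y c t \<omega> = g t)"
proof -
  obtain g where g: "continuous_on {0..T} g" "\<And>t. t \<in> dyads T \<Longrightarrow> g t = U c t \<omega>"
    using good(3)[OF w] unfolding nice_def by blast
  have "Y c t \<omega> = g t" if t: "t \<in> {0..T}" for t
  proof -
    have d: "dfloor T j t \<in> dyads T" for j using dfloor_facts(2)[OF T_pos] t by auto
    have "(\<lambda>j. g (dfloor T j t)) \<longlonglongrightarrow> g t"
      using t dyads_bounds[OF T_pos d] dfloor_tendsto[OF T_pos]
      by (intro continuous_on_tendsto_compose[OF g(1)]) auto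
    then have "(\<lambda>j. U c (dfloor T j t) \<omega>) \<longlonglongrightarrow> g t" by (simp add: g(2)[OF d])
    then show ?thesis using w by (simp add: Y_def limI)
  qed
  then show ?thesis using g by blast
qed

lemma Y_continuous: "continuous_on {0..T} (\<lambda>t. Y c t \<omega>)"
proof (cases "\<omega> \<in> good")
  case True
  then obtain g where g: "continuous_on {0..T} g" "\<And>t. t \<in> {0..T} \<Longrightarrow> Y c t \<omega> = g t" using Y_good[of \<omega> c] by auto
  then show ?thesis using continuous_on_cong[OF refl, of "{0..T}" "\<lambda>t. Y c t \<omega>" g] by simp
next
  case False then show ?thesis by (simp add: Y_def)
qed

lemma Y_dyadic: "t \<in> dyads T \<Longrightarrow> \<omega> \<in> good \<Longrightarrow> Y c t \<omega> = U c t \<omega>"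
proof -
  assume t: "t \<in> dyads T" and w: "\<omega> \<in> good"
  obtain g where g: "\<forall>t\<in>dyads T. g t = U c t \<omega>" "\<forall>t\<in>{0..T}. Y c t \<omega> = g t" using Y_good[OF w, of c] by blast
  have "t \<in> {0..T}" using dyads_bounds[OF T_pos t] by simp
  then show "Y c t \<omega> = U c t \<omega>" using g t by simp
qed

lemma Y_tendsto:
  assumes "\<And>j. u j \<in> {0..T}" "u \<longlonglongrightarrow> t"
  shows "(\<lambda>j. Y c (u j) \<omega>) \<longlonglongrightarrow> Y c t \<omega>"
proof -
  have u: "0 \<le> u j" "u j \<le> T" for j using assms(1)[of j] by auto
  have "0 \<le> t" by (rule LIMSEQ_le_const[OF assms(2)]) (use u(1) in blast)
  moreover have "t \<le> T" by (rule LIMSEQ_le_const2[OF assms(2)]) (use u(2) in blast)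
  ultimately have "t \<in> {0..T}" by simp
  then show ?thesis using assms by (intro continuous_on_tendsto_compose[OF Y_continuous[of c \<omega>]]) auto
qed

lemma Y_energy:
  assumes t: "t \<in> {0..T}"
  shows "(\<Sum>n<m. (Y (4 * n) t \<omega>)\<^sup>2) \<le> R\<^sup>2"
proof (cases "\<omega> \<in> good")
  case True
  have d: "dfloor T j t \<in> dyads T" for j using dfloor_facts(2)[OF T_pos] t by auto
  have "(\<Sum>n<m. (Y (4 * n) (dfloor T j t) \<omega>)\<^sup>2) \<le> R\<^sup>2" for j
    using good(3)[OF True] d by (simp add: Y_dyadic[OF d True] nice_def)
  moreover have "(\<lambda>j. \<Sum>n<m. (Y (4 * n) (dfloor T j t) \<omega>)\<^sup>2) \<longlonglongrightarrow> (\<Sum>n<m. (Y (4 * n) t \<omega>)\<^sup>2)"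
    using t dyads_bounds[OF T_pos d] dfloor_tendsto[OF T_pos] by (intro tendsto_intros Y_tendsto) auto
  ultimately show ?thesis by (intro LIMSEQ_le_const2) auto
qed (simp add: Y_def)

lemma Y_W0: "Y (4 * n + 1) 0 \<omega> = 0"
proof (cases "\<omega> \<in> good")
  case True
  then show ?thesis using Y_dyadic[OF zero_dyads True] good(3)[OF True] unfolding nice_def by metis
qed (simp add: Y_def)

lemma Z_tendsto_Y: "AE \<omega> in M. \<forall>c. \<forall>t\<in>dyads T. (\<lambda>N. Z N \<omega> (dyad_index c t)) \<longlonglongrightarrow> Y c t \<omega>"
  using Z_lim good(2) by eventually_elim (auto simp: Y_dyadic U_def)

definition YY :: "'b \<Rightarrow> nat \<Rightarrow> real" where "YY \<omega> i = Y (fst (prod_decode i)) (dyad_time (snd (prod_decode i))) \<omega>"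

lemma YY_meas [measurable]: "YY \<in> borel_measurable M"
  by (rule measurable_coordinatewise_then_product) (simp add: YY_def)

lemma YY_code: "t \<in> dyads T \<Longrightarrow> YY \<omega> (dyad_index c t) = Y c t \<omega>" by (simp add: YY_def)


lemma Z_YY: "AE \<omega> in M. \<forall>s. (\<lambda>N. restrict_past s (Z N \<omega>)) \<longlonglongrightarrow> restrict_past s (YY \<omega>)"
  using Z_tendsto_Y
proof eventually_elim
  case (elim \<omega>)
  show ?case
  proof (intro allI tendsto_fun)
    fix s i
    show "(\<lambda>N. restrict_past s (Z N \<omega>) i) \<longlonglongrightarrow> restrict_past s (YY \<omega>) i"
      using elim by (simp add: restrict_past_def YY_code)
  qed
qed

section \<open>Laws and independence of the limiting noise\<close>

text \<open>For large N both times lie on the grid and the normalised increment of the copy is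
  standard normal already, so the law is constant along the sequence.\<close>

lemma W_law:
  assumes s: "s \<in> dyads T" and t: "t \<in> dyads T" and st: "s < t"
  shows "distr M borel (\<lambda>\<omega>. (Y (4 * n + 1) t \<omega> - Y (4 * n + 1) s \<omega>) / sqrt (t - s)) = std_normal_distribution"
proof (rule distr_limit[where U="\<lambda>N \<omega>. (Z N \<omega> (dyad_index (4 * n + 1) t) - Z N \<omega> (dyad_index (4 * n + 1) s)) / sqrt (t - s)"])
  show "AE \<omega> in M. (\<lambda>N. (Z N \<omega> (dyad_index (4 * n + 1) t) - Z N \<omega> (dyad_index (4 * n + 1) s)) / sqrt (t - s))
      \<longlonglongrightarrow> (Y (4 * n + 1) t \<omega> - Y (4 * n + 1) s \<omega>) / sqrt (t - s)"
    using Z_tendsto_Y by eventually_elim (intro tendsto_intros, use s t st in auto)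
  show "\<forall>\<^sub>F N in sequentially. distr M borel (\<lambda>\<omega>. (Z N \<omega> (dyad_index (4 * n + 1) t) - Z N \<omega> (dyad_index (4 * n + 1) s)) / sqrt (t - s)) = std_normal_distribution"
    using eventually_r[OF grid_exact[OF s]] eventually_r[OF grid_exact[OF t]]
  proof eventually_elim
    case (elim N)
    let ?\<phi> = "\<lambda>w. (w (dyad_index (4 * n + 1) t) - w (dyad_index (4 * n + 1) s)) / sqrt (t - s)"
    let ?h = "step (r N)" and ?a = "grid (r N) s" and ?b = "grid (r N) t"
    have "real ?a * ?h < real ?b * ?h" using elim st by simp
    then have ab: "?a < ?b" using step_facts(2)[of "r N"] by (simp add: mult_less_cancel_right)
    have diff: "real (?b - ?a) * ?h = t - s" using ab elim by (simp add: of_nat_diff left_diff_distrib)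
    have \<phi>: "?\<phi> \<in> borel_measurable borel" by measurable
    have "distr M borel (\<lambda>\<omega>. ?\<phi> (Z N \<omega>)) = distr (distr M borel (Z N)) borel ?\<phi>"
      by (subst distr_distr[OF \<phi> Z_meas]) (simp add: comp_def)
    also have "\<dots> = distr gauss_space borel (\<lambda>\<omega>. ?\<phi> (samples (r N) \<omega>))"
      unfolding Z_law by (subst distr_distr[OF \<phi>]) (simp_all add: comp_def)
    also have "\<dots> = std_normal_distribution"
      using W_increment_law[OF step_facts(1) ab, of "r N" n] unfolding diff by (simp only: samples_code[OF s] samples_code[OF t] component_simps)
    finally show ?case .
  qed
qed measurable

lemma past_indep:
  assumes s: "s \<in> dyads T" and t: "t \<in> dyads T" and st: "s < t"
  shows "indep_var borel (\<lambda>\<omega>. restrict_past s (YY \<omega>)) borel (\<lambda>\<omega> (_::nat). Y (4 * n + 1) t \<omega> - Y (4 * n + 1) s \<omega>)"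
proof (rule indep_var_limit[where U="\<lambda>N \<omega>. restrict_past s (Z N \<omega>)" and
      U'="\<lambda>N \<omega> _. Z N \<omega> (dyad_index (4 * n + 1) t) - Z N \<omega> (dyad_index (4 * n + 1) s)"])
  let ?\<psi> = "\<lambda>w (_::nat). w (dyad_index (4 * n + 1) t) - w (dyad_index (4 * n + 1) s) :: real"
  show "AE \<omega> in M. (\<lambda>N. restrict_past s (Z N \<omega>)) \<longlonglongrightarrow> restrict_past s (YY \<omega>)"
    using Z_YY by eventually_elim blast
  show "AE \<omega> in M. (\<lambda>N. ?\<psi> (Z N \<omega>)) \<longlonglongrightarrow> (\<lambda>_. Y (4 * n + 1) t \<omega> - Y (4 * n + 1) s \<omega>)"
    using Z_tendsto_Y by eventually_elim (intro tendsto_fun tendsto_intros, use s t in auto)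
  show "\<forall>\<^sub>F N in sequentially. indep_var borel (\<lambda>\<omega>. restrict_past s (Z N \<omega>)) borel (\<lambda>\<omega>. ?\<psi> (Z N \<omega>))"
  proof (rule always_eventually, rule allI)
    fix N
    \<comment> \<open>Past and increment are rewritten as a family of functions of the single
      variable \<open>Z N\<close>, the form in which independence is transferred between
      spaces.\<close>
    let ?f = "case_bool (restrict_past s) ?\<psi>"
    have *: "case_bool borel borel = (\<lambda>_. borel)" by (auto simp: fun_eq_iff split: bool.split)
    have c: "case_bool (\<lambda>\<omega>. restrict_past s (f \<omega>)) (\<lambda>\<omega>. ?\<psi> (f \<omega>)) = (\<lambda>j \<omega>. ?f j (f \<omega>))" for f :: "'x \<Rightarrow> nat \<Rightarrow> real"
      by (auto simp: fun_eq_iff split: bool.split)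
    have m: "?\<psi> \<in> borel_measurable borel" by (rule measurable_coordinatewise_then_product) measurable
    have "gauss.indep_vars (\<lambda>_. borel) (\<lambda>j \<omega>. ?f j (samples (r N) \<omega>)) UNIV"
      using past_increment_indep[OF s t st, of "r N" n] unfolding gauss.indep_var_def * c .
    then have "indep_vars (\<lambda>_. borel) (\<lambda>j \<omega>. ?f j (Z N \<omega>)) UNIV"
      by (rule indep_vars_transfer[OF prob_space_axioms gauss.prob_space_axioms Z_meas _ Z_law, rotated 2]) (use m in \<open>auto split: bool.split\<close>)
    then show "indep_var borel (\<lambda>\<omega>. restrict_past s (Z N \<omega>)) borel (\<lambda>\<omega>. ?\<psi> (Z N \<omega>))"
      unfolding indep_var_def * c .
  qed
  show "(\<lambda>\<omega>. ?\<psi> (Z N \<omega>)) \<in> borel_measurable M" for N by (rule measurable_coordinatewise_then_product) measurable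
  show "(\<lambda>\<omega> (_::nat). Y (4 * n + 1) t \<omega> - Y (4 * n + 1) s \<omega>) \<in> borel_measurable M"
    by (rule measurable_coordinatewise_then_product) measurable
qed measurable

lemma W_indep: "indep_vars (\<lambda>_. borel) (\<lambda>n \<omega> d. Y (4 * n + 1) (dyad_time d) \<omega>) UNIV"
proof (rule indep_vars_limit[where U="\<lambda>N n \<omega> d. Z N \<omega> (dyad_index (4 * n + 1) (dyad_time d))"])
  let ?f = "\<lambda>n w d. w (dyad_index (4 * n + 1) (dyad_time d)) :: real"
  show "AE \<omega> in M. (\<lambda>N. ?f n (Z N \<omega>)) \<longlonglongrightarrow> (\<lambda>d. Y (4 * n + 1) (dyad_time d) \<omega>)" for n
    using Z_tendsto_Y by eventually_elim (intro tendsto_fun, auto)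
  have m: "?f n \<in> borel_measurable borel" for n by (rule measurable_coordinatewise_then_product) measurable
  show "\<forall>\<^sub>F N in sequentially. indep_vars (\<lambda>_. borel) (\<lambda>n \<omega>. ?f n (Z N \<omega>)) UNIV"
  proof (rule always_eventually, rule allI)
    fix N
    show "indep_vars (\<lambda>_. borel) (\<lambda>n \<omega>. ?f n (Z N \<omega>)) UNIV"
      by (rule indep_vars_transfer[where \<phi>="?f" and z="samples (r N)", OF prob_space_axioms gauss.prob_space_axioms Z_meas _ Z_law _ W_family_indep[of "r N"]])
        (use m in auto)
  qed
  show "(\<lambda>\<omega>. ?f n (Z N \<omega>)) \<in> borel_measurable M" for n N by (rule measurable_compose[OF Z_meas m])
  show "(\<lambda>\<omega> d. Y (4 * n + 1) (dyad_time d) \<omega>) \<in> borel_measurable M" for n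
    by (rule measurable_coordinatewise_then_product) measurable
qed

section \<open>Mean square Riemann estimates for the limit\<close>

text \<open>For large N all partition points lie on the grid and the gaps are unchanged. The
  additional \<open>step N\<close> in the bound for the equation is the error of the scheme; it
  vanishes in the limit and leaves the mesh alone.\<close>

lemma riemann_dyadic:
  assumes p0: "p 0 = 0" and pd: "\<And>j. j \<le> L \<Longrightarrow> p j \<in> dyads T" and p: "\<And>j. j < L \<Longrightarrow> p j < p (Suc j)"
    and \<delta>: "\<And>j. j < L \<Longrightarrow> p (Suc j) - p j \<le> \<delta>" "0 < \<delta>"
  shows "c = 4 * n + 2 \<and> s = n \<or> c = 4 * n + 3 \<and> s = Suc n \<Longrightarrow>
      (\<integral>\<^sup>+\<omega>. ennreal ((ito_defect (\<lambda>c t. Y c t \<omega>) c n s p L)\<^sup>2) \<partial>M) \<le> ennreal (riemann_const n s * \<delta>)"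
    "(\<integral>\<^sup>+\<omega>. ennreal ((equation_defect (\<lambda>c t. Y c t \<omega>) n p L)\<^sup>2) \<partial>M) \<le> ennreal (equation_const n * \<delta>)"
proof -
  have ex: "\<forall>\<^sub>F N in sequentially. \<forall>j\<in>{..L}. real (grid N (p j)) * step N = p j"
    using pd grid_exact by (intro eventually_ball_finite) auto
  have d: "p j \<in> dyads T" "p (Suc j) \<in> dyads T" if "j < L" for j using pd that by auto
  note dL = pd[OF order_refl]
  have parts: "grid N (p 0) = 0 \<and> (\<forall>j<L. grid N (p j) < grid N (p (Suc j))) \<and> real (grid N (p L)) * step N \<le> T
      \<and> (\<forall>j<L. real (grid N (p (Suc j)) - grid N (p j)) * step N = p (Suc j) - p j)"
    if e: "\<forall>j\<in>{..L}. real (grid N (p j)) * step N = p j" for N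
  proof (intro conjI allI impI)
    show "grid N (p 0) = 0" by (simp add: p0 grid_def)
    show "real (grid N (p L)) * step N \<le> T" using e dyads_bounds[OF T_pos dL] by simp
    fix j assume j: "j < L"
    have "real (grid N (p j)) * step N < real (grid N (p (Suc j))) * step N" using e j p[OF j] by simp
    then show lt: "grid N (p j) < grid N (p (Suc j))" using step_facts(2)[of N] by (simp add: mult_less_cancel_right)
    show "real (grid N (p (Suc j)) - grid N (p j)) * step N = p (Suc j) - p j"
      using e j lt by (simp add: of_nat_diff left_diff_distrib)
  qed
  have Ylim: "AE \<omega> in M. \<forall>c. \<forall>j\<le>L. (\<lambda>N. Z N \<omega> (dyad_index c (p j))) \<longlonglongrightarrow> Y c (p j) \<omega>"
    using Z_tendsto_Y by eventually_elim (use pd in auto)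
  { assume cs: "c = 4 * n + 2 \<and> s = n \<or> c = 4 * n + 3 \<and> s = Suc n"
    show "(\<integral>\<^sup>+\<omega>. ennreal ((ito_defect (\<lambda>c t. Y c t \<omega>) c n s p L)\<^sup>2) \<partial>M) \<le> ennreal (riemann_const n s * \<delta>)"
    proof (rule moment_limit[where G="\<lambda>N w. (ito_defect (\<lambda>c t. w (dyad_index c t)) c n s p L)\<^sup>2" and c="\<lambda>_. riemann_const n s * \<delta>"])
      show "(\<lambda>w. (ito_defect (\<lambda>c t. w (dyad_index c t)) c n s p L)\<^sup>2) \<in> borel_measurable borel"
        by (rule defect_measurable[OF measurable_product_coordinates])
      show "AE \<omega> in M. (\<lambda>N. (ito_defect (\<lambda>c t. Z N \<omega> (dyad_index c t)) c n s p L)\<^sup>2) \<longlonglongrightarrow> (ito_defect (\<lambda>c t. Y c t \<omega>) c n s p L)\<^sup>2"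
        using Ylim by eventually_elim (rule defect_tendsto, auto)
      show "\<forall>\<^sub>F N in sequentially. (\<integral>\<^sup>+\<omega>. ennreal ((ito_defect (\<lambda>c t. samples N \<omega> (dyad_index c t)) c n s p L)\<^sup>2) \<partial>gauss_space) \<le> ennreal (riemann_const n s * \<delta>)"
        using ex
      proof eventually_elim
        case (elim N)
        note g = parts[OF elim]
        have eq: "ito_defect (\<lambda>c t. samples N \<omega> (dyad_index c t)) c n s p L
          = (\<Sum>l<grid N (p L). \<sigma> * k n * X (step N) \<omega> l s * (sqrt (step N) * \<omega> (n, l)))
            - (\<Sum>j<L. \<sigma> * k n * X (step N) \<omega> (grid N (p j)) s * (W (step N) \<omega> (grid N (p (Suc j))) n - W (step N) \<omega> (grid N (p j)) n))" for \<omega>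
        proof -
          have "samples N \<omega> (dyad_index c (p L)) = (\<Sum>l<grid N (p L). \<sigma> * k n * X (step N) \<omega> l s * (sqrt (step N) * \<omega> (n, l)))"
            using cs by (auto simp only: samples_code[OF dL] component_simps A_def B_def)
          moreover have "(\<Sum>j<L. \<sigma> * k n * samples N \<omega> (dyad_index (4 * s) (p j)) * (samples N \<omega> (dyad_index (4 * n + 1) (p (Suc j))) - samples N \<omega> (dyad_index (4 * n + 1) (p j))))
            = (\<Sum>j<L. \<sigma> * k n * X (step N) \<omega> (grid N (p j)) s * (W (step N) \<omega> (grid N (p (Suc j))) n - W (step N) \<omega> (grid N (p j)) n))"
            using d by (intro sum.cong refl) (simp only: samples_code component_simps lessThan_iff)
          ultimately show ?thesis by (simp only: ito_defect_def)
        qed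
        show ?case unfolding eq
          by (rule riemann_error(1)[where p="\<lambda>j. grid N (p j)", OF step_facts(2,3)]) (use g \<delta> in auto)
      qed
    qed (rule tendsto_const)
  }
  show "(\<integral>\<^sup>+\<omega>. ennreal ((equation_defect (\<lambda>c t. Y c t \<omega>) n p L)\<^sup>2) \<partial>M) \<le> ennreal (equation_const n * \<delta>)"
  proof (rule moment_limit[where G="\<lambda>N w. (equation_defect (\<lambda>c t. w (dyad_index c t)) n p L)\<^sup>2" and c="\<lambda>N. equation_const n * (\<delta> + step N)"])
    show "(\<lambda>w. (equation_defect (\<lambda>c t. w (dyad_index c t)) n p L)\<^sup>2) \<in> borel_measurable borel"
      by (rule defect_measurable[OF measurable_product_coordinates])
    show "AE \<omega> in M. (\<lambda>N. (equation_defect (\<lambda>c t. Z N \<omega> (dyad_index c t)) n p L)\<^sup>2) \<longlonglongrightarrow> (equation_defect (\<lambda>c t. Y c t \<omega>) n p L)\<^sup>2"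
      using Ylim by eventually_elim (rule defect_tendsto, auto)
    show "\<forall>\<^sub>F N in sequentially. (\<integral>\<^sup>+\<omega>. ennreal ((equation_defect (\<lambda>c t. samples N \<omega> (dyad_index c t)) n p L)\<^sup>2) \<partial>gauss_space)
      \<le> ennreal (equation_const n * (\<delta> + step N))"
      using ex
    proof eventually_elim
      case (elim N)
      note g = parts[OF elim]
      have eq: "equation_defect (\<lambda>c t. samples N \<omega> (dyad_index c t)) n p L
        = X (step N) \<omega> (grid N (p L)) (Suc n) - x (Suc n) - A (step N) \<omega> (grid N (p L)) n + B (step N) \<omega> (grid N (p L)) (Suc n)
          - (\<Sum>j<L. drift (Suc n) (X (step N) \<omega> (grid N (p j))) * (real (grid N (p (Suc j)) - grid N (p j)) * step N))" for \<omega>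
      proof -
        have "(\<Sum>j<L. drift (Suc n) (\<lambda>m. samples N \<omega> (dyad_index (4 * m) (p j))) * (p (Suc j) - p j))
          = (\<Sum>j<L. drift (Suc n) (X (step N) \<omega> (grid N (p j))) * (real (grid N (p (Suc j)) - grid N (p j)) * step N))"
          using d g by (intro sum.cong refl) (simp add: samples_code component_simps)
        then show ?thesis by (simp only: equation_defect_def samples_code[OF dL] component_simps)
      qed
      show ?case unfolding eq
        by (rule riemann_error(2)[where p="\<lambda>j. grid N (p j)", OF step_facts(2,3)]) (use g \<delta> in auto)
    qed
    have "(\<lambda>N. equation_const n * (\<delta> + step N)) \<longlonglongrightarrow> equation_const n * (\<delta> + 0)" by (intro tendsto_intros step_tendsto)
    then show "(\<lambda>N. equation_const n * (\<delta> + step N)) \<longlonglongrightarrow> equation_const n * \<delta>" by simp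
  qed
qed

end

text \<open>Uniform continuity makes the error over the first L cells at most e times the length
  covered, by adding one cell at a time. The choice e = r / (2 t) leaves a strict inequality for the
  whole interval.\<close>

lemma riemann_sum_tendsto:
  fixes f :: "real \<Rightarrow> real"
  assumes t: "0 < t" and f: "continuous_on {0..t} f"
  shows "(\<lambda>N. \<Sum>i<Suc N. f (t * real i / real (Suc N)) * (t * real (Suc i) / real (Suc N) - t * real i / real (Suc N))) \<longlonglongrightarrow> integral {0..t} f"
proof (rule LIMSEQ_I)
  fix r :: real assume r: "0 < r"
  define e where "e = r / (2 * t)"
  have e: "0 < e" using r t by (simp add: e_def)
  have "uniformly_continuous_on {0..t} f" by (rule compact_uniformly_continuous[OF f]) simp
  then obtain d where d: "0 < d" "\<And>u v. u \<in> {0..t} \<Longrightarrow> v \<in> {0..t} \<Longrightarrow> dist v u < d \<Longrightarrow> dist (f v) (f u) < e"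
    using e unfolding uniformly_continuous_on_def by metis
  obtain N0 :: nat where N0: "t / d < real N0" using reals_Archimedean2 by blast
  show "\<exists>no. \<forall>N\<ge>no. norm ((\<Sum>i<Suc N. f (t * real i / real (Suc N)) * (t * real (Suc i) / real (Suc N) - t * real i / real (Suc N))) - integral {0..t} f) < r"
  proof (intro exI allI impI)
    fix N assume N: "N0 \<le> N"
    define p where "p i = t * real i / real (Suc N)" for i
    have gap: "p (Suc i) - p i < d" for i
    proof -
      have "t / d < real (Suc N)" using N N0 by linarith
      then have "t / real (Suc N) < d" using d(1) by (simp add: field_simps)
      moreover have "p (Suc i) - p i = t / real (Suc N)" by (simp add: p_def diff_divide_distrib[symmetric] right_diff_distrib[symmetric])
      ultimately show ?thesis by simp
    qed
    have mono: "p i \<le> p (Suc i)" "0 \<le> p i" for i using t by (auto simp: p_def divide_right_mono)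
    have top: "p i \<le> t" if "i \<le> Suc N" for i
    proof -
      have "t * real i \<le> t * real (Suc N)" using that t by (intro mult_left_mono) auto
      then show ?thesis by (simp add: p_def divide_le_eq)
    qed
    have main: "L \<le> Suc N \<Longrightarrow> \<bar>(\<Sum>i<L. f (p i) * (p (Suc i) - p i)) - integral {0..p L} f\<bar> \<le> e * p L" for L
    proof (induction L)
      case 0 then show ?case by (simp add: p_def)
    next
      case (Suc L)
      let ?I = "{p L..p (Suc L)}"
      have sub: "{0..p (Suc L)} \<subseteq> {0..t}" "?I \<subseteq> {0..t}" using top[OF Suc(2)] mono by (auto intro: order_trans)
      have int: "f integrable_on {0..p (Suc L)}" "f integrable_on ?I"
        using sub by (auto intro!: integrable_continuous_interval continuous_on_subset[OF f])
      have split: "integral {0..p (Suc L)} f = integral {0..p L} f + integral ?I f"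
        using Henstock_Kurzweil_Integration.integral_combine[OF mono(2)[of L] mono(1)[of L] int(1)] by simp
      have "norm (integral ?I (\<lambda>s. f (p L) - f s)) \<le> e * (p (Suc L) - p L)"
      proof (rule integral_bound[OF mono(1)])
        show "continuous_on ?I (\<lambda>s. f (p L) - f s)" by (intro continuous_intros continuous_on_subset[OF f sub(2)])
        fix s assume s: "s \<in> ?I"
        have "dist (f (p L)) (f s) < e"
          using s sub(2) gap[of L] mono(1)[of L] by (intro d(2)) (auto simp: dist_real_def)
        then show "norm (f (p L) - f s) \<le> e" by (simp add: dist_real_def)
      qed
      moreover have "integral ?I (\<lambda>s. f (p L) - f s) = f (p L) * (p (Suc L) - p L) - integral ?I f"
        using int(2) mono(1)[of L] by (subst Henstock_Kurzweil_Integration.integral_diff) auto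
      moreover have "\<bar>(\<Sum>i<L. f (p i) * (p (Suc i) - p i)) - integral {0..p L} f\<bar> \<le> e * p L" using Suc by simp
      ultimately have "\<bar>((\<Sum>i<L. f (p i) * (p (Suc i) - p i)) - integral {0..p L} f) + (f (p L) * (p (Suc L) - p L) - integral ?I f)\<bar>
          \<le> e * p L + e * (p (Suc L) - p L)" by simp
      also have "\<dots> = e * p (Suc L)" by (simp add: algebra_simps)
      finally show ?case unfolding split by (simp add: algebra_simps)
    qed
    have "p (Suc N) = t" by (simp add: p_def)
    then have "\<bar>(\<Sum>i<Suc N. f (p i) * (p (Suc i) - p i)) - integral {0..t} f\<bar> \<le> e * t" using main[of "Suc N"] by simp
    also have "\<dots> < r" using r t by (simp add: e_def)
    finally show "norm ((\<Sum>i<Suc N. f (t * real i / real (Suc N)) * (t * real (Suc i) / real (Suc N) - t * real i / real (Suc N))) - integral {0..t} f) < r"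
      unfolding p_def real_norm_def .
  qed
qed

lemma (in prob_space) second_moment_chebyshev:
  assumes [measurable]: "D \<in> borel_measurable M" and K: "(\<integral>\<^sup>+\<omega>. ennreal ((D \<omega>)\<^sup>2) \<partial>M) \<le> ennreal K" "0 \<le> K" and e: "0 < e"
  shows "prob {\<omega>\<in>space M. e < \<bar>D \<omega>\<bar>} \<le> K / e\<^sup>2"
proof -
  have "ennreal (prob {\<omega>\<in>space M. e < \<bar>D \<omega>\<bar>}) = emeasure M {\<omega>\<in>space M. e < \<bar>D \<omega>\<bar>}" by (simp add: emeasure_eq_measure)
  also have "\<dots> \<le> emeasure M ({\<omega>\<in>space M. 1 \<le> ennreal (1 / e\<^sup>2) * ennreal ((D \<omega>)\<^sup>2)} \<inter> space M)"
  proof (rule emeasure_mono, safe)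
    fix \<omega> assume w: "e < \<bar>D \<omega>\<bar>"
    then have "e\<^sup>2 \<le> \<bar>D \<omega>\<bar>\<^sup>2" using e by (intro power_mono) auto
    then have "1 \<le> 1 / e\<^sup>2 * (D \<omega>)\<^sup>2" using e by (simp add: field_simps)
    then show "1 \<le> ennreal (1 / e\<^sup>2) * ennreal ((D \<omega>)\<^sup>2)" by (subst ennreal_mult[symmetric]) (auto simp: ennreal_ge_1)
  qed measurable
  also have "\<dots> = emeasure M {\<omega>\<in>space M. 1 \<le> ennreal (1 / e\<^sup>2) * ennreal ((D \<omega>)\<^sup>2)}" by (rule arg_cong[where f="emeasure M"]) auto
  also have "\<dots> \<le> ennreal (1 / e\<^sup>2) * (\<integral>\<^sup>+\<omega>. ennreal ((D \<omega>)\<^sup>2) * indicator (space M) \<omega> \<partial>M)"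
    by (rule nn_integral_Markov_inequality) auto
  also have "(\<integral>\<^sup>+\<omega>. ennreal ((D \<omega>)\<^sup>2) * indicator (space M) \<omega> \<partial>M) = (\<integral>\<^sup>+\<omega>. ennreal ((D \<omega>)\<^sup>2) \<partial>M)"
    by (rule nn_integral_cong) simp
  also have "ennreal (1 / e\<^sup>2) * \<dots> \<le> ennreal (1 / e\<^sup>2) * ennreal K" by (rule mult_left_mono[OF K(1)]) simp
  also have "\<dots> = ennreal (K / e\<^sup>2)" using K e by (subst ennreal_mult[symmetric]) auto
  finally show ?thesis using K e by (subst (asm) ennreal_le_iff) auto
qed

text \<open>The condition \<open>s < T\<close> keeps the index of the next dyadic point within
  \<open>2 ^ j\<close>.\<close>

lemma dceil_facts:
  assumes T: "0 < T" and s: "0 \<le> s" "s < T"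
  shows "dfloor T j s + T / 2 ^ j \<in> dyads T"
proof -
  let ?n = "nat \<lfloor>s * 2 ^ j / T\<rfloor>"
  have "T * real ?n / 2 ^ j < T" using dfloor_facts(3)[OF T, of s j] s by (simp add: dfloor_def dyad_def)
  then have "real ?n < 2 ^ j" using T by (simp add: field_simps)
  then have "real ?n < real (2 ^ j)" by simp
  then have "?n < 2 ^ j" by (simp only: of_nat_less_iff)
  then have "dyad T j (Suc ?n) \<in> dyads T" by (intro dyadsI Suc_leI)
  also have "dyad T j (Suc ?n) = dfloor T j s + T / 2 ^ j" by (simp add: dfloor_def dyad_def field_simps)
  finally show ?thesis .
qed

context dyadic_limit
begin

text \<open>The points of an arbitrary partition are rounded down to dyadic level i. For large i
  they remain strictly increasing, their gaps grow by at most \<open>T / 2 ^ i\<close>, and 0 stays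
  fixed; path continuity makes the defects converge and Fatou's lemma concludes. The bound for every
  real partition is what \<open>ito_integral\<close> quantifies over.\<close>

lemma riemann_real:
  assumes p0: "p 0 = 0" and pT: "p L \<le> T" and p: "\<And>j. j < L \<Longrightarrow> p j < p (Suc j)"
    and \<delta>: "\<And>j. j < L \<Longrightarrow> p (Suc j) - p j \<le> \<delta>" "0 < \<delta>"
  shows "c = 4 * n + 2 \<and> s = n \<or> c = 4 * n + 3 \<and> s = Suc n \<Longrightarrow>
      (\<integral>\<^sup>+\<omega>. ennreal ((ito_defect (\<lambda>c t. Y c t \<omega>) c n s p L)\<^sup>2) \<partial>M) \<le> ennreal (riemann_const n s * \<delta>)"
    "(\<integral>\<^sup>+\<omega>. ennreal ((equation_defect (\<lambda>c t. Y c t \<omega>) n p L)\<^sup>2) \<partial>M) \<le> ennreal (equation_const n * \<delta>)"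
proof -
  define f where "f i j = dfloor T i (p j)" for i j
  have pj: "0 \<le> p j" "p j \<le> T" if "j \<le> L" for j
    using partition_mono[of L p 0 j] partition_mono[of L p j L] p p0 pT that by auto
  have fd: "f i j \<in> dyads T" and flim: "(\<lambda>i. f i j) \<longlonglongrightarrow> p j" if "j \<le> L" for i j
    unfolding f_def using dfloor_facts(2)[OF T_pos pj[OF that]] dfloor_tendsto[OF T_pos pj[OF that]] by auto
  have fT: "f i j \<in> {0..T}" if "j \<le> L" for i j using dyads_bounds[OF T_pos fd[OF that]] by auto
  have Ylim: "(\<lambda>i. Y c (f i j) \<omega>) \<longlonglongrightarrow> Y c (p j) \<omega>" if "j \<le> L" for c j \<omega>
    by (rule Y_tendsto[OF fT[OF that] flim[OF that]])
  have f0: "f i 0 = 0" for i by (simp add: f_def p0 dfloor_def dyad_def)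
  have lt: "\<forall>\<^sub>F i in sequentially. \<forall>j\<in>{..<L}. f i j < f i (Suc j)"
  proof (intro eventually_ball_finite ballI)
    fix j assume j: "j \<in> {..<L}"
    have "(\<lambda>i. f i (Suc j) - f i j) \<longlonglongrightarrow> p (Suc j) - p j" using j by (intro tendsto_diff flim) auto
    then have "\<forall>\<^sub>F i in sequentially. 0 < f i (Suc j) - f i j" using p[of j] j by (intro order_tendstoD) auto
    then show "\<forall>\<^sub>F i in sequentially. f i j < f i (Suc j)" by simp
  qed simp
  have gap: "f i (Suc j) - f i j \<le> \<delta> + T / 2 ^ i" if j: "j < L" for i j
  proof -
    have "f i (Suc j) \<le> p (Suc j)" unfolding f_def using dfloor_facts(3)[OF T_pos pj[of "Suc j"]] j by simp
    moreover have "p j < f i j + T / 2 ^ i" unfolding f_def using dfloor_facts(4)[OF T_pos pj[of j]] j by simp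
    ultimately show ?thesis using \<delta>(1)[OF j] by linarith
  qed
  have \<delta>i: "0 < \<delta> + T / 2 ^ i" for i using \<delta>(2) T_pos by (simp add: add_pos_pos)
  have clim: "(\<lambda>i. C * (\<delta> + T / 2 ^ i)) \<longlonglongrightarrow> C * \<delta>" for C
  proof -
    have "(\<lambda>i. C * (\<delta> + T / 2 ^ i)) \<longlonglongrightarrow> C * (\<delta> + 0)" by (intro tendsto_intros power_half_tendsto)
    then show ?thesis by simp
  qed
  note R = riemann_dyadic[where L=L, OF f0 fd _ gap \<delta>i]
  have lim: "AE \<omega> in M. (\<lambda>i. (ito_defect (\<lambda>c t. Y c t \<omega>) c n s (f i) L)\<^sup>2) \<longlonglongrightarrow> (ito_defect (\<lambda>c t. Y c t \<omega>) c n s p L)\<^sup>2"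
    "AE \<omega> in M. (\<lambda>i. (equation_defect (\<lambda>c t. Y c t \<omega>) n (f i) L)\<^sup>2) \<longlonglongrightarrow> (equation_defect (\<lambda>c t. Y c t \<omega>) n p L)\<^sup>2"
    using Ylim flim by (auto intro!: AE_I2 defect_tendsto)
  { assume cs: "c = 4 * n + 2 \<and> s = n \<or> c = 4 * n + 3 \<and> s = Suc n"
    show "(\<integral>\<^sup>+\<omega>. ennreal ((ito_defect (\<lambda>c t. Y c t \<omega>) c n s p L)\<^sup>2) \<partial>M) \<le> ennreal (riemann_const n s * \<delta>)"
    proof (rule nn_integral_limit_le[OF _ lim(1) _ clim])
      show "(\<lambda>\<omega>. (ito_defect (\<lambda>c t. Y c t \<omega>) c n s (f N) L)\<^sup>2) \<in> borel_measurable M" for N by (rule defect_measurable) simp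
      show "\<forall>\<^sub>F i in sequentially. (\<integral>\<^sup>+\<omega>. ennreal ((ito_defect (\<lambda>c t. Y c t \<omega>) c n s (f i) L)\<^sup>2) \<partial>M) \<le> ennreal (riemann_const n s * (\<delta> + T / 2 ^ i))"
        using lt by eventually_elim (rule R(1)[OF _ _ _ cs], auto)
    qed
  }
  show "(\<integral>\<^sup>+\<omega>. ennreal ((equation_defect (\<lambda>c t. Y c t \<omega>) n p L)\<^sup>2) \<partial>M) \<le> ennreal (equation_const n * \<delta>)"
  proof (rule nn_integral_limit_le[OF _ lim(2) _ clim])
    show "(\<lambda>\<omega>. (equation_defect (\<lambda>c t. Y c t \<omega>) n (f N) L)\<^sup>2) \<in> borel_measurable M" for N by (rule defect_measurable) simp
    show "\<forall>\<^sub>F i in sequentially. (\<integral>\<^sup>+\<omega>. ennreal ((equation_defect (\<lambda>c t. Y c t \<omega>) n (f i) L)\<^sup>2) \<partial>M) \<le> ennreal (equation_const n * (\<delta> + T / 2 ^ i))"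
      using lt by eventually_elim (rule R(2), auto)
  qed
qed

section \<open>The right-continuous filtration and the Brownian property\<close>

text \<open>Generated by the values of the modified processes Y, so that these are adapted on the
  exceptional set as well.\<close>

definition past_alg :: "real \<Rightarrow> 'b measure" where
  "past_alg s = vimage_algebra (space M) (\<lambda>\<omega>. restrict_past s (YY \<omega>)) borel"

text \<open>Right limits of the pasts, so that right-continuity is built in. Only times below T
  enter the intersection, and time T receives all of \<open>sets M\<close>, as
  \<open>filtered_prob_space\<close> prescribes.\<close>

definition filtration :: "real \<Rightarrow> 'b measure" where
  "filtration t = (if t < T then sigma (space M) (\<Inter>s\<in>{t<..<T}. sets (past_alg s)) else M)"

lemma space_past_alg [simp]: "space (past_alg s) = space M" by (simp add: past_alg_def)

lemma sets_past_alg: "sets (past_alg s) = {(\<lambda>\<omega>. restrict_past s (YY \<omega>)) -` B \<inter> space M | B. B \<in> sets borel}"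
  unfolding past_alg_def by (rule sets_vimage_algebra2) simp

lemma past_measurable [measurable]: "(\<lambda>\<omega>. restrict_past s (YY \<omega>)) \<in> borel_measurable M"
  by measurable

lemma past_alg_subset: "sets (past_alg s) \<subseteq> sets M"
  unfolding sets_past_alg using measurable_sets[OF past_measurable] by auto

lemma Y_past_measurable:
  assumes "u \<in> dyads T" "u \<le> s"
  shows "Y c u \<in> borel_measurable (past_alg s)"
proof -
  have "(\<lambda>\<omega>. restrict_past s (YY \<omega>)) \<in> past_alg s \<rightarrow>\<^sub>M borel"
    unfolding past_alg_def by (rule measurable_vimage_algebra1) simp
  then have "(\<lambda>\<omega>. restrict_past s (YY \<omega>) (dyad_index c u)) \<in> borel_measurable (past_alg s)"
    by (rule measurable_product_then_coordinatewise)
  then show ?thesis using assms by (simp add: restrict_past_def YY_code)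
qed

text \<open>An intersection of sigma-algebras over a non-empty index set is a sigma-algebra, so
  \<open>sigma\<close> adds no sets.\<close>

lemma sets_filtration: "t < T \<Longrightarrow> sets (filtration t) = (\<Inter>s\<in>{t<..<T}. sets (past_alg s))"
proof -
  assume t: "t < T"
  have ne: "{t<..<T} \<noteq> {}" using t by simp
  have "sigma_algebra (space M) (\<Inter>s\<in>{t<..<T}. sets (past_alg s))"
  proof (subst sigma_algebra_iff2, intro conjI ballI allI impI)
    show "(\<Inter>s\<in>{t<..<T}. sets (past_alg s)) \<subseteq> Pow (space M)"
      using ne sets.sets_into_space[where M="past_alg _"] by fastforce
    show "{} \<in> (\<Inter>s\<in>{t<..<T}. sets (past_alg s))" by auto
    show "space M - A \<in> (\<Inter>s\<in>{t<..<T}. sets (past_alg s))" if "A \<in> (\<Inter>s\<in>{t<..<T}. sets (past_alg s))" for A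
      using that sets.compl_sets[where M="past_alg _"] by auto
    show "\<Union> (range A) \<in> (\<Inter>s\<in>{t<..<T}. sets (past_alg s))" if "range A \<subseteq> (\<Inter>s\<in>{t<..<T}. sets (past_alg s))" for A :: "nat \<Rightarrow> 'b set"
      using that by (auto intro!: sets.countable_UN)
  qed
  then show ?thesis using t unfolding filtration_def by (simp add: sigma_algebra.sets_measure_of_eq)
qed

lemma space_filtration [simp]: "space (filtration t) = space M"
  by (simp add: filtration_def space_measure_of_conv)

lemma filtration_subset: "sets (filtration t) \<subseteq> sets M"
proof (cases "t < T")
  case True
  then have "(t + T) / 2 \<in> {t<..<T}" by (simp add: field_simps)
  then have "sets (filtration t) \<subseteq> sets (past_alg ((t + T) / 2))" unfolding sets_filtration[OF True] by (rule INF_lower)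
  then show ?thesis using past_alg_subset by blast
qed (simp add: filtration_def)

lemma filtration_mono: "s \<le> t \<Longrightarrow> t \<le> T \<Longrightarrow> sets (filtration s) \<subseteq> sets (filtration t)"
proof (cases "t < T")
  case True
  assume st: "s \<le> t"
  then show ?thesis using True unfolding sets_filtration[OF True] by (subst sets_filtration) auto
next
  case False
  then show ?thesis using filtration_subset by (simp add: filtration_def)
qed

lemma filtered: "filtered_prob_space M filtration T"
  unfolding filtered_prob_space_def
proof (intro conjI ballI allI impI)
  show "prob_space M" by (rule prob_space_axioms)
  show "space (filtration t) = space M" for t by simp
  show "sets (filtration t) \<subseteq> sets M" for t by (rule filtration_subset)
  show "sets (filtration s) \<subseteq> sets (filtration t)" if "0 \<le> s \<and> s \<le> t \<and> t \<le> T" for s t using that filtration_mono by blast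
  show "sets (filtration T) = sets M" by (simp add: filtration_def)
  fix t assume t: "0 \<le> t \<and> t < T"
  show "sets (filtration t) = (\<Inter>s\<in>{t<..T}. sets (filtration s))"
  proof
    show "sets (filtration t) \<subseteq> (\<Inter>s\<in>{t<..T}. sets (filtration s))" using filtration_mono by (intro INF_greatest) auto
    show "(\<Inter>s\<in>{t<..T}. sets (filtration s)) \<subseteq> sets (filtration t)"
    proof
      fix A assume A: "A \<in> (\<Inter>s\<in>{t<..T}. sets (filtration s))"
      have "A \<in> sets (past_alg u)" if u: "u \<in> {t<..<T}" for u
      proof -
        let ?s = "(t + u) / 2"
        have "?s \<in> {t<..T}" "?s < T" "u \<in> {?s<..<T}" using u by auto
        then have "A \<in> sets (filtration ?s)" using A by blast
        then show ?thesis unfolding sets_filtration[OF \<open>?s < T\<close>] using \<open>u \<in> {?s<..<T}\<close> by blast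
      qed
      then show "A \<in> sets (filtration t)" using t sets_filtration by simp
    qed
  qed
qed

text \<open>Rounded times never exceed t, so their values, and by continuity the value at t, are
  measurable for the past up to every later s below T.\<close>

lemma Y_adapted:
  assumes t: "t \<in> {0..T}"
  shows "Y c t \<in> borel_measurable (filtration t)"
proof (cases "t < T")
  case False
  then show ?thesis by (simp add: filtration_def)
next
  case True
  have "Y c t \<in> borel_measurable (past_alg s)" if s: "s \<in> {t<..<T}" for s
  proof (rule borel_measurable_LIMSEQ_real)
    have tt: "0 \<le> t" "t \<le> T" using t by auto
    show "Y c (dfloor T j t) \<in> borel_measurable (past_alg s)" for j
      using dfloor_facts(2,3)[OF T_pos tt, of j] s by (intro Y_past_measurable) auto
    show "(\<lambda>j. Y c (dfloor T j t) \<omega>) \<longlonglongrightarrow> Y c t \<omega>" for \<omega>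
      using dyads_bounds[OF T_pos dfloor_facts(2)[OF T_pos tt]] by (intro Y_tendsto dfloor_tendsto[OF T_pos tt]) auto
  qed
  then have "Y c t -` B \<inter> space M \<in> sets (past_alg s)" if "s \<in> {t<..<T}" "B \<in> sets borel" for s B
    using measurable_sets[of "Y c t" "past_alg s" borel B] that by simp
  then show ?thesis by (intro measurableI) (auto simp: sets_filtration[OF True])
qed

text \<open>An event known at time s lies in the past of every dyadic time strictly between s and T.
  Hence s is approached from above: independence holds for the increments from \<open>sj j\<close>
  to \<open>tj j\<close>, and path continuity carries it to the increment from s to t. This gives
  independence from the enlarged, right-continuous past.\<close>

lemma brownian: "brownian_motion M filtration T (\<lambda>t \<omega>. Y (4 * n + 1) t \<omega>)"
  unfolding brownian_motion_def
proof (intro conjI ballI allI impI)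
  show "Y (4 * n + 1) 0 \<omega> = 0" for \<omega> by (rule Y_W0)
  show "continuous_on {0..T} (\<lambda>t. Y (4 * n + 1) t \<omega>)" for \<omega> by (rule Y_continuous)
  show "(\<lambda>\<omega>. Y (4 * n + 1) t \<omega>) \<in> borel_measurable (filtration t)" if "t \<in> {0..T}" for t using Y_adapted[OF that] by simp
  fix s t assume st: "0 \<le> s \<and> s < t \<and> t \<le> T"
  then have s: "0 \<le> s" "s < T" "s \<le> T" and t: "0 \<le> t" "t \<le> T" by auto
  \<comment> \<open>Rounding down and adding one cell gives a dyadic time strictly above s even when
    s itself is dyadic.\<close>
  define sj where "sj j = dfloor T j s + T / 2 ^ j" for j
  define tj where "tj j = dfloor T j t" for j
  have sd: "sj j \<in> dyads T" and td: "tj j \<in> dyads T" for j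
    using dceil_facts[OF T_pos s(1,2)] dfloor_facts(2)[OF T_pos t] by (auto simp: sj_def tj_def)
  have slim: "sj \<longlonglongrightarrow> s"
  proof -
    have "(\<lambda>j. dfloor T j s + T / 2 ^ j) \<longlonglongrightarrow> s + 0" by (intro tendsto_add dfloor_tendsto[OF T_pos s(1,3)] power_half_tendsto)
    then show ?thesis by (simp add: sj_def[abs_def])
  qed
  have tlim: "tj \<longlonglongrightarrow> t" unfolding tj_def[abs_def] by (rule dfloor_tendsto[OF T_pos t])
  have ss: "s < sj j" for j unfolding sj_def by (rule dfloor_facts(4)[OF T_pos s(1,3)])
  have lt: "\<forall>\<^sub>F j in sequentially. sj j < tj j"
  proof -
    have "(\<lambda>j. tj j - sj j) \<longlonglongrightarrow> t - s" by (intro tendsto_diff slim tlim)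
    then have "\<forall>\<^sub>F j in sequentially. 0 < tj j - sj j" using st by (intro order_tendstoD) auto
    then show ?thesis by simp
  qed
  have sT: "\<forall>\<^sub>F j in sequentially. sj j < T" using s(2) slim by (intro order_tendstoD)
  have Ys: "(\<lambda>j. Y c (sj j) \<omega>) \<longlonglongrightarrow> Y c s \<omega>" and Yt: "(\<lambda>j. Y c (tj j) \<omega>) \<longlonglongrightarrow> Y c t \<omega>" for c \<omega>
    using dyads_bounds[OF T_pos sd] dyads_bounds[OF T_pos td] by (auto intro!: Y_tendsto slim tlim)
  let ?W = "\<lambda>t \<omega>. Y (4 * n + 1) t \<omega>"
  have law: "distr M borel (\<lambda>\<omega>. (?W t \<omega> - ?W s \<omega>) / sqrt (t - s)) = std_normal_distribution"
  proof (rule distr_limit[where U="\<lambda>j \<omega>. (?W (tj j) \<omega> - ?W (sj j) \<omega>) / sqrt (tj j - sj j)"])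
    show "AE \<omega> in M. (\<lambda>j. (?W (tj j) \<omega> - ?W (sj j) \<omega>) / sqrt (tj j - sj j)) \<longlonglongrightarrow> (?W t \<omega> - ?W s \<omega>) / sqrt (t - s)"
      using st by (intro AE_I2 tendsto_divide tendsto_diff tendsto_real_sqrt Ys Yt slim tlim) auto
    show "\<forall>\<^sub>F j in sequentially. distr M borel (\<lambda>\<omega>. (?W (tj j) \<omega> - ?W (sj j) \<omega>) / sqrt (tj j - sj j)) = std_normal_distribution"
      using lt by eventually_elim (rule W_law[OF sd td])
  qed measurable
  have "distributed M lborel (\<lambda>\<omega>. ((?W t \<omega> - ?W s \<omega>) - 0) / sqrt (t - s)) std_normal_density"
    unfolding distributed_def
  proof (intro conjI)
    have "distr M lborel (\<lambda>\<omega>. ((?W t \<omega> - ?W s \<omega>) - 0) / sqrt (t - s)) = distr M borel (\<lambda>\<omega>. (?W t \<omega> - ?W s \<omega>) / sqrt (t - s))"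
      by (rule distr_cong) auto
    then show "distr M lborel (\<lambda>\<omega>. ((?W t \<omega> - ?W s \<omega>) - 0) / sqrt (t - s)) = density lborel (\<lambda>x. ennreal (std_normal_density x))"
      using law by simp
  qed auto
  then show "distributed M lborel (\<lambda>\<omega>. ?W t \<omega> - ?W s \<omega>) (\<lambda>x. ennreal (normal_density 0 (sqrt (t - s)) x))"
    using st by (subst normal_standard_normal_convert) auto
  fix A B assume A: "A \<in> sets (filtration s)" and B: "B \<in> sets (borel :: real measure)"
  have AM: "A \<in> sets M" using A filtration_subset by blast
  have "indep_var borel (indicator A :: 'b \<Rightarrow> real) borel (\<lambda>\<omega>. ?W t \<omega> - ?W s \<omega>)"
  proof -
    \<comment> \<open>The same event A has its own Borel representation for each j; the
      corresponding indicators all agree with that of A once \<open>sj j < T\<close>, so their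
      sequence is eventually constant.\<close>
    have ex: "\<exists>C. C \<in> sets borel \<and> (sj j < T \<longrightarrow> A = (\<lambda>\<omega>. restrict_past (sj j) (YY \<omega>)) -` C \<inter> space M)" for j
    proof (cases "sj j < T")
      case True
      then have "A \<in> sets (past_alg (sj j))" using A ss unfolding sets_filtration[OF s(2)] by auto
      then show ?thesis unfolding sets_past_alg by auto
    qed auto
    then obtain C where C: "\<And>j. C j \<in> sets borel" "\<And>j. sj j < T \<Longrightarrow> A = (\<lambda>\<omega>. restrict_past (sj j) (YY \<omega>)) -` C j \<inter> space M"
      by metis
    show ?thesis
    proof (rule indep_var_limit[where U="\<lambda>j \<omega>. indicator (C j) (restrict_past (sj j) (YY \<omega>))" and U'="\<lambda>j \<omega>. ?W (tj j) \<omega> - ?W (sj j) \<omega>"])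
      show "(\<lambda>\<omega>. indicator (C j) (restrict_past (sj j) (YY \<omega>)) :: real) \<in> borel_measurable M" for j
        using C(1)[of j] by measurable
      show "(indicator A :: 'b \<Rightarrow> real) \<in> borel_measurable M" using AM by measurable
      show "AE \<omega> in M. (\<lambda>j. indicator (C j) (restrict_past (sj j) (YY \<omega>)) :: real) \<longlonglongrightarrow> indicator A \<omega>"
      proof (rule AE_I2)
        fix \<omega> assume w: "\<omega> \<in> space M"
        show "(\<lambda>j. indicator (C j) (restrict_past (sj j) (YY \<omega>)) :: real) \<longlonglongrightarrow> indicator A \<omega>"
        proof (rule tendsto_eventually)
          show "\<forall>\<^sub>F j in sequentially. (indicator (C j) (restrict_past (sj j) (YY \<omega>)) :: real) = indicator A \<omega>"
            using sT by eventually_elim (use C(2) w in \<open>auto simp: indicator_def\<close>)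
        qed
      qed
      show "AE \<omega> in M. (\<lambda>j. ?W (tj j) \<omega> - ?W (sj j) \<omega>) \<longlonglongrightarrow> ?W t \<omega> - ?W s \<omega>"
        by (intro AE_I2 tendsto_diff Ys Yt)
      show "\<forall>\<^sub>F j in sequentially. indep_var borel (\<lambda>\<omega>. indicator (C j) (restrict_past (sj j) (YY \<omega>)) :: real) borel (\<lambda>\<omega>. ?W (tj j) \<omega> - ?W (sj j) \<omega>)"
        using lt
      proof eventually_elim
        case (elim j)
        have "indep_var borel ((indicator (C j) :: _ \<Rightarrow> real) \<circ> (\<lambda>\<omega>. restrict_past (sj j) (YY \<omega>)))
            borel ((\<lambda>w. w 0) \<circ> (\<lambda>\<omega> (_::nat). ?W (tj j) \<omega> - ?W (sj j) \<omega>))"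
          by (rule indep_var_compose[OF past_indep[OF sd td elim]]) (use C(1)[of j] in auto)
        then show ?case by (simp add: comp_def)
      qed
    qed measurable
  qed
  from indep_varD[OF this, of "{1}" B]
  have "prob ((\<lambda>\<omega>. (indicator A \<omega> :: real, ?W t \<omega> - ?W s \<omega>)) -` ({1} \<times> B) \<inter> space M)
      = prob ((indicator A :: 'b \<Rightarrow> real) -` {1} \<inter> space M) * prob ((\<lambda>\<omega>. ?W t \<omega> - ?W s \<omega>) -` B \<inter> space M)"
    using B by simp
  moreover have "(\<lambda>\<omega>. (indicator A \<omega> :: real, ?W t \<omega> - ?W s \<omega>)) -` ({1} \<times> B) \<inter> space M = A \<inter> {\<omega> \<in> space M. ?W t \<omega> - ?W s \<omega> \<in> B}"
    using sets.sets_into_space[OF AM] by (auto simp: indicator_def split: if_splits)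
  moreover have "(indicator A :: 'b \<Rightarrow> real) -` {1} \<inter> space M = A"
    using sets.sets_into_space[OF AM] by (auto simp: indicator_def split: if_splits)
  moreover have "(\<lambda>\<omega>. ?W t \<omega> - ?W s \<omega>) -` B \<inter> space M = {\<omega> \<in> space M. ?W t \<omega> - ?W s \<omega> \<in> B}" by auto
  ultimately show "prob (A \<inter> {\<omega> \<in> space M. ?W t \<omega> - ?W s \<omega> \<in> B}) = prob A * prob {\<omega> \<in> space M. ?W t \<omega> - ?W s \<omega> \<in> B}" by simp
qed

text \<open>A path is a measurable function of its countably many dyadic values, through limits
  along \<open>dfloor\<close>. Independence of the sequences of dyadic values thus extends to the
  product sigma-algebra over all real times.\<close>

lemma W_paths_indep:
  "indep_vars (\<lambda>_. PiM {0..T} (\<lambda>_. borel)) (\<lambda>n \<omega>. restrict (\<lambda>t. Y (4 * n + 1) t \<omega>) {0..T}) {1..}"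
proof -
  let ?\<Psi> = "\<lambda>w. restrict (\<lambda>t. lim (\<lambda>j. w (to_nat_on (dyads T) (dfloor T j t)))) {0..T} :: real \<Rightarrow> real"
  have m: "?\<Psi> \<in> borel \<rightarrow>\<^sub>M PiM {0..T} (\<lambda>_. borel)"
    by (intro measurable_restrict borel_measurable_lim_metric measurable_product_coordinates)
  have "indep_vars (\<lambda>_. PiM {0..T} (\<lambda>_. borel)) (\<lambda>n \<omega>. ?\<Psi> (\<lambda>d. Y (4 * n + 1) (dyad_time d) \<omega>)) UNIV"
    by (rule indep_vars_compose2[OF W_indep m])
  moreover have "?\<Psi> (\<lambda>d. Y c (dyad_time d) \<omega>) = restrict (\<lambda>t. Y c t \<omega>) {0..T}" for c \<omega>
  proof (rule restrict_ext)
    fix t assume t: "t \<in> {0..T}"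
    then have tt: "0 \<le> t" "t \<le> T" by auto
    have d: "dfloor T j t \<in> dyads T" for j by (rule dfloor_facts(2)[OF T_pos tt])
    have "dyad_time (to_nat_on (dyads T) (dfloor T j t)) = dfloor T j t" for j
      unfolding dyad_time_def by (rule from_nat_into_to_nat_on[OF countable_dyads d])
    moreover have "(\<lambda>j. Y c (dfloor T j t) \<omega>) \<longlonglongrightarrow> Y c t \<omega>"
      using dyads_bounds[OF T_pos d] by (intro Y_tendsto dfloor_tendsto[OF T_pos tt]) auto
    ultimately show "lim (\<lambda>j. Y c (dyad_time (to_nat_on (dyads T) (dfloor T j t))) \<omega>) = Y c t \<omega>" by (simp add: limI)
  qed
  ultimately have "indep_vars (\<lambda>_. PiM {0..T} (\<lambda>_. borel)) (\<lambda>n \<omega>. restrict (\<lambda>t. Y (4 * n + 1) t \<omega>) {0..T}) UNIV" by simp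
  then show ?thesis by (rule indep_vars_subset) simp
qed

section \<open>Identification of the stochastic integrals and of the equation\<close>

text \<open>Mode 0 is replaced by an exact zero at all times and all points. The terms of the
  equations affected by this carry the factor \<open>k 0 = 0\<close>.\<close>

definition solution :: "nat \<Rightarrow> real \<Rightarrow> 'b \<Rightarrow> real" where "solution n t \<omega> = (if n = 0 then 0 else Y (4 * n) t \<omega>)"

lemma riemann_const_nonneg: "0 \<le> riemann_const n p" using T_pos X_const_nonneg[of p] by (simp add: riemann_const_def)

text \<open>Chebyshev's inequality turns the mean square bound \<open>C * \<delta>\<close> into a
  probability of at most \<open>C * \<delta> / e\<^sup>2\<close>; the choice of
  \<open>\<delta>\<close> as e^3 / (2 (C + 1)) makes this smaller than e.\<close>

lemma ito_of_riemann:
  assumes t: "t \<in> {0..T}" and I [measurable]: "I \<in> borel_measurable M"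
    and H [measurable]: "\<And>s. H s \<in> borel_measurable M" and W [measurable]: "\<And>s. W' s \<in> borel_measurable M" and C: "0 \<le> C"
    and est: "\<And>p L \<delta>. p 0 = 0 \<Longrightarrow> p L = t \<Longrightarrow> (\<And>j. j < L \<Longrightarrow> p j < p (Suc j)) \<Longrightarrow> (\<And>j. j < L \<Longrightarrow> p (Suc j) - p j \<le> \<delta>) \<Longrightarrow> 0 < \<delta> \<Longrightarrow>
      (\<integral>\<^sup>+\<omega>. ennreal ((I \<omega> - (\<Sum>j<L. H (p j) \<omega> * (W' (p (Suc j)) \<omega> - W' (p j) \<omega>)))\<^sup>2) \<partial>M) \<le> ennreal (C * \<delta>)"
  shows "ito_integral M H W' t I"
  unfolding ito_integral_def
proof (intro conjI allI impI I)
  fix e :: real assume e: "0 < e"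
  define \<delta> where "\<delta> = e ^ 3 / (C + 1) / 2"
  have \<delta>: "0 < \<delta>" using e C by (simp add: \<delta>_def)
  show "\<exists>\<delta>>0. \<forall>p N. p 0 = 0 \<and> p N = t \<and> (\<forall>i<N. p i < p (Suc i) \<and> p (Suc i) - p i < \<delta>) \<longrightarrow>
      prob {\<omega> \<in> space M. e < \<bar>(\<Sum>i<N. H (p i) \<omega> * (W' (p (Suc i)) \<omega> - W' (p i) \<omega>)) - I \<omega>\<bar>} < e"
  proof (intro exI[of _ \<delta>] conjI allI impI \<delta>)
    fix p N assume p: "p 0 = 0 \<and> p N = t \<and> (\<forall>i<N. p i < p (Suc i) \<and> p (Suc i) - p i < \<delta>)"
    let ?D = "\<lambda>\<omega>. I \<omega> - (\<Sum>j<N. H (p j) \<omega> * (W' (p (Suc j)) \<omega> - W' (p j) \<omega>))"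
    have "(\<integral>\<^sup>+\<omega>. ennreal ((?D \<omega>)\<^sup>2) \<partial>M) \<le> ennreal (C * \<delta>)" by (rule est) (use p \<delta> in \<open>auto intro: less_imp_le\<close>)
    then have "prob {\<omega>\<in>space M. e < \<bar>?D \<omega>\<bar>} \<le> C * \<delta> / e\<^sup>2" using C \<delta> e by (intro second_moment_chebyshev) auto
    also have "\<dots> < e"
    proof -
      have "0 < e ^ 3 * (C + 2)" using e C by simp
      then have "C * e ^ 3 < e ^ 3 * ((C + 1) * 2)" by (simp add: algebra_simps)
      then have "C * \<delta> < e ^ 3" using C by (simp add: \<delta>_def divide_less_eq)
      also have "e ^ 3 = e * e\<^sup>2" by (simp add: power3_eq_cube power2_eq_square)
      finally show ?thesis using e by (simp add: divide_less_eq)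
    qed
    finally show "prob {\<omega> \<in> space M. e < \<bar>(\<Sum>i<N. H (p i) \<omega> * (W' (p (Suc i)) \<omega> - W' (p i) \<omega>)) - I \<omega>\<bar>} < e"
      by (simp add: abs_minus_commute)
  qed
qed

lemma ito_component:
  assumes t: "t \<in> {0..T}" and cs: "c = 4 * n + 2 \<and> s = n \<or> c = 4 * n + 3 \<and> s = Suc n"
  shows "ito_integral M (\<lambda>u \<omega>. \<sigma> * k n * solution s u \<omega>) (\<lambda>u \<omega>. Y (4 * n + 1) u \<omega>) t (\<lambda>\<omega>. Y c t \<omega>)"
proof (rule ito_of_riemann[OF t _ _ _ riemann_const_nonneg[of n s]])
  have eq: "\<sigma> * k n * solution s u \<omega> = \<sigma> * k n * Y (4 * s) u \<omega>" for u \<omega>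
    using cs k0 by (cases "s = 0") (auto simp: solution_def)
  show "(\<lambda>\<omega>. \<sigma> * k n * solution s u \<omega>) \<in> borel_measurable M" for u unfolding eq by measurable
  fix p :: "nat \<Rightarrow> real" and L \<delta> assume p: "p 0 = 0" "p L = t" "\<And>j. j < L \<Longrightarrow> p j < p (Suc j)" "\<And>j. j < L \<Longrightarrow> p (Suc j) - p j \<le> \<delta>" "0 < \<delta>"
  show "(\<integral>\<^sup>+\<omega>. ennreal ((Y c t \<omega> - (\<Sum>j<L. \<sigma> * k n * solution s (p j) \<omega> * (Y (4 * n + 1) (p (Suc j)) \<omega> - Y (4 * n + 1) (p j) \<omega>)))\<^sup>2) \<partial>M) \<le> ennreal (riemann_const n s * \<delta>)"
    unfolding eq p(2)[symmetric] by (rule riemann_real(1)[unfolded ito_defect_def, OF _ _ _ _ _ cs]) (use p t in auto)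
qed measurable

lemma drift_continuous: "continuous_on {0..T} (\<lambda>s. drift n (\<lambda>m. Y (4 * m) s \<omega>))"
  unfolding drift_def by (intro continuous_intros Y_continuous)

text \<open>Along uniform partitions the defect tends to 0 in mean square, while the Riemann sums of
  the drift converge to the integral on every path. By Fatou's lemma the squared error has integral
  0. For t = 0 the partition has no cells, since its points must increase strictly.\<close>

lemma equation:
  assumes t: "t \<in> {0..T}"
  shows "AE \<omega> in M. Y (4 * Suc n) t \<omega> - x (Suc n) - Y (4 * n + 2) t \<omega> + Y (4 * Suc n + 3) t \<omega>
      - integral {0..t} (\<lambda>s. drift (Suc n) (\<lambda>m. Y (4 * m) s \<omega>)) = 0"
proof -
  let ?f = "\<lambda>\<omega> s. drift (Suc n) (\<lambda>m. Y (4 * m) s \<omega>)"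
  let ?E = "\<lambda>\<omega>. Y (4 * Suc n) t \<omega> - x (Suc n) - Y (4 * n + 2) t \<omega> + Y (4 * Suc n + 3) t \<omega>"
  let ?p = "\<lambda>N i. if t = 0 then 0 else t * real i / real (Suc N)"
  let ?S = "\<lambda>N \<omega>. \<Sum>i<(if t = 0 then 0 else Suc N). ?f \<omega> (?p N i) * (?p N (Suc i) - ?p N i)"
  \<comment> \<open>The added 1 keeps the bound on the mesh positive when t = 0.\<close>
  let ?\<delta> = "\<lambda>N. (t + 1) / real (Suc N)"
  have t0: "0 \<le> t" "t \<le> T" using t by auto
  have Sm: "?S N \<in> borel_measurable M" for N unfolding drift_def by measurable
  have Slim: "(\<lambda>N. ?S N \<omega>) \<longlonglongrightarrow> integral {0..t} (?f \<omega>)" for \<omega>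
  proof (cases "t = 0")
    case False
    then show ?thesis using riemann_sum_tendsto[of t "?f \<omega>"] t0 continuous_on_subset[OF drift_continuous, of "{0..t}"] by auto
  qed simp
  have c: "(\<lambda>N. equation_const n * ?\<delta> N) \<longlonglongrightarrow> equation_const n * 0"
    by (intro tendsto_intros LIMSEQ_Suc[OF lim_const_over_n])
  have "(\<integral>\<^sup>+\<omega>. ennreal ((?E \<omega> - integral {0..t} (?f \<omega>))\<^sup>2) \<partial>M) \<le> ennreal (equation_const n * 0)"
  proof (rule nn_integral_limit_le[OF _ _ _ c])
    show "(\<lambda>\<omega>. (?E \<omega> - ?S N \<omega>)\<^sup>2) \<in> borel_measurable M" for N using Sm by measurable
    show "AE \<omega> in M. (\<lambda>N. (?E \<omega> - ?S N \<omega>)\<^sup>2) \<longlonglongrightarrow> (?E \<omega> - integral {0..t} (?f \<omega>))\<^sup>2"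
      by (intro AE_I2 tendsto_power tendsto_diff tendsto_const Slim)
    show "\<forall>\<^sub>F N in sequentially. (\<integral>\<^sup>+\<omega>. ennreal ((?E \<omega> - ?S N \<omega>)\<^sup>2) \<partial>M) \<le> ennreal (equation_const n * ?\<delta> N)"
    proof (rule always_eventually, rule allI)
      fix N
      let ?L = "if t = 0 then 0 else Suc N"
      have "?p N ?L = t" by simp
      moreover have "(\<integral>\<^sup>+\<omega>. ennreal ((Y (4 * Suc n) (?p N ?L) \<omega> - x (Suc n) - Y (4 * n + 2) (?p N ?L) \<omega> + Y (4 * Suc n + 3) (?p N ?L) \<omega> - ?S N \<omega>)\<^sup>2) \<partial>M)
          \<le> ennreal (equation_const n * ?\<delta> N)"
      proof (rule riemann_real(2)[where p="?p N" and L="?L", unfolded equation_defect_def])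
        show "?p N ?L \<le> T" using t0 by simp
        show "?p N j < ?p N (Suc j)" if "j < ?L" for j using that t0 by (auto simp: divide_strict_right_mono split: if_splits)
        show "?p N (Suc j) - ?p N j \<le> ?\<delta> N" if "j < ?L" for j
        proof -
          have "t * real (Suc j) / real (Suc N) - t * real j / real (Suc N) = t / real (Suc N)"
            by (simp add: diff_divide_distrib[symmetric] right_diff_distrib[symmetric])
          also have "\<dots> \<le> ?\<delta> N" by (intro divide_right_mono) auto
          finally show ?thesis using that by (auto split: if_splits)
        qed
        show "0 < ?\<delta> N" using t0 by simp
      qed simp
      ultimately show "(\<integral>\<^sup>+\<omega>. ennreal ((?E \<omega> - ?S N \<omega>)\<^sup>2) \<partial>M) \<le> ennreal (equation_const n * ?\<delta> N)" by simp
    qed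
  qed
  then have "(\<integral>\<^sup>+\<omega>. ennreal ((?E \<omega> - integral {0..t} (?f \<omega>))\<^sup>2) \<partial>M) = 0" by simp
  moreover have "(\<lambda>\<omega>. integral {0..t} (?f \<omega>)) \<in> borel_measurable M"
    by (rule borel_measurable_LIMSEQ_real[OF Slim Sm])
  ultimately show ?thesis
    by (subst (asm) nn_integral_0_iff_AE) (measurable, auto)
qed

text \<open>The equations start at n = 1, whereas the scheme carries a mode 0 that must vanish;
  \<open>x'\<close> may therefore differ from \<open>x\<close> at index 0.\<close>

lemma weak_solution_limit:
  assumes x': "\<And>n. 1 \<le> n \<Longrightarrow> x' n = x n"
  shows "weak_solution T \<sigma> k x' M filtration (\<lambda>n t \<omega>. Y (4 * n + 1) t \<omega>) solution"
  unfolding weak_solution_def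
proof (intro conjI allI impI ballI)
  show "filtered_prob_space M filtration T" by (rule filtered)
  show "brownian_motion M filtration T (Y (4 * n + 1))" for n using brownian by simp
  show "indep_vars (\<lambda>_. PiM {0..T} (\<lambda>_. borel)) (\<lambda>n \<omega>. restrict (\<lambda>t. Y (4 * n + 1) t \<omega>) {0..T}) {1..}" by (rule W_paths_indep)
  show "solution 0 t \<omega> = 0" for t \<omega> by (simp add: solution_def)
  show "continuous_on {0..T} (\<lambda>t. solution n t \<omega>)" if "1 \<le> n" for n \<omega> using that Y_continuous by (simp add: solution_def)
  show "solution n t \<in> borel_measurable (filtration t)" if "1 \<le> n" "t \<in> {0..T}" for n t
    using that Y_adapted by (simp add: solution_def[abs_def])
  show "summable (\<lambda>n. (solution n t \<omega>)\<^sup>2)" if "t \<in> {0..T}" for t \<omega>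
  proof (rule summableI_nonneg_bounded[of _ "R\<^sup>2"])
    have "(\<Sum>n<m. (solution n t \<omega>)\<^sup>2) \<le> (\<Sum>n<m. (Y (4 * n) t \<omega>)\<^sup>2)" for m by (intro sum_mono) (simp add: solution_def)
    then show "(\<Sum>n<m. (solution n t \<omega>)\<^sup>2) \<le> R\<^sup>2" for m using Y_energy[OF that, where m=m and \<omega>=\<omega>] by (rule order_trans)
  qed simp
  fix n :: nat and t assume n: "1 \<le> n" and t: "t \<in> {0..T}"
  then obtain m where m: "n = Suc m" by (cases n) auto
  let ?d1 = "\<lambda>\<omega> s. k (n - 1) * (solution (n - 1) s \<omega>)\<^sup>2 - k n * solution n s \<omega> * solution (Suc n) s \<omega>"
  let ?d2 = "\<lambda>\<omega> s. \<sigma>\<^sup>2 / 2 * ((k n)\<^sup>2 + (k (n - 1))\<^sup>2) * solution n s \<omega>"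
  have XXc: "continuous_on {0..t} (\<lambda>s. solution j s \<omega>)" for j \<omega>
  proof (rule continuous_on_subset[of "{0..T}"])
    show "continuous_on {0..T} (\<lambda>s. solution j s \<omega>)" using Y_continuous by (cases "j = 0") (simp_all add: solution_def)
  qed (use t in auto)
  have split: "integral {0..t} (\<lambda>s. drift (Suc m) (\<lambda>j. Y (4 * j) s \<omega>)) = integral {0..t} (?d1 \<omega>) - integral {0..t} (?d2 \<omega>)" for \<omega>
  proof -
    have "drift (Suc m) (\<lambda>j. Y (4 * j) s \<omega>) = ?d1 \<omega> s - ?d2 \<omega> s" for s
    proof -
      have "k m * (Y (4 * m) s \<omega>)\<^sup>2 = k m * (solution m s \<omega>)\<^sup>2" by (cases "m = 0") (simp_all add: solution_def k0)
      then show ?thesis by (simp add: drift_def m solution_def)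
    qed
    \<comment> \<open>The drift of the scheme contains the Ito correction, while the equation states
      it as a separate integral; continuity of the paths allows the integral to be split.\<close>
    then show ?thesis
      by (simp only:) (intro Henstock_Kurzweil_Integration.integral_diff integrable_continuous_interval continuous_intros XXc)
  qed
  show "\<exists>I1 I2. ito_integral M (\<lambda>s \<omega>. \<sigma> * k (n - 1) * solution (n - 1) s \<omega>) (Y (4 * (n - 1) + 1)) t I1 \<and>
      ito_integral M (\<lambda>s \<omega>. \<sigma> * k n * solution (Suc n) s \<omega>) (Y (4 * n + 1)) t I2 \<and>
      (AE \<omega> in M. solution n t \<omega> = x' n + integral {0..t} (?d1 \<omega>) + I1 \<omega> - I2 \<omega> - integral {0..t} (?d2 \<omega>))"
  proof (intro exI conjI)
    show "ito_integral M (\<lambda>s \<omega>. \<sigma> * k (n - 1) * solution (n - 1) s \<omega>) (Y (4 * (n - 1) + 1)) t (\<lambda>\<omega>. Y (4 * m + 2) t \<omega>)"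
      using ito_component[OF t, of "4 * m + 2" m m] by (simp add: m)
    show "ito_integral M (\<lambda>s \<omega>. \<sigma> * k n * solution (Suc n) s \<omega>) (Y (4 * n + 1)) t (\<lambda>\<omega>. Y (4 * n + 3) t \<omega>)"
      using ito_component[OF t, of "4 * n + 3" n "Suc n"] by simp
    show "AE \<omega> in M. solution n t \<omega> = x' n + integral {0..t} (?d1 \<omega>) + Y (4 * m + 2) t \<omega> - Y (4 * n + 3) t \<omega> - integral {0..t} (?d2 \<omega>)"
      using equation[OF t, of m]
    proof eventually_elim
      case (elim \<omega>)
      then have "Y (4 * n) t \<omega> - x n - Y (4 * m + 2) t \<omega> + Y (4 * n + 3) t \<omega> - (integral {0..t} (?d1 \<omega>) - integral {0..t} (?d2 \<omega>)) = 0"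
        unfolding split m .
      moreover have "solution n t \<omega> = Y (4 * n) t \<omega>" using n by (simp add: solution_def)
      ultimately show ?case using x'[OF n] by linarith
    qed
  qed
qed

lemma solution_suminf_le:
  assumes "t \<in> {0..T}"
  shows "(\<Sum>n. (solution n t \<omega>)\<^sup>2) \<le> R\<^sup>2"
proof (rule suminf_le_const)
  have le: "(\<Sum>n<m. (solution n t \<omega>)\<^sup>2) \<le> R\<^sup>2" for m
  proof -
    have "(\<Sum>n<m. (solution n t \<omega>)\<^sup>2) \<le> (\<Sum>n<m. (Y (4 * n) t \<omega>)\<^sup>2)" by (intro sum_mono) (simp add: solution_def)
    then show ?thesis using Y_energy[OF assms, where m=m and \<omega>=\<omega>] by (rule order_trans)
  qed
  then show "(\<Sum>n<m. (solution n t \<omega>)\<^sup>2) \<le> R\<^sup>2" for m .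
  show "summable (\<lambda>n. (solution n t \<omega>)\<^sup>2)" by (rule summableI_nonneg_bounded[OF _ le]) simp
qed

end

theorem theorem2:
  fixes T \<sigma> :: real and k x :: "nat \<Rightarrow> real"
  assumes "T > 0" and "\<sigma> \<noteq> 0" and "k 0 = 0" and "\<forall>n\<ge>1. k n > 0"
    and "summable (\<lambda>n. (x n)\<^sup>2)"
  shows "\<exists>(M :: (nat \<Rightarrow> real \<Rightarrow> real) measure) F W X.
           weak_solution T \<sigma> k x M F W X \<and>
           (\<exists>C>0. AE z in M \<Otimes>\<^sub>M restrict_space lborel {0..T}.
                     (\<Sum>n. (X n (snd z) (fst z))\<^sup>2) \<le> C)"
proof -
  \<comment> \<open>The entry of index 0 is cleared to meet the convention of the scheme; this can
    only lower the energy.\<close>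
  define y where "y = x(0 := 0)"
  define R where "R = sqrt (\<Sum>n. (x n)\<^sup>2)"
  have s0: "0 \<le> (\<Sum>n. (x n)\<^sup>2)" by (rule suminf_nonneg[OF assms(5)]) simp
  interpret dyadic T \<sigma> k y R
  proof
    show "0 \<le> R" using s0 by (simp add: R_def)
    fix n
    have "(\<Sum>j<n. (y j)\<^sup>2) \<le> (\<Sum>j<n. (x j)\<^sup>2)" by (intro sum_mono) (simp add: y_def)
    also have "\<dots> \<le> (\<Sum>n. (x n)\<^sup>2)" by (rule sum_le_suminf[OF assms(5)]) auto
    also have "\<dots> = R\<^sup>2" using s0 by (simp add: R_def)
    finally show "(\<Sum>j<n. (y j)\<^sup>2) \<le> R\<^sup>2" .
  qed (use assms in \<open>auto simp: y_def\<close>)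
  have "\<exists>(M :: real measure) r Z V. prob_space M \<and> strict_mono (r :: nat \<Rightarrow> nat) \<and>
    (\<forall>N. Z N \<in> borel_measurable M) \<and> V \<in> borel_measurable M \<and>
    (\<forall>N. distr M borel (Z N) = distr gauss_space borel (samples (r N))) \<and> (AE \<omega> in M. \<forall>i. (\<lambda>N. Z N \<omega> i) \<longlonglongrightarrow> V \<omega> i)"
    by (rule skorohod_sequence[OF gauss.prob_space_axioms _ samples_tight]) simp
  then obtain M0 :: "real measure" and r Z0 V0 where M0: "prob_space M0" "strict_mono (r :: nat \<Rightarrow> nat)"
    "\<And>N. Z0 N \<in> borel_measurable M0" "V0 \<in> borel_measurable M0"
    "\<And>N. distr M0 borel (Z0 N) = distr gauss_space borel (samples (r N))" "AE \<omega> in M0. \<forall>i. (\<lambda>N. Z0 N \<omega> i) \<longlonglongrightarrow> V0 \<omega> i"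
    by blast
  obtain M :: "(nat \<Rightarrow> real \<Rightarrow> real) measure" and Z V where M: "prob_space M"
    "\<And>N. Z N \<in> borel_measurable M" "V \<in> borel_measurable M" "\<And>N. distr M borel (Z N) = distr M0 borel (Z0 N)"
    "AE \<omega> in M. \<forall>i. (\<lambda>N. Z N \<omega> i) \<longlonglongrightarrow> V \<omega> i"
    using real_space_embedding[OF M0(1,3,4,6)] by blast
  interpret prob_space M by fact
  interpret dyadic_limit T \<sigma> k y R M r Z V
    by unfold_locales (use M M0 in auto)
  have "weak_solution T \<sigma> k x M filtration (\<lambda>n t \<omega>. Y (4 * n + 1) t \<omega>) solution"
    by (rule weak_solution_limit) (simp add: y_def)
  \<comment> \<open>The energy bound holds at every point and time. The added 1 makes the constant
    positive also for a vanishing initial condition.\<close>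
  moreover have "AE z in M \<Otimes>\<^sub>M restrict_space lborel {0..T}. (\<Sum>n. (solution n (snd z) (fst z))\<^sup>2) \<le> R\<^sup>2 + 1"
  proof (rule AE_I2)
    fix z assume "z \<in> space (M \<Otimes>\<^sub>M restrict_space lborel {0..T})"
    then have "snd z \<in> {0..T}" by (auto simp: space_pair_measure space_restrict_space)
    from solution_suminf_le[OF this, of "fst z"] show "(\<Sum>n. (solution n (snd z) (fst z))\<^sup>2) \<le> R\<^sup>2 + 1" by simp
  qed
  moreover have "0 < R\<^sup>2 + 1" by (simp add: add_nonneg_pos)
  ultimately show ?thesis by blast
qed

end
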